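(* Let $\Omega\subset\mathbb{R}^2$ be an open connected set, let $A\in L^2(\Omega)$ be a real vector-valued function $A=(A_1,A_2):\Omega\to\mathbb{R}^2$, and let $v\in W^{2,2}_{loc}(\Omega)$ be any solution of $$\Delta v+A\cdot\nabla v=0\quad\text{in }\Omega.$$ Suppose that for some $z_0\in\Omega$ the following holds: for every $N\in\mathbb{N}$ there exist $C_N>0$ and $r_N>0$ such that $$|v(z)-v(z_0)|\le C_N|z-z_0|^N\quad\text{for all } |z-z_0|<r_N.$$ Then $v(z)=v(z_0)$ for all $z\in\Omega$.
   Context: The equation holds almost everywhere; $v$ may be real- or complex-valued. Functions in $W^{2,2}_{loc}$ in two dimensions are identified with their continuous representatives. *)

theory Defs
  imports "HOL-Analysis.Analysis"
begin

definition partial_deriv :: "'n::finite \<Rightarrow> (real ^ 'n \<Rightarrow> real) \<Rightarrow> real ^ 'n \<Rightarrow> real" where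
  "partial_deriv i \<phi> x = frechet_derivative \<phi> (at x) (axis i 1)"

primrec Ck :: "nat \<Rightarrow> (real ^ 'n::finite \<Rightarrow> real) \<Rightarrow> bool" where
  "Ck 0 \<phi> \<longleftrightarrow> continuous_on UNIV \<phi>"
| "Ck (Suc k) \<phi> \<longleftrightarrow> (\<forall>x. \<phi> differentiable (at x)) \<and> (\<forall>i. Ck k (partial_deriv i \<phi>))"

definition test_function :: "(real ^ 'n::finite) set \<Rightarrow> (real ^ 'n \<Rightarrow> real) \<Rightarrow> bool" where
  "test_function \<Omega> \<phi> \<longleftrightarrow>
     (\<forall>k. Ck k \<phi>) \<and> compact (closure {x. \<phi> x \<noteq> 0}) \<and> closure {x. \<phi> x \<noteq> 0} \<subseteq> \<Omega>"

definition L1_loc :: "(real ^ 'n::finite) set \<Rightarrow> (real ^ 'n \<Rightarrow> 'a::euclidean_space) \<Rightarrow> bool" where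
  "L1_loc \<Omega> u \<longleftrightarrow> (\<forall>K. compact K \<and> K \<subseteq> \<Omega> \<longrightarrow> set_integrable lebesgue K u)"

definition L2_on :: "(real ^ 'n::finite) set \<Rightarrow> (real ^ 'n \<Rightarrow> 'a::euclidean_space) \<Rightarrow> bool" where
  "L2_on S u \<longleftrightarrow>
     set_borel_measurable lebesgue S u \<and> set_integrable lebesgue S (\<lambda>x. (norm (u x))\<^sup>2)"

definition L2_loc :: "(real ^ 'n::finite) set \<Rightarrow> (real ^ 'n \<Rightarrow> 'a::euclidean_space) \<Rightarrow> bool" where
  "L2_loc \<Omega> u \<longleftrightarrow> (\<forall>K. compact K \<and> K \<subseteq> \<Omega> \<longrightarrow> L2_on K u)"

definition has_weak_partial ::
  "(real ^ 'n::finite) set \<Rightarrow> 'n \<Rightarrow> (real ^ 'n \<Rightarrow> 'a::euclidean_space) \<Rightarrow> (real ^ 'n \<Rightarrow> 'a) \<Rightarrow> bool" where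
  "has_weak_partial \<Omega> i u g \<longleftrightarrow> L1_loc \<Omega> u \<and> L1_loc \<Omega> g \<and>
     (\<forall>\<phi>. test_function \<Omega> \<phi> \<longrightarrow>
        (LINT x:\<Omega>|lebesgue. partial_deriv i \<phi> x *\<^sub>R u x) = - (LINT x:\<Omega>|lebesgue. \<phi> x *\<^sub>R g x))"

(* Weak derivatives are determined only up to null sets; weak_partial selects one representative,
   so statements about it are meaningful only almost everywhere (and only if one exists). *)
definition weak_partial ::
  "(real ^ 'n::finite) set \<Rightarrow> 'n \<Rightarrow> (real ^ 'n \<Rightarrow> 'a::euclidean_space) \<Rightarrow> real ^ 'n \<Rightarrow> 'a" where
  "weak_partial \<Omega> i u = (SOME g. has_weak_partial \<Omega> i u g)"

(* The local Sobolev space W^{k,2}_loc(\<Omega>). *)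
primrec W2_loc :: "nat \<Rightarrow> (real ^ 'n::finite) set \<Rightarrow> (real ^ 'n \<Rightarrow> 'a::euclidean_space) \<Rightarrow> bool" where
  "W2_loc 0 \<Omega> u \<longleftrightarrow> L2_loc \<Omega> u"
| "W2_loc (Suc k) \<Omega> u \<longleftrightarrow>
     L2_loc \<Omega> u \<and> (\<forall>i. \<exists>g. has_weak_partial \<Omega> i u g \<and> W2_loc k \<Omega> g)"

definition weak_laplacian ::
  "(real ^ 'n::finite) set \<Rightarrow> (real ^ 'n \<Rightarrow> 'a::euclidean_space) \<Rightarrow> real ^ 'n \<Rightarrow> 'a" where
  "weak_laplacian \<Omega> u x = (\<Sum>i\<in>UNIV. weak_partial \<Omega> i (weak_partial \<Omega> i u) x)"

end

(*
The proof is an energy estimate for the logarithm of the gradient. Take v real-valued (apply the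
argument to each component of v - v z0), let g be its gradient and q = |g|^2. Where g does not
vanish, w = ln |g| satisfies div (grad w - (Laplace v) g / q) = 0: this is the closedness of the
angle form of g, and it uses that the dimension is two. Since |Laplace v| / |g| <= |A| lies in L^2,
the equation for w has its right-hand side in divergence form with an L^2 field. Subtracting the
harmonic function n ln |z - p| does not change this. If v vanishes to infinite order at p, then so
does g, so the positive part of w - n ln (|z - p| / rho) does not see the singularity at p, and
testing with it bounds its L^2 norm by norms of A and of g on the ball of radius 2 rho,
independently of n. Letting n tend to infinity forces g = 0 near p.

No smallness of A is used, so the radius of the ball on which v is constant depends only on the
distance from p to the boundary. Hence the set of points near which v equals v z0 is closed in
the domain, as well as open.

All computations are made on mollifications of v and with |z - p|^2 + delta^2 in place of
|z - p|^2, so that every function involved is smooth.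
*)
theory Submission
  imports Defs
begin

section \<open>Partial derivatives and integration by parts\<close>

text \<open>The obstacle is that mollification destroys the equation: the mollified Laplacian is not
  bounded by a mollified |A| times the mollified gradient, so (Laplace v)^2 / q is out of control
  where the mollified gradient is small. The energy estimate is therefore stated for arbitrary
  smooth functions, without any equation. Its multiplier is such that the Laplacian enters with the
  factor s / (1 + s q) instead of 1 / q, where s is the n-th power of \<rho>^2 / (|z - p|^2 +
  \<delta>^2). For fixed n and \<delta> this factor is bounded, so the mollified squares of the
  Laplacian, which converge in L^1, pass to the limit. Only then is the equation used, in the form s
  (Laplace v)^2 / (1 + s q) \<le> |A|^2. Accordingly n is fixed first, \<delta> is chosen depending
  on n, and the limit of the mollifications is taken for fixed n and \<delta>. The limit \<delta> ->
  0 is never taken; one small \<delta> for each n is enough.\<close>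

definition has_partial :: "'n::finite \<Rightarrow> (real ^ 'n \<Rightarrow> real) \<Rightarrow> (real ^ 'n \<Rightarrow> real) \<Rightarrow> bool" where
  "has_partial i F F' \<longleftrightarrow> (\<forall>x. ((\<lambda>t. F (x + t *\<^sub>R axis i 1)) has_real_derivative F' x) (at 0))"

lemma has_partialD: "has_partial i F F' \<Longrightarrow> ((\<lambda>t. F (x + t *\<^sub>R axis i 1)) has_real_derivative F' x)
    (at 0)"
  by (simp add: has_partial_def)

lemma has_partial_line:
  assumes "has_partial i F F'"
  shows "((\<lambda>t. F (x + t *\<^sub>R axis i 1)) has_real_derivative F' (x + t0 *\<^sub>R axis i 1)) (at t0)"
proof -
  have "((\<lambda>t. F ((x + t0 *\<^sub>R axis i 1) + t *\<^sub>R axis i 1)) has_real_derivative F' (x + t0 *\<^sub>R axis i 1))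
      (at 0)"
    using assms by (rule has_partialD)
  then show ?thesis
    using DERIV_shift[of "\<lambda>t. F (x + t *\<^sub>R axis i 1)" "F' (x + t0 *\<^sub>R axis i 1)" 0 t0]
    by (simp add: algebra_simps scaleR_add_left)
qed

lemma integrable_continuous_bounded_support:
  fixes f :: "'a::euclidean_space \<Rightarrow> real"
  assumes "continuous_on UNIV f" and "\<And>x. x \<notin> cball p r \<Longrightarrow> f x = 0"
  shows "integrable lborel f"
proof -
  have "integrable lborel (\<lambda>x. indicator (cball p r) x *\<^sub>R f x)"
    by (rule borel_integrable_compact) (auto intro: continuous_on_subset[OF assms(1)])
  moreover have "(\<lambda>x. indicator (cball p r) x *\<^sub>R f x) = f"
  proof
    fix x show "indicator (cball p r) x *\<^sub>R f x = f x"
      using assms(2)[of x] by (cases "x \<in> cball p r") (auto simp del: mem_cball)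
  qed
  ultimately show ?thesis by simp
qed

lemma lborel_integrable_translation:
  fixes f :: "'a::euclidean_space \<Rightarrow> real"
  assumes "integrable lborel f"
  shows "integrable lborel (\<lambda>x. f (x + c))"
proof -
  have "integrable (distr lborel borel ((+) c)) f"
    using assms by (simp add: lborel_distr_plus)
  then show ?thesis
    using assms by (subst (asm) integrable_distr_eq) (auto simp: add.commute)
qed

lemma lborel_integral_translation:
  fixes f :: "'a::euclidean_space \<Rightarrow> real"
  assumes "f \<in> borel_measurable borel"
  shows "(LINT x|lborel. f (x + c)) = (LINT x|lborel. f x)"
proof -
  have "(LINT x|lborel. f x) = (LINT x|distr lborel borel ((+) c). f x)"
    by (simp add: lborel_distr_plus)
  also have "\<dots> = (LINT x|lborel. f (x + c))"
    using assms by (subst integral_distr) (auto simp: add.commute)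
  finally show ?thesis by simp
qed

lemma continuous_bounded_support_bounded:
  fixes f :: "'a::euclidean_space \<Rightarrow> real"
  assumes "continuous_on UNIV f" and "\<And>x. x \<notin> cball p r \<Longrightarrow> f x = 0"
  shows "\<exists>B\<ge>0. \<forall>x. \<bar>f x\<bar> \<le> B"
proof -
  have "bounded (f ` cball p r)"
    by (intro compact_imp_bounded compact_continuous_image compact_cball
        continuous_on_subset[OF assms(1)]) auto
  then obtain B where B: "\<And>x. x \<in> cball p r \<Longrightarrow> \<bar>f x\<bar> \<le> B"
    unfolding bounded_iff by (auto simp del: mem_cball)
  have "\<bar>f x\<bar> \<le> max B 0" for x
    using B[of x] assms(2)[of x] by (cases "x \<in> cball p r") auto
  then show ?thesis by (intro exI[of _ "max B 0"]) auto
qed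

text \<open>Translation invariance does the work of Fubini: the integral of every difference
  quotient of \<open>F\<close> is 0, and the quotients converge to \<open>F'\<close> under a bound
  from the mean value theorem. So derivatives along coordinate lines, as in
  \<open>has_partial\<close>, together with continuity are all that integration by parts
  requires.\<close>

lemma integral_partial_eq_0:
  fixes F :: "real ^ 'n::finite \<Rightarrow> real"
  assumes der: "has_partial i F F'" and cont: "continuous_on UNIV F" "continuous_on UNIV F'"
    and supp: "\<And>x. x \<notin> cball p r \<Longrightarrow> F x = 0" "\<And>x. x \<notin> cball p r \<Longrightarrow> F' x = 0"
  shows "(LINT x|lborel. F' x) = 0"
proof -
  obtain B where B: "B \<ge> 0" "\<And>x. \<bar>F' x\<bar> \<le> B"
    using continuous_bounded_support_bounded[OF cont(2) supp(2)] by blast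
  define h where "h n = 1 / real (Suc n)" for n
  have h: "h n > 0" "h n \<le> 1" for n by (auto simp: h_def field_simps)
  have hlim: "h \<longlonglongrightarrow> 0"
    unfolding h_def using LIMSEQ_inverse_real_of_nat by (simp add: divide_inverse)
  have [measurable]: "F \<in> borel_measurable borel" "F' \<in> borel_measurable borel"
    using cont by (auto intro: borel_measurable_continuous_onI)
  have intF: "integrable lborel F"
    by (rule integrable_continuous_bounded_support[OF cont(1) supp(1)])
  let ?D = "\<lambda>n x. (F (x + h n *\<^sub>R axis i 1) - F x) / h n"
  have "(\<lambda>n. LINT x|lborel. ?D n x) \<longlonglongrightarrow> (LINT x|lborel. F' x)"
  \<comment> \<open>Radius \<open>r + 1\<close>: a step of length \<open>h n \<le> 1\<close> cannot
    reach the support from further out.\<close>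
  proof (rule integral_dominated_convergence[where w = "\<lambda>x. B * indicator (cball p (r + 1)) x"])
    show "integrable lborel (\<lambda>x. B * indicator (cball p (r + 1)) x)"
      by (auto intro!: integrable_mult_right integrable_real_indicator emeasure_bounded_finite)
    show "AE x in lborel. (\<lambda>n. ?D n x) \<longlonglongrightarrow> F' x"
    proof (rule AE_I2)
      fix x
      have "((\<lambda>t. (F (x + t *\<^sub>R axis i 1) - F x) / t) \<longlongrightarrow> F' x) (at 0)"
        using has_partialD[OF der, of x] by (simp add: DERIV_def)
      moreover have "filterlim h (at 0) sequentially"
        using hlim h by (auto simp: filterlim_at intro!: always_eventually) (metis less_irrefl)
      ultimately show "(\<lambda>n. ?D n x) \<longlonglongrightarrow> F' x" by (rule filterlim_compose)
    qed
    fix n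
    show "AE x in lborel. norm (?D n x) \<le> B * indicator (cball p (r + 1)) x"
    proof (rule AE_I2)
      fix x
      obtain t where t: "0 < t" "t < h n"
        "F (x + h n *\<^sub>R axis i 1) - F (x + 0 *\<^sub>R axis i 1) = (h n - 0) * F' (x + t *\<^sub>R axis i 1)"
        using MVT2[of 0 "h n" "\<lambda>t. F (x + t *\<^sub>R axis i 1)" "\<lambda>t. F' (x + t *\<^sub>R axis i 1)"]
          has_partial_line[OF der] h(1) by blast
      then have eq: "?D n x = F' (x + t *\<^sub>R axis i 1)" using h(1)[of n] by (simp add: field_simps)
      show "norm (?D n x) \<le> B * indicator (cball p (r + 1)) x"
      proof (cases "x \<in> cball p (r + 1)")
        case True
        then show ?thesis using B eq by simp
      next
        case False
        have "dist p x \<le> dist p (x + t *\<^sub>R axis i 1) + t"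
          using dist_triangle[of p x "x + t *\<^sub>R axis i 1"] t by (simp add: dist_norm)
        then have "x + t *\<^sub>R axis i 1 \<notin> cball p r" using False t h(2)[of n] by auto
        then have "F' (x + t *\<^sub>R axis i 1) = 0" by (rule supp(2))
        then show ?thesis unfolding eq using B(1) by simp
      qed
    qed
  qed simp_all
  moreover have "(LINT x|lborel. ?D n x) = 0" for n
  proof -
    have "(LINT x|lborel. F (x + h n *\<^sub>R axis i 1) - F x) = 0"
      using lborel_integrable_translation[OF intF] lborel_integral_translation[of F] intF
      by (subst Bochner_Integration.integral_diff) auto
    then show ?thesis by simp
  qed
  ultimately show ?thesis by (simp only: LIMSEQ_const_iff)
qed

section \<open>Mollifiers\<close>

text \<open>The powers of \<open>t\<close> in the denominator make the family closed under
  differentiation up to linear combinations, see \<open>flat_deriv\<close>. So a limit has to be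
  computed only at \<open>t = 0\<close>.\<close>

definition flat :: "nat \<Rightarrow> real \<Rightarrow> real" where
  "flat m t = (if t > 0 then exp (- (1 / t)) / t ^ m else 0)"

text \<open>A single term of the series of exp (1 / t) outweighs the denominator. The square of
  \<open>t\<close> on the right makes the difference quotient at 0 tend to 0.\<close>

lemma flat_bound: "\<bar>flat m t\<bar> \<le> fact (m + 2) * t\<^sup>2"
proof (cases "t > 0")
  case True
  have "inverse (fact n) *\<^sub>R y ^ n \<le> exp y" if "y \<ge> 0" for y :: real and n
    using sum_le_suminf[OF summable_exp_generic[of y], of "{n}"] that
    by (simp add: exp_def)
  from this[of "1 / t" "m + 2"] have "(1 / t) ^ (m + 2) / fact (m + 2) \<le> exp (1 / t)"
    using True by (simp add: divide_inverse mult.commute)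
  moreover define A :: real where "A = fact (m + 2)"
  ultimately have "1 \<le> exp (1 / t) * A * t ^ (m + 2)" "A > 0"
    using True by (simp_all add: field_simps power_divide del: fact_Suc power_Suc)
  then show ?thesis
    using True unfolding A_def[symmetric]
    by (auto simp: flat_def exp_minus field_simps power_add power2_eq_square)
qed (auto simp: flat_def)

lemma flat_deriv: "(flat m has_real_derivative (flat (m + 2) t - real m * flat (m + 1) t)) (at t)"
proof -
  consider "t > 0" | "t = 0" | "t < 0" by linarith
  then show ?thesis
  proof cases
    case 1
    have p: "((\<lambda>t. t ^ m) has_real_derivative real m * t ^ m / t) (at t)"
      using DERIV_pow[of m t UNIV] 1 by (cases m) auto
    have "((\<lambda>t. exp (- (1 / t)) / t ^ m) has_real_derivative
        (flat (m + 2) t - real m * flat (m + 1) t)) (at t)"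
      using 1 by (auto intro!: derivative_eq_intros p simp: flat_def divide_simps power2_eq_square
          power_add) (auto simp: algebra_simps, cases m, auto)
    moreover have "eventually (\<lambda>t. t > 0) (nhds t)" using 1
        by (intro eventually_nhds_in_open[of "{0<..}", simplified]) auto
    then have "eventually (\<lambda>t. exp (- (1 / t)) / t ^ m = flat m t) (nhds t)"
      by eventually_elim (auto simp: flat_def)
    ultimately show ?thesis by (subst (asm) DERIV_cong_ev[OF refl _ refl]) 
  next
    case 2
    have "((\<lambda>h. flat m h / h) \<longlongrightarrow> 0) (at 0)"
    proof (rule Lim_null_comparison)
      show "\<forall>\<^sub>F h in at 0. norm (flat m h / h) \<le> fact (m + 2) * \<bar>h\<bar>"
      proof (rule eventually_mono[OF eventually_at_filter[THEN iffD2, OF always_eventually]])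
        show "\<forall>h::real. h \<noteq> 0 \<longrightarrow> h \<in> UNIV \<longrightarrow> h \<noteq> 0" by simp
        fix h :: real assume "h \<noteq> 0"
        then show "norm (flat m h / h) \<le> fact (m + 2) * \<bar>h\<bar>"
          using flat_bound[of m h]
          by (simp add: pos_divide_le_eq mult.assoc abs_mult[symmetric] power2_eq_square[symmetric]
              del: fact_Suc abs_mult)
      qed
      show "((\<lambda>h. fact (m + 2) * \<bar>h\<bar>) \<longlongrightarrow> (0::real)) (at 0)"
        by (auto intro!: tendsto_eq_intros)
    qed
    then show ?thesis using 2 by (simp add: DERIV_def flat_def)
  next
    case 3
    have "((\<lambda>t. 0) has_real_derivative (flat (m + 2) t - real m * flat (m + 1) t)) (at t)"
      using 3 by (auto intro!: derivative_eq_intros simp: flat_def)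
    moreover have "eventually (\<lambda>t. t < 0) (nhds t)" using 3
        by (intro eventually_nhds_in_open[of "{..<0}", simplified]) auto
    then have "eventually (\<lambda>t. 0 = flat m t) (nhds t)"
      by eventually_elim (auto simp: flat_def)
    ultimately show ?thesis by (subst (asm) DERIV_cong_ev[OF refl _ refl]) 
  qed
qed

text \<open>Finite sums of products that vanish to infinite order at both ends of
  [-\<epsilon>, \<epsilon>]. The set contains a derivative of each of its members, so all
  derivatives of a bump are obtained by iterating inside it.\<close>

inductive_set bumps :: "real \<Rightarrow> (real \<Rightarrow> real) set" for \<epsilon> where
  bumps_flat: "(\<lambda>t. c * (flat m (\<epsilon> - t) * flat k (\<epsilon> + t))) \<in> bumps \<epsilon>"
| bumps_add: "f \<in> bumps \<epsilon> \<Longrightarrow> g \<in> bumps \<epsilon> \<Longrightarrow> (\<lambda>t. f t + g t) \<in> bumps \<epsilon>"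

lemma bumps_deriv:
  assumes "f \<in> bumps \<epsilon>"
  shows "\<exists>g\<in>bumps \<epsilon>. \<forall>t. (f has_real_derivative g t) (at t)"
  using assms
proof induction
  case (bumps_flat c m k)
  let ?e = "\<lambda>c m k t. c * (flat m (\<epsilon> - t) * flat k (\<epsilon> + t))"
  let ?g = "\<lambda>t. (?e (- c) (m + 2) k t + ?e (c * m) (m + 1) k t)
      + (?e c m (k + 2) t + ?e (- (c * k)) m (k + 1) t)"
  have "((\<lambda>t. ?e c m k t) has_real_derivative ?g t) (at t)" for t
    by (auto intro!: derivative_eq_intros DERIV_chain2[OF flat_deriv] simp: algebra_simps)
  moreover have "?g \<in> bumps \<epsilon>"
    by (intro bumps.intros)
  ultimately show ?case by (intro bexI[of _ ?g]) simp_all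
next
  case (bumps_add f g)
  then obtain f' g' where "f' \<in> bumps \<epsilon>" "\<And>t. (f has_real_derivative f' t) (at t)"
    "g' \<in> bumps \<epsilon>" "\<And>t. (g has_real_derivative g' t) (at t)" by blast
  then show ?case
    by (intro bexI[of _ "\<lambda>t. f' t + g' t"]) (auto intro!: derivative_intros bumps.bumps_add)
qed

lemma bumps_support: "f \<in> bumps \<epsilon> \<Longrightarrow> \<epsilon> \<le> \<bar>t\<bar> \<Longrightarrow> f t = 0"
  by (induction rule: bumps.induct) (auto simp: flat_def)

text \<open>\<open>H n\<close> is the \<open>n\<close>-th derivative of a bump \<open>H 0\<close> supported in
  \<open>[-\<epsilon>, \<epsilon>]\<close>. With the product kernel \<open>H 0 (x $ 1) * H 0 (x $ 2)\<close> all mixed partial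
  derivatives of a mollification are explicit and symmetric.\<close>

definition mollifier :: "real \<Rightarrow> (nat \<Rightarrow> real \<Rightarrow> real) \<Rightarrow> bool" where
  "mollifier \<epsilon> H \<longleftrightarrow> (\<forall>n t. (H n has_real_derivative H (Suc n) t) (at t)) \<and>
     (\<forall>n t. \<epsilon> \<le> \<bar>t\<bar> \<longrightarrow> H n t = 0) \<and> (\<forall>t. 0 \<le> H 0 t) \<and>
     (LINT x|lborel. H 0 ((x::real^2) $ 1) * H 0 (x $ 2)) = 1"

lemma mollifier_exists:
  assumes "\<epsilon> > 0"
  shows "\<exists>H. mollifier \<epsilon> H"
proof -
  \<comment> \<open>The factor 1 gives \<open>f\<close> the literal form of
    \<open>bumps_flat\<close>.\<close>
  define f where "f t = 1 * (flat 0 (\<epsilon> - t) * flat 0 (\<epsilon> + t))" for t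
  have "\<exists>H. (H 0 = f \<and> H 0 \<in> bumps \<epsilon>) \<and> (\<forall>n. (H (Suc n) \<in> bumps \<epsilon>)
      \<and> (\<forall>t. (H n has_real_derivative H (Suc n) t) (at t)))"
  proof -
    have "\<exists>H. \<forall>n. (H n \<in> bumps \<epsilon> \<and> (n = 0 \<longrightarrow> H n = f))
        \<and> (\<forall>t. (H n has_real_derivative H (Suc n) t) (at t))"
      by (rule dependent_nat_choice) (use bumps_flat[of 1 0 \<epsilon> 0] bumps_deriv in \<open>auto simp:
          f_def[abs_def] Bex_def\<close>)
    then show ?thesis by blast
  qed
  then obtain H where H0: "H 0 = f" and H: "\<And>n. H n \<in> bumps \<epsilon>"
      "\<And>n t. (H n has_real_derivative H (Suc n) t) (at t)"
    by (metis not0_implies_Suc)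
  have fnn: "f t \<ge> 0" for t by (auto simp: f_def flat_def)
  have fcont: "continuous_on UNIV f"
    using H(2)[of 0] H0 by (auto intro!: DERIV_continuous_on)
  define \<rho> where "\<rho> x = f (x $ 1) * f (x $ 2)" for x :: "real^2"
  have cont: "continuous_on UNIV \<rho>"
    unfolding \<rho>_def by (intro continuous_intros continuous_on_compose2[OF fcont]) auto
  have supp: "\<rho> x = 0" if "x \<notin> cball 0 (2 * \<epsilon>)" for x
  proof (rule ccontr)
    assume "\<rho> x \<noteq> 0"
    then have "\<bar>x $ 1\<bar> < \<epsilon>" "\<bar>x $ 2\<bar> < \<epsilon>"
      using bumps_support[OF H(1)[of 0]] unfolding H0 \<rho>_def by (force simp: not_le[symmetric])+
    then have "norm x \<le> 2 * \<epsilon>" using norm_le_l1_cart[of x] by (simp add: sum_2)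
    then show False using that by simp
  qed
  have int: "integrable lborel \<rho>"
    by (rule integrable_continuous_bounded_support[OF cont supp])
  define I where "I = (LINT x|lborel. \<rho> x)"
  \<comment> \<open>\<open>\<rho>\<close> is continuous and nonzero at 0, and a nonempty open set is
    not negligible.\<close>
  have "I \<noteq> 0"
  proof
    assume "I = 0"
    then have "AE x in lborel. \<rho> x = 0"
      using int fnn unfolding I_def by (subst (asm) integral_nonneg_eq_0_iff_AE) (auto simp: \<rho>_def)
    moreover have "open {x. \<rho> x \<noteq> 0}"
      using continuous_open_preimage[OF cont open_UNIV, of "-{0}"] by (auto simp: vimage_def)
    ultimately have "{x. \<rho> x \<noteq> 0} \<in> null_sets lborel"
      using AE_iff_null_sets[of "{x. \<rho> x \<noteq> 0}" lborel] by simp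
    then have "negligible {x. \<rho> x \<noteq> 0}"
      by (simp add: negligible_iff_null_sets null_sets_completionI)
    then have "{x. \<rho> x \<noteq> 0} = {}"
      using open_not_negligible \<open>open {x. \<rho> x \<noteq> 0}\<close> by blast
    then have "\<rho> 0 = 0" by blast
    then show False using assms by (simp add: \<rho>_def f_def flat_def)
  qed
  moreover have "I \<ge> 0" unfolding I_def using fnn by (intro integral_nonneg_AE) (auto simp: \<rho>_def)
  ultimately have I: "I > 0" by simp
  \<comment> \<open>The kernel is a product of two factors, hence the square root. All derivatives
    are divided by the same constant, so \<open>G (Suc n)\<close> remains the derivative of
    \<open>G n\<close>.\<close>
  define G where "G n t = H n t / sqrt I" for n t
  have "mollifier \<epsilon> G"
    unfolding mollifier_def
  proof (intro conjI allI impI)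
    show "(G n has_real_derivative G (Suc n) t) (at t)" for n t
      unfolding G_def using I by (intro DERIV_cdivide H(2))
    show "\<epsilon> \<le> \<bar>t\<bar> \<Longrightarrow> G n t = 0" for n t
      using bumps_support[OF H(1)] by (simp add: G_def)
    show "0 \<le> G 0 t" for t using I fnn by (simp add: G_def H0)
    have "G 0 (x $ 1) * G 0 (x $ 2) = \<rho> x / I" for x :: "real^2"
      using I by (simp add: G_def H0 \<rho>_def)
    then show "(LINT x|lborel. G 0 ((x::real^2) $ 1) * G 0 (x $ 2)) = 1"
      using I by (simp add: I_def[symmetric])
  qed
  then show ?thesis by (rule exI[of _ G])
qed

section \<open>Convolution with the product kernel\<close>

lemma lborel_integral_reflect:
  fixes f :: "'a::euclidean_space \<Rightarrow> real"
  assumes [measurable]: "f \<in> borel_measurable borel"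
  shows "(LINT y|lborel. f (x - y)) = (LINT y|lborel. f y)"
proof -
  have "(lborel :: 'a measure) = distr lborel borel (\<lambda>y. x - y)"
    using lborel_affine[of "-1" x] by (simp add: density_1)
  then have "(LINT y|lborel. f y) = (LINT y|distr lborel borel (\<lambda>y. x - y). f y)"
    by metis
  also have "\<dots> = (LINT y|lborel. f (x - y))"
    by (subst integral_distr) auto
  finally show ?thesis by simp
qed

lemma borel_measurable_vec_nth' [measurable (raw)]:
  fixes f :: "'b \<Rightarrow> real ^ 'n::finite"
  assumes "f \<in> borel_measurable M"
  shows "(\<lambda>x. f x $ i) \<in> borel_measurable M"
proof -
  have "(\<lambda>y :: real ^ 'n. y $ i) \<in> borel_measurable borel"
    by (intro borel_measurable_continuous_onI continuous_intros)
  then show ?thesis by (rule measurable_compose[OF assms])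
qed

text \<open>The mixed derivative, of order \<open>i\<close> in the first and \<open>j\<close> in the
  second variable, of the mollification of \<open>u\<close>. All derivatives sit on the kernel, so
  it makes sense for every integrable \<open>u\<close>.\<close>

definition conv :: "(nat \<Rightarrow> real \<Rightarrow> real) \<Rightarrow> nat \<Rightarrow> nat \<Rightarrow> (real^2 \<Rightarrow> real) \<Rightarrow> real^2 \<Rightarrow> real" where
  "conv H i j u x = (LINT y|lborel. H i (x $ 1 - y $ 1) * H j (x $ 2 - y $ 2) * u y)"

context
  fixes \<epsilon> :: real and H :: "nat \<Rightarrow> real \<Rightarrow> real"
  assumes moll: "mollifier \<epsilon> H"
begin

lemma mollD: "(H n has_real_derivative H (Suc n) t) (at t)" "\<epsilon> \<le> \<bar>t\<bar> \<Longrightarrow> H n t = 0" "0 \<le> H 0 t"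
  "(LINT x|lborel. H 0 ((x::real^2) $ 1) * H 0 (x $ 2)) = 1"
  using moll by (auto simp: mollifier_def)

lemma moll_cont: "continuous_on S (H n)"
  using mollD(1) by (meson DERIV_continuous_on has_field_derivative_at_within)

lemma moll_measurable: "H n \<in> borel_measurable borel"
  by (intro borel_measurable_continuous_onI moll_cont)

lemma moll_bounded: "\<exists>B\<ge>0. \<forall>t. \<bar>H n t\<bar> \<le> B"
proof (rule continuous_bounded_support_bounded[OF moll_cont])
  show "x \<notin> cball 0 \<epsilon> \<Longrightarrow> H n x = 0" for x using mollD(2)[of x n] by auto
qed

text \<open>The support is a square of half side \<epsilon>. Bounding the norm by the sum of the
  absolute coordinates gives the radius \<open>2 * \<epsilon>\<close> that appears in every
  localisation below.\<close>

lemma kernel_support: "H i (x $ 1 - y $ 1) * H j (x $ 2 - y $ 2) \<noteq> 0 \<Longrightarrow> dist x (y :: real^2) \<le> 2 * \<epsilon>"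
proof -
  assume "H i (x $ 1 - y $ 1) * H j (x $ 2 - y $ 2) \<noteq> 0"
  then have "\<bar>x $ 1 - y $ 1\<bar> < \<epsilon>" "\<bar>x $ 2 - y $ 2\<bar> < \<epsilon>"
    using mollD(2) by (force simp: not_le[symmetric])+
  then show ?thesis using norm_le_l1_cart[of "x - y"] by (simp add: sum_2 dist_norm)
qed

lemma kernel_continuous: "continuous_on UNIV (\<lambda>y :: real^2. H i (x $ 1 - y $ 1) * H j
    (x $ 2 - y $ 2))"
  by (intro continuous_intros continuous_on_compose2[OF moll_cont]) auto

lemma kernel_integral:
  fixes x :: "real^2"
  shows "(LINT y|lborel. H 0 (x $ 1 - y $ 1) * H 0 (x $ 2 - (y::real^2) $ 2)) = 1"
  using lborel_integral_reflect[of "\<lambda>y::real^2. H 0 (y $ 1) * H 0 (y $ 2)" x] mollD(4)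
      moll_measurable by simp

lemma kernel_integrable:
  fixes x :: "real^2"
  shows "integrable lborel (\<lambda>y :: real^2. H i (x $ 1 - y $ 1) * H j (x $ 2 - y $ 2))"
  using kernel_support by (intro integrable_continuous_bounded_support[OF kernel_continuous, of x
      "2 * \<epsilon>"]) auto

lemma kernel_integral':
  fixes y :: "real^2"
  shows "(LINT x|lborel. H 0 ((x::real^2) $ 1 - y $ 1) * H 0 (x $ 2 - y $ 2)) = 1"
  using lborel_integral_translation[of "\<lambda>y::real^2. H 0 (y $ 1) * H 0 (y $ 2)" "-y"] mollD(4)
      moll_measurable by simp

lemma kernel_integrable':
  fixes y :: "real^2"
  shows "integrable lborel (\<lambda>x :: real^2. H 0 (x $ 1 - y $ 1) * H 0 (x $ 2 - y $ 2))"
  \<comment> \<open>The integral of a non-integrable function is 0 by convention, so the value 1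
    already shows integrability.\<close>
  using kernel_integral'[of y] not_integrable_integral_eq by fastforce

lemma conv_integrable:
  fixes x :: "real^2"
  assumes "integrable lborel u"
  shows "integrable lborel (\<lambda>y. H i (x $ 1 - y $ 1) * H j (x $ 2 - (y::real^2) $ 2) * u y)"
proof -
  note [measurable] = moll_measurable
  obtain B1 B2 where B: "B1 \<ge> 0" "B2 \<ge> 0" "\<And>t. \<bar>H i t\<bar> \<le> B1" "\<And>t. \<bar>H j t\<bar> \<le> B2"
    using moll_bounded by metis
  have [measurable]: "u \<in> borel_measurable borel" using assms by simp
  show ?thesis
    by (rule Bochner_Integration.integrable_bound[of _ "\<lambda>y. B1 * B2 * \<bar>u y\<bar>"])
      (use assms B in \<open>auto simp: abs_mult intro!: mult_mono AE_I2\<close>)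
qed

lemma conv_continuous:
  assumes "integrable lborel u"
  shows "continuous_on UNIV (conv H i j u)"
proof -
  note [measurable] = moll_measurable
  obtain B1 B2 where B: "B1 \<ge> 0" "B2 \<ge> 0" "\<And>t. \<bar>H i t\<bar> \<le> B1" "\<And>t. \<bar>H j t\<bar> \<le> B2"
    using moll_bounded by metis
  have [measurable]: "u \<in> borel_measurable borel" using assms by simp
  have "(\<lambda>n. conv H i j u (X n)) \<longlonglongrightarrow> conv H i j u x" if "X \<longlonglongrightarrow> x" for X x
    unfolding conv_def
  proof (rule integral_dominated_convergence[where w="\<lambda>y. B1 * B2 * \<bar>u y\<bar>"])
    show "AE y in lborel. (\<lambda>n. H i (X n $ 1 - y $ 1) * H j (X n $ 2 - y $ 2) * u y)
        \<longlonglongrightarrow> H i (x $ 1 - y $ 1) * H j (x $ 2 - y $ 2) * u y"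
      by (intro AE_I2 tendsto_mult tendsto_const
          continuous_on_tendsto_compose[OF moll_cont[of UNIV]]
          tendsto_diff tendsto_vec_nth that) auto
  qed (use assms B in \<open>auto simp: abs_mult intro!: mult_mono AE_I2\<close>)
  then show ?thesis by (auto simp: continuous_on_sequentially o_def)
qed

text \<open>The derivative falls on the kernel. Dominated convergence applies because the difference
  quotients of \<open>H n\<close> are bounded by any bound for \<open>H (Suc n)\<close>.\<close>

lemma conv_has_partial:
  assumes u: "integrable lborel u"
  shows "has_partial 1 (conv H i j u) (conv H (Suc i) j u)"
      "has_partial 2 (conv H i j u) (conv H i (Suc j) u)"
proof -
  have [measurable]: "u \<in> borel_measurable borel" using assms by simp
  note [measurable] = moll_measurable
  have quot: "\<bar>(H n (t + s) - H n t) / s\<bar> \<le> B" if B: "\<And>t. \<bar>H (Suc n) t\<bar> \<le> B" "B \<ge> 0" for n t s B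
  proof (cases "s = 0")
    case False
    have "norm (H n (t + s) - H n t) \<le> B * norm (t + s - t)"
      by (rule field_differentiable_bound[of UNIV "H n" "H (Suc n)"]) (use mollD(1) B in auto)
    then show ?thesis using False by (simp add: field_simps)
  qed (use B in simp)
  have lim: "(\<lambda>k. (H n (t + s k) - H n t) / s k) \<longlonglongrightarrow> H (Suc n) t"
    if "s \<longlonglongrightarrow> 0" "\<And>k. s k \<noteq> 0" for n t s
  proof (rule filterlim_compose[of "\<lambda>h. (H n (t + h) - H n t) / h"])
    show "((\<lambda>h. (H n (t + h) - H n t) / h) \<longlongrightarrow> H (Suc n) t) (at 0)"
      using mollD(1)[of n t] by (simp add: DERIV_def)
    show "filterlim s (at 0) sequentially"
      using that by (simp add: filterlim_at)
  qed
  have seq: "((\<lambda>t. F (x + t *\<^sub>R axis l 1)) has_real_derivative D) (at 0)"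
    if "\<And>s. s \<longlonglongrightarrow> 0 \<Longrightarrow> (\<And>k. s k \<noteq> 0) \<Longrightarrow> (\<lambda>k. (F (x + s k *\<^sub>R axis l 1) - F x) / s k) \<longlonglongrightarrow> D"
    for F :: "real^2 \<Rightarrow> real" and x l D
    using that unfolding DERIV_def by (simp add: tendsto_at_iff_sequentially o_def)
  obtain Bi where Bi: "Bi \<ge> 0" "\<And>t. \<bar>H i t\<bar> \<le> Bi" using moll_bounded by metis
  obtain Bj where Bj: "Bj \<ge> 0" "\<And>t. \<bar>H j t\<bar> \<le> Bj" using moll_bounded by metis
  obtain Ci where Ci: "Ci \<ge> 0" "\<And>t. \<bar>H (Suc i) t\<bar> \<le> Ci" using moll_bounded by metis
  obtain Cj where Cj: "Cj \<ge> 0" "\<And>t. \<bar>H (Suc j) t\<bar> \<le> Cj" using moll_bounded by metis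
  have i12: "(1::2) \<noteq> 2" by simp
  show "has_partial 1 (conv H i j u) (conv H (Suc i) j u)"
    unfolding has_partial_def
  proof (intro allI seq)
    fix x :: "real^2" and s assume s: "s \<longlonglongrightarrow> (0::real)" "\<And>k. s k \<noteq> 0"
    let ?f = "\<lambda>k y. (H i (x $ 1 - y $ 1 + s k) - H i (x $ 1 - y $ 1)) / s k * H j (x $ 2 - y $ 2) *
        u y"
    have "(\<lambda>k. LINT y|lborel. ?f k y) \<longlonglongrightarrow> conv H (Suc i) j u x"
      unfolding conv_def
    proof (rule integral_dominated_convergence[where w="\<lambda>y. Ci * Bj * \<bar>u y\<bar>"])
      show "AE y in lborel. (\<lambda>k. ?f k y) \<longlonglongrightarrow> H (Suc i) (x $ 1 - y $ 1) * H j (x $ 2 - y $ 2) * u y"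
        by (intro AE_I2 tendsto_mult tendsto_const lim s)
      show "AE y in lborel. norm (?f k y) \<le> Ci * Bj * \<bar>u y\<bar>" for k
        unfolding real_norm_def abs_mult
        by (intro AE_I2 mult_right_mono mult_mono quot Ci Bj abs_ge_zero)
    qed (use u in auto)
    moreover have "(LINT y|lborel. ?f k y) = (conv H i j u (x + s k *\<^sub>R axis 1 1) - conv H i j u x) /
        s k" for k
      unfolding conv_def using s(2)[of k] 
      by (subst Bochner_Integration.integral_diff[symmetric, OF conv_integrable[OF u]
          conv_integrable[OF u]])
        (auto simp: axis_def field_simps intro!: Bochner_Integration.integral_cong
          simp flip: Bochner_Integration.integral_divide_zero)
    ultimately show "(\<lambda>k. (conv H i j u (x + s k *\<^sub>R axis 1 1) - conv H i j u x) / s k)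
        \<longlonglongrightarrow> conv H (Suc i) j u x"
      by (simp only:)
  qed
  show "has_partial 2 (conv H i j u) (conv H i (Suc j) u)"
    unfolding has_partial_def
  proof (intro allI seq)
    fix x :: "real^2" and s assume s: "s \<longlonglongrightarrow> (0::real)" "\<And>k. s k \<noteq> 0"
    let ?f = "\<lambda>k y. H i (x $ 1 - y $ 1) * ((H j (x $ 2 - y $ 2 + s k) - H j (x $ 2 - y $ 2)) / s k)
        * u y"
    have "(\<lambda>k. LINT y|lborel. ?f k y) \<longlonglongrightarrow> conv H i (Suc j) u x"
      unfolding conv_def
    proof (rule integral_dominated_convergence[where w="\<lambda>y. Bi * Cj * \<bar>u y\<bar>"])
      show "AE y in lborel. (\<lambda>k. ?f k y) \<longlonglongrightarrow> H i (x $ 1 - y $ 1) * H (Suc j) (x $ 2 - y $ 2) * u y"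
        by (intro AE_I2 tendsto_mult tendsto_const lim s)
      show "AE y in lborel. norm (?f k y) \<le> Bi * Cj * \<bar>u y\<bar>" for k
        unfolding real_norm_def abs_mult
        by (intro AE_I2 mult_right_mono mult_mono quot Cj Bi abs_ge_zero)
    qed (use u in auto)
    moreover have "(LINT y|lborel. ?f k y) = (conv H i j u (x + s k *\<^sub>R axis 2 1) - conv H i j u x) /
        s k" for k
      unfolding conv_def using s(2)[of k] 
      by (subst Bochner_Integration.integral_diff[symmetric, OF conv_integrable[OF u]
          conv_integrable[OF u]])
        (auto simp: axis_def field_simps intro!: Bochner_Integration.integral_cong
          simp flip: Bochner_Integration.integral_divide_zero)
    ultimately show "(\<lambda>k. (conv H i j u (x + s k *\<^sub>R axis 2 1) - conv H i j u x) / s k)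
        \<longlonglongrightarrow> conv H i (Suc j) u x"
      by (simp only:)
  qed
qed

lemma kernel_nonneg: "0 \<le> H 0 a * H 0 b" using mollD(3) by simp

lemma conv_add:
  "integrable lborel u \<Longrightarrow> integrable lborel w \<Longrightarrow> conv H i j (\<lambda>y. u y + w y) x = conv H i j u x
      + conv H i j w x"
  unfolding conv_def
  by (subst Bochner_Integration.integral_add[symmetric, OF conv_integrable conv_integrable])
      (auto simp: algebra_simps)

lemma conv_diff:
  "integrable lborel u \<Longrightarrow> integrable lborel w \<Longrightarrow> conv H i j (\<lambda>y. u y - w y) x = conv H i j u x
      - conv H i j w x"
  unfolding conv_def
  by (subst Bochner_Integration.integral_diff[symmetric, OF conv_integrable conv_integrable])
      (auto simp: algebra_simps)

lemma conv_nonneg: "(\<And>y. 0 \<le> u y) \<Longrightarrow> 0 \<le> conv H 0 0 u x"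
  unfolding conv_def using kernel_nonneg by (intro integral_nonneg_AE) auto

lemma conv_abs_le: "\<bar>conv H 0 0 u x\<bar> \<le> conv H 0 0 (\<lambda>y. \<bar>u y\<bar>) x"
  unfolding conv_def using integral_norm_bound[of lborel
      "\<lambda>y. H 0 (x $ 1 - y $ 1) * H 0 (x $ 2 - y $ 2) * u y"]
  by (simp add: abs_mult mollD(3))

text \<open>The kernel is a probability density on the ball of radius \<open>2 * \<epsilon>\<close>,
  so averaging cannot leave an interval around \<open>c\<close>. With \<eta> = 0 this locates the
  support of a mollification, with small \<eta> it gives uniform convergence.\<close>

lemma conv_local:
  assumes u: "integrable lborel u" and close: "\<And>y. dist x y \<le> 2 * \<epsilon> \<Longrightarrow> \<bar>u y - c\<bar> \<le> \<eta>"
  shows "\<bar>conv H 0 0 u x - c\<bar> \<le> \<eta>"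
proof -
  let ?k = "\<lambda>y. H 0 (x $ 1 - y $ 1) * H 0 (x $ 2 - (y::real^2) $ 2)"
  have "conv H 0 0 u x - c = (LINT y|lborel. ?k y * u y - ?k y * c)"
    unfolding conv_def
    by (subst Bochner_Integration.integral_diff)
       (use kernel_integral conv_integrable[OF u] kernel_integrable in auto)
  also have "\<bar>\<dots>\<bar> \<le> (LINT y|lborel. ?k y * \<eta>)"
  proof (rule integral_abs_bound_integral)
    show "\<bar>?k y * u y - ?k y * c\<bar> \<le> ?k y * \<eta>" for y
    proof (cases "?k y = 0")
      case False
      then have "\<bar>u y - c\<bar> \<le> \<eta>" using kernel_support close by blast
      then have "?k y * \<bar>u y - c\<bar> \<le> ?k y * \<eta>" using kernel_nonneg by (intro mult_left_mono) auto
      moreover have "\<bar>?k y * u y - ?k y * c\<bar> = ?k y * \<bar>u y - c\<bar>"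
        using kernel_nonneg[of "x $ 1 - y $ 1" "x $ 2 - y $ 2"]
            by (simp add: right_diff_distrib[symmetric] abs_mult mollD(3))
      ultimately show ?thesis by simp
    qed (simp only: mult_zero_left)
  qed (use conv_integrable[OF u] kernel_integrable in auto)
  also have "\<dots> = \<eta>" using kernel_integral by simp
  finally show ?thesis .
qed

lemma conv_L1:
  assumes u: "integrable lborel u"
  shows "integrable lborel (conv H 0 0 u)" "(LINT x|lborel. conv H 0 0 u x) = (LINT x|lborel. u x)"
proof -
  have [measurable]: "u \<in> borel_measurable borel" using assms by simp
  note [measurable] = moll_measurable
  let ?f = "\<lambda>y x. H 0 ((x::real^2) $ 1 - y $ 1) * H 0 (x $ 2 - (y::real^2) $ 2) * u y"
  have int: "integrable (lborel \<Otimes>\<^sub>M lborel) (case_prod ?f)"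
  proof (rule lborel_pair.Fubini_integrable)
    have "(LINT x|lborel. norm (case_prod ?f (y, x))) = \<bar>u y\<bar>" for y
      using kernel_integral'[of y] by (simp add: abs_mult mollD(3))
    then show "integrable lborel (\<lambda>y. LINT x|lborel. norm (case_prod ?f (y, x)))"
      using u by simp
    show "AE y in lborel. integrable lborel (\<lambda>x. case_prod ?f (y, x))"
      using kernel_integrable' by auto
  qed (simp add: split_beta')
  show "integrable lborel (conv H 0 0 u)"
    using lborel_pair.integrable_snd[OF int] unfolding conv_def[abs_def] by simp
  have "(LINT x|lborel. conv H 0 0 u x) = (LINT y|lborel. LINT x|lborel. ?f y x)"
    unfolding conv_def by (rule lborel_pair.Fubini_integral[OF int])
  also have "\<dots> = (LINT x|lborel. u x)"
    using kernel_integral' by simp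
  finally show "(LINT x|lborel. conv H 0 0 u x) = (LINT x|lborel. u x)" .
qed

lemma conv_L1_bound:
  assumes u: "integrable lborel u"
  shows "(LINT x|lborel. \<bar>conv H 0 0 u x\<bar>) \<le> (LINT x|lborel. \<bar>u x\<bar>)"
proof -
  have "(LINT x|lborel. \<bar>conv H 0 0 u x\<bar>) \<le> (LINT x|lborel. conv H 0 0 (\<lambda>y. \<bar>u y\<bar>) x)"
    by (intro integral_mono conv_abs_le integrable_abs conv_L1 u)
  also have "\<dots> = (LINT x|lborel. \<bar>u x\<bar>)" by (intro conv_L1 integrable_abs u)
  finally show ?thesis .
qed

text \<open>Jensen's inequality, from the nonnegativity of the variance of \<open>u\<close> under
  the kernel. It replaces squares of mollified functions by mollified squares, whose convergence in
  L^1 is known.\<close>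

lemma conv_square_le:
  assumes u: "integrable lborel u" and u2: "integrable lborel (\<lambda>y. (u y)\<^sup>2)"
  shows "(conv H 0 0 u x)\<^sup>2 \<le> conv H 0 0 (\<lambda>y. (u y)\<^sup>2) x"
proof -
  define c where "c = conv H 0 0 u x"
  let ?k = "\<lambda>y. H 0 (x $ 1 - y $ 1) * H 0 (x $ 2 - (y::real^2) $ 2)"
  have "0 \<le> (LINT y|lborel. ?k y * (u y - c)\<^sup>2)"
    using kernel_nonneg by (intro integral_nonneg_AE) auto
  also have "\<dots> = (LINT y|lborel. (?k y * (u y)\<^sup>2 - 2 * c * (?k y * u y)) + c\<^sup>2 * ?k y)"
    by (intro Bochner_Integration.integral_cong) (auto simp: power2_eq_square algebra_simps)
  also have "\<dots> = (conv H 0 0 (\<lambda>y. (u y)\<^sup>2) x - 2 * c * c) + c\<^sup>2"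
    using conv_integrable[OF u, of 0 x 0] conv_integrable[OF u2, of 0 x 0]
        kernel_integrable[of 0 x 0] kernel_integral
    unfolding c_def conv_def
    by (subst Bochner_Integration.integral_add, simp, simp, subst Bochner_Integration.integral_diff)
        auto
  finally show ?thesis unfolding c_def by (simp add: power2_eq_square)
qed

end


section \<open>Approximation in L^1\<close>

lemma continuous_L1_dense:
  fixes u :: "'a::euclidean_space \<Rightarrow> real"
  assumes u: "integrable lborel u" and \<eta>: "\<eta> > 0"
  shows "\<exists>w r. continuous_on UNIV w \<and> (\<forall>x. x \<notin> cball 0 r \<longrightarrow> w x = 0) \<and>
           (LINT x|lborel. \<bar>u x - w x\<bar>) < \<eta>"
proof -
  have [measurable]: "u \<in> borel_measurable borel" using assms by simp
  define clamp where "clamp k t = max (- k) (min k t)" for k t :: real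
  \<comment> \<open>Truncated in value and in space, so that afterwards a constant on a ball can
    serve as dominating function.\<close>
  define uk where "uk k x = clamp (real k) (u x) * indicator (cball 0 (real k)) x" for k x
  have uk_meas[measurable]: "uk k \<in> borel_measurable borel" for k
  proof -
    have [measurable]: "cball (0::'a) (real k) \<in> sets borel" by simp
    show ?thesis unfolding uk_def clamp_def by
        (intro borel_measurable_times borel_measurable_max borel_measurable_min
        borel_measurable_indicator) auto
  qed
  have uk_le: "\<bar>uk k x\<bar> \<le> \<bar>u x\<bar>" for k x
    by (auto simp: uk_def clamp_def indicator_def)
  have "(\<lambda>k. LINT x|lborel. \<bar>u x - uk k x\<bar>) \<longlonglongrightarrow> (LINT x::'a|lborel. (0::real))"
  proof (rule integral_dominated_convergence[where w="\<lambda>x. 2 * \<bar>u x\<bar>"])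
    show "AE x in lborel. (\<lambda>k. \<bar>u x - uk k x\<bar>) \<longlonglongrightarrow> 0"
    proof (rule AE_I2)
      fix x
      obtain N where N: "\<bar>u x\<bar> + norm x \<le> real N" using real_arch_simple by blast
      have "\<bar>u x - uk k x\<bar> = 0" if "k \<ge> N" for k
      proof -
        have "\<bar>u x\<bar> + norm x \<le> real k" using N that by linarith
        then have "\<bar>u x\<bar> \<le> real k" "norm x \<le> real k" using norm_ge_zero[of x] by linarith+
        then show ?thesis by (auto simp: uk_def clamp_def indicator_def)
      qed
      then show "(\<lambda>k. \<bar>u x - uk k x\<bar>) \<longlonglongrightarrow> 0"
        by (intro tendsto_eventually) (auto simp: eventually_sequentially)
    qed
    show "AE x in lborel. norm \<bar>u x - uk k x\<bar> \<le> 2 * \<bar>u x\<bar>" for k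
      using uk_le[of k] abs_triangle_ineq4 by (intro AE_I2) (smt (verit) real_norm_def)
  qed (use u in auto)
  then have "\<forall>\<^sub>F k in sequentially. (LINT x|lborel. \<bar>u x - uk k x\<bar>) < \<eta> / 2"
    using \<eta> by (intro order_tendstoD(2)[of _ 0]) auto
  then obtain k where k: "(LINT x|lborel. \<bar>u x - uk k x\<bar>) < \<eta> / 2"
    using eventually_happens'[OF sequentially_bot] by blast
  have "uk k measurable_on UNIV"
    by (rule lebesgue_measurable_imp_measurable_on) (auto intro: measurable_completion)
  then obtain N g where N: "negligible N" "\<And>n. continuous_on UNIV (g n)"
      "\<And>x. x \<notin> N \<Longrightarrow> (\<lambda>n. g n x) \<longlonglongrightarrow> uk k x"
    unfolding measurable_on_def by auto
  \<comment> \<open>The continuous \<open>g n\<close> converge almost everywhere but need not be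
    bounded, so they are clamped and cut off as well. In the limit this changes nothing, since
    \<open>uk k\<close> is bounded by \<open>k\<close> and vanishes outside
    \<open>cball 0 k\<close>.\<close>
  define w where "w n x = clamp (real k) (g n x) * max 0 (min 1 (real k + 1 - norm x))" for n x
  have wcont: "continuous_on UNIV (w n)" for n
    unfolding w_def clamp_def by (intro continuous_intros N)
  have [measurable]: "w n \<in> borel_measurable borel" for n
    by (intro borel_measurable_continuous_onI wcont)
  have wle: "\<bar>w n x\<bar> \<le> real k * indicator (cball 0 (real k + 1)) x" for n x
  proof (cases "norm x \<le> real k + 1")
    case True
    have "\<bar>clamp (real k) (g n x)\<bar> \<le> real k" "\<bar>max 0 (min 1 (real k + 1 - norm x))\<bar> \<le> 1"
      by (auto simp: clamp_def)
    then have "\<bar>w n x\<bar> \<le> real k * 1" unfolding w_def abs_mult by (intro mult_mono) auto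
    then show ?thesis using True by simp
  qed (auto simp: w_def)
  have ukle': "\<bar>uk k x\<bar> \<le> real k * indicator (cball 0 (real k + 1)) x" for x
    by (auto simp: uk_def clamp_def indicator_def)
  have cint: "integrable lborel (\<lambda>x. 2 * (real k * indicator (cball (0::'a) (real k + 1)) x))"
    by (intro integrable_mult_right integrable_real_indicator emeasure_bounded_finite) auto
  have "(\<lambda>n. LINT x|lborel. \<bar>uk k x - w n x\<bar>) \<longlonglongrightarrow> (LINT x::'a|lborel. (0::real))"
  proof (rule integral_dominated_convergence[OF _ _ cint])
    have "AE x in lebesgue. x \<notin> N" using N(1) by (simp add: AE_not_in negligible_iff_null_sets)
    then have "AE x in lborel. x \<notin> N" by (simp add: AE_completion_iff)
    then show "AE x in lborel. (\<lambda>n. \<bar>uk k x - w n x\<bar>) \<longlonglongrightarrow> 0"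
    proof eventually_elim
      fix x assume "x \<notin> N"
      have "(\<lambda>n. w n x) \<longlonglongrightarrow> clamp (real k) (uk k x) * max 0 (min 1 (real k + 1 - norm x))"
        unfolding w_def clamp_def by (intro tendsto_intros N(3) \<open>x \<notin> N\<close>)
      also have "clamp (real k) (uk k x) * max 0 (min 1 (real k + 1 - norm x)) = uk k x"
        by (auto simp: uk_def clamp_def indicator_def)
      finally have "(\<lambda>n. \<bar>uk k x - w n x\<bar>) \<longlonglongrightarrow> \<bar>uk k x - uk k x\<bar>" by (intro tendsto_intros)
      then show "(\<lambda>n. \<bar>uk k x - w n x\<bar>) \<longlonglongrightarrow> 0" by simp
    qed
    show "AE x in lborel. norm \<bar>uk k x - w n x\<bar> \<le> 2 * (real k * indicator (cball 0 (real k + 1)) x)"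
        for n
      using wle[of n] ukle' by (intro AE_I2) (smt (verit) real_norm_def)
  qed auto
  then have "\<forall>\<^sub>F n in sequentially. (LINT x|lborel. \<bar>uk k x - w n x\<bar>) < \<eta> / 2"
    using \<eta> by (intro order_tendstoD(2)[of _ 0]) auto
  then obtain n where n: "(LINT x|lborel. \<bar>uk k x - w n x\<bar>) < \<eta> / 2"
    using eventually_happens'[OF sequentially_bot] by blast
  have wsupp: "w n x = 0" if "x \<notin> cball 0 (real k + 1)" for x
    using wle[of n x] that by (simp del: mem_cball)
  have wint: "integrable lborel (w n)"
    by (rule integrable_continuous_bounded_support[OF wcont wsupp])
  have ukint: "integrable lborel (uk k)"
    by (rule Bochner_Integration.integrable_bound[OF u]) (use uk_le in auto)
  have "(LINT x|lborel. \<bar>u x - w n x\<bar>) \<le> (LINT x|lborel. \<bar>u x - uk k x\<bar> + \<bar>uk k x - w n x\<bar>)"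
    by (intro integral_mono) (use u wint ukint in auto)
  also have "\<dots> = (LINT x|lborel. \<bar>u x - uk k x\<bar>) + (LINT x|lborel. \<bar>uk k x - w n x\<bar>)"
    by (intro Bochner_Integration.integral_add) (use u wint ukint in auto)
  also have "\<dots> < \<eta>" using k n by simp
  finally show ?thesis using wcont wsupp by blast
qed

text \<open>Mollification does not increase the L^1 norm, so it suffices to treat a continuous
  \<open>w\<close> with bounded support, for which the convergence is uniform. The tolerance is
  split into \<eta> / 4 for each of the two terms with \<open>u - w\<close> and \<eta> / 2 for
  \<open>w\<close> itself.\<close>

lemma conv_tendsto_L1:
  assumes u: "integrable lborel u" and moll: "\<And>m. mollifier (\<epsilon> m) (H m)"
    and \<epsilon>: "\<And>m. 0 < \<epsilon> m" "\<epsilon> \<longlonglongrightarrow> 0"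
  shows "(\<lambda>m. LINT x|lborel. \<bar>conv (H m) 0 0 u x - u x\<bar>) \<longlonglongrightarrow> 0"
proof (rule tendstoI)
  fix \<eta> :: real assume \<eta>: "\<eta> > 0"
  obtain w r where w: "continuous_on UNIV w" "\<And>x. x \<notin> cball 0 r \<Longrightarrow> w x = 0"
    "(LINT x|lborel. \<bar>u x - w x\<bar>) < \<eta> / 4"
    using continuous_L1_dense[OF u, of "\<eta> / 4"] \<eta> by auto
  have wint: "integrable lborel w" by (rule integrable_continuous_bounded_support[OF w(1,2)])
  define V where "V = measure lborel (cball (0 :: real^2) (r + 1))"
  define \<kappa> where "\<kappa> = \<eta> / (4 * (V + 1))"
  have V: "V \<ge> 0" by (simp add: V_def)
  then have V: "V \<ge> 0" "\<kappa> > 0" using \<eta> by (auto simp: \<kappa>_def)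
  have "uniformly_continuous_on (cball 0 (r + 2)) w"
    by (intro compact_uniformly_continuous continuous_on_subset[OF w(1)]) auto
  then obtain \<delta> where \<delta>: "\<delta> > 0" "\<And>x y. x \<in> cball 0 (r + 2) \<Longrightarrow> y \<in> cball 0 (r + 2) \<Longrightarrow> dist y x < \<delta>
      \<Longrightarrow> dist (w y) (w x) < \<kappa>"
    using V(2) unfolding uniformly_continuous_on_def by metis
  \<comment> \<open>The bound \<delta> / 2 is for uniform continuity; the bound 1 / 2 keeps the
    support of the mollification inside radius \<open>r + 1\<close>.\<close>
  have "eventually (\<lambda>m. \<epsilon> m < min (\<delta> / 2) (1 / 2)) sequentially"
    using \<epsilon>(2) \<delta>(1) by (intro order_tendstoD) auto
  then show "\<forall>\<^sub>F m in sequentially. dist (LINT x|lborel. \<bar>conv (H m) 0 0 u x - u x\<bar>) 0 < \<eta>"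
  proof eventually_elim
    case (elim m)
    note M = moll[of m]
    have close: "\<bar>conv (H m) 0 0 w x - w x\<bar> \<le> \<kappa> * indicator (cball 0 (r + 1)) x" for x
    proof (cases "x \<in> cball 0 (r + 1)")
      case True
      have "\<bar>conv (H m) 0 0 w x - w x\<bar> \<le> \<kappa>"
      proof (rule conv_local[OF M wint])
        fix y assume y: "dist x y \<le> 2 * \<epsilon> m"
        have "norm y \<le> norm x + dist x y" using norm_triangle_sub[of y x]
            by (simp add: dist_norm norm_minus_commute)
        then have "y \<in> cball 0 (r + 2)" "x \<in> cball 0 (r + 2)" using True elim y by auto
        moreover have "dist y x < \<delta>" using y elim by (simp add: dist_commute)
        ultimately show "\<bar>w y - w x\<bar> \<le> \<kappa>" using \<delta>(2)[of x y] by (simp add: dist_real_def)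
      qed
      then show ?thesis using True by simp
    next
      case False
      have "\<bar>conv (H m) 0 0 w x - 0\<bar> \<le> 0"
      proof (rule conv_local[OF M wint])
        fix y assume y: "dist x y \<le> 2 * \<epsilon> m"
        have "norm x \<le> norm y + dist x y" using norm_triangle_sub[of x y] by (simp add: dist_norm)
        then have "y \<notin> cball 0 r" using False y elim by auto
        then show "\<bar>w y - 0\<bar> \<le> 0" using w(2) by simp
      qed
      moreover have "w x = 0" using False w(2)[of x] by auto
      ultimately show ?thesis using False by simp
    qed
    have i1: "integrable lborel (\<lambda>x. \<kappa> * indicator (cball (0::real^2) (r + 1)) x)"
      by (intro integrable_mult_right integrable_real_indicator emeasure_bounded_finite) auto
    have i2: "integrable lborel (conv (H m) 0 0 w)" "integrable lborel (conv (H m) 0 0 u)"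
      "integrable lborel (\<lambda>y. u y - w y)" "integrable lborel (conv (H m) 0 0 (\<lambda>y. u y - w y))"
      using conv_L1[OF M] u wint by auto
    have "(LINT x|lborel. \<bar>conv (H m) 0 0 w x - w x\<bar>)
        \<le> (LINT x|lborel. \<kappa> * indicator (cball (0::real^2) (r + 1)) x)"
      by (intro integral_mono close i1) (use i2 wint in auto)
    also have "\<dots> = \<kappa> * V" by (simp add: V_def)
    also have "\<dots> < \<eta> / 2" using V \<eta> by (simp add: \<kappa>_def field_simps)
        (smt (verit) mult_nonneg_nonneg)
    finally have 1: "(LINT x|lborel. \<bar>conv (H m) 0 0 w x - w x\<bar>) < \<eta> / 2" .
    have 2: "(LINT x|lborel. \<bar>conv (H m) 0 0 (\<lambda>y. u y - w y) x\<bar>) < \<eta> / 4"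
      using conv_L1_bound[OF M i2(3)] w(3) by simp
    have "(LINT x|lborel. \<bar>conv (H m) 0 0 u x - u x\<bar>) \<le>
      (LINT x|lborel. (\<bar>conv (H m) 0 0 (\<lambda>y. u y - w y) x\<bar> + \<bar>conv (H m) 0 0 w x - w x\<bar>) + \<bar>u x
          - w x\<bar>)"
      by (intro integral_mono) (use u wint i2 in \<open>auto simp: conv_diff[OF M]\<close>)
    also have "\<dots> = (LINT x|lborel. \<bar>conv (H m) 0 0 (\<lambda>y. u y - w y) x\<bar>)
        + (LINT x|lborel. \<bar>conv (H m) 0 0 w x - w x\<bar>)
        + (LINT x|lborel. \<bar>u x - w x\<bar>)"
      using u wint i2 by (subst Bochner_Integration.integral_add, simp, simp, subst
          Bochner_Integration.integral_add) auto
    also have "\<dots> < \<eta>" using 1 2 w(3) by linarith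
    finally show ?case by (simp add: dist_real_def)
  qed
qed

section \<open>The energy estimate for smooth functions\<close>

text \<open>This is the pointwise form of the energy estimate for \<open>w = ln (s * \<bar>G\<bar>\<^sup>2) / 2\<close>, where
  \<open>G = \<nabla>V\<close> and \<open>a, b, c\<close> are the second derivatives of \<open>V\<close>. The vector
  \<open>(P1, P2)\<close> is \<open>q \<nabla>w\<close>, and \<open>(N1, N2) = (P1, P2) - \<Delta>V G\<close>, so that \<open>(N1, N2) / q\<close>
  is divergence free up to the term with \<open>\<delta>\<^sup>2 / \<kappa>\<^sup>2\<close>. \<open>Z\<close> is the divergence of
  \<open>\<zeta>\<^sup>2 \<tau>(\<sigma>) (N1, N2) / q\<close> for the multiplier \<open>\<tau>(\<sigma>) = \<sigma> ln (1 + \<sigma>) / (1 + \<sigma>)\<close>. This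
  multiplier is chosen because it is unbounded, while \<open>\<tau>(\<sigma>) / q\<close> is smooth where \<open>G = 0\<close>
  and \<open>\<sigma> \<tau>'(\<sigma>)\<close> is bounded. The left-hand side is the square of the first
  partial derivative of \<open>\<zeta> \<tau>(\<sigma>)\<close>.\<close>

lemma key_inequality:
  fixes G1 G2 a b c y1 y2 \<delta> \<rho> \<zeta> z1 z2 \<kappa> q s \<sigma> L P1 P2 N1 N2 Z :: real and n :: nat
  assumes "\<delta> > 0" "\<rho> > 0"
  defines "\<kappa> \<equiv> y1\<^sup>2 + y2\<^sup>2 + \<delta>\<^sup>2" and "q \<equiv> G1\<^sup>2 + G2\<^sup>2"
  defines "s \<equiv> (\<rho>\<^sup>2 / \<kappa>) ^ n"
  defines "\<sigma> \<equiv> s * q"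
  defines "L \<equiv> ln (1 + \<sigma>)"
  defines "P1 \<equiv> G1 * a + G2 * b - n * q * y1 / \<kappa>" and "P2 \<equiv> G1 * b + G2 * c - n * q * y2 / \<kappa>"
  defines "N1 \<equiv> G2 * b - G1 * c - n * q * y1 / \<kappa>" and "N2 \<equiv> G1 * b - G2 * a - n * q * y2 / \<kappa>"
  defines "Z \<equiv> 2 * \<zeta> * (L / (1 + \<sigma>)) * s * (z1 * N1 + z2 * N2) +
     \<zeta>\<^sup>2 * (2 * ((1 - L) / (1 + \<sigma>)\<^sup>2) * s\<^sup>2 * (P1 * N1 + P2 * N2)
        + (L / (1 + \<sigma>)) * (- 2 * n * s * (y1 * N1 + y2 * N2) / \<kappa>)
        + (L / (1 + \<sigma>)) * s * (2 * (b\<^sup>2 - a * c)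
            - n * (2 * ((G1 * a + G2 * b) * y1 + (G1 * b + G2 * c) * y2) / \<kappa> + q * (2 * \<delta>\<^sup>2 / \<kappa>\<^sup>2))))"
  shows "(z1 * (\<sigma> * L / (1 + \<sigma>)) + \<zeta> * ((L + \<sigma>) / (1 + \<sigma>)\<^sup>2 * (2 * s * P1)))\<^sup>2
    \<le> 32 * Z + (82 * ((z1\<^sup>2 + z2\<^sup>2) * L\<^sup>2) + 192 * (\<zeta>\<^sup>2 * (s * (a + c)\<^sup>2 / (1 + \<sigma>)))
       + 64 * n * (\<zeta>\<^sup>2 * (\<sigma> * L / (1 + \<sigma>)) * (\<delta>\<^sup>2 / \<kappa>\<^sup>2)))"
proof (cases "q = 0")
  case True
  then have "G1 = 0" "G2 = 0" by (auto simp: q_def sum_power2_eq_zero_iff)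
  then show ?thesis
    unfolding Z_def L_def \<sigma>_def P1_def N1_def N2_def P2_def True using assms(1,2)
    by (auto simp: q_def \<kappa>_def s_def intro!: divide_nonneg_nonneg mult_nonneg_nonneg)
next
  case False
  then have q: "q > 0" by (auto simp: q_def sum_power2_gt_zero_iff)
  have \<kappa>: "\<kappa> > 0" using assms(1) unfolding \<kappa>_def
      by (smt (verit) sum_power2_ge_zero zero_less_power2)
  have s: "s > 0" using \<kappa> assms(2) by (simp add: s_def)
  have \<sigma>: "\<sigma> > 0" using s q by (simp add: \<sigma>_def)
  have L: "L > 0" "L \<le> \<sigma>" using \<sigma> ln_add_one_self_le_self[of \<sigma>] by (auto simp: L_def)
  \<comment> \<open>\<open>k * \<sigma>\<close> is \<tau>(\<sigma>) and \<open>t\<close> is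
    \<tau>'(\<sigma>). Since the gradient of \<sigma> is 2 s P, the gradient of \<tau>(\<sigma>)
    paired with N / q is \<open>\<alpha>\<close> times the inner product of P and N.\<close>
  define k where "k = L / (1 + \<sigma>)"
  define t where "t = (L + \<sigma>) / (1 + \<sigma>)\<^sup>2"
  define \<alpha> where "\<alpha> = 2 * s * t / q"
  define d where "d = a + c"
  define m :: real where "m = real n"
  have k: "k \<ge> 0" using L \<sigma> by (simp add: k_def)
  have t: "t > 0" using L \<sigma> by (simp add: t_def add_pos_pos)
  have \<alpha>: "\<alpha> > 0" using s t q by (simp add: \<alpha>_def)
  have N: "N1 = P1 - d * G1" "N2 = P2 - d * G2"
    unfolding N1_def N2_def P1_def P2_def d_def by (simp_all add: algebra_simps)
  \<comment> \<open>The left-hand side is div (s N) / s. As \<sigma> = s q has the gradient 2 s P,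
    the identity is another form of div (N / q) = - 2 m \<delta>^2 / \<kappa>^2; the right-hand side
    of that is the Laplacian of - m ln \<kappa> / 2.\<close>
  have PN: "2 * (b\<^sup>2 - a * c) - m * (2 * ((G1 * a + G2 * b) * y1 + (G1 * b + G2 * c) * y2) / \<kappa>
      + q * (2 * \<delta>\<^sup>2 / \<kappa>\<^sup>2))
     - 2 * m * (y1 * N1 + y2 * N2) / \<kappa>
     = 2 * (P1 * N1 + P2 * N2) / q - 2 * m * q * \<delta>\<^sup>2 / \<kappa>\<^sup>2"
  proof -
    define A1 A2 M1 M2 where "A1 = G1 * a + G2 * b" and "A2 = G1 * b + G2 * c"
      and "M1 = G2 * b - G1 * c" and "M2 = G1 * b - G2 * a"
    define w1 w2 where "w1 = y1 / \<kappa>" and "w2 = y2 / \<kappa>"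
    \<comment> \<open>Cayley-Hamilton for the Hessian H with trace d: H (H - d) = - det H, applied
      to G. Here (\<open>A1\<close>, \<open>A2\<close>) is H G and (\<open>M1\<close>,
      \<open>M2\<close>) is (H - d) G. This is where the dimension two enters.\<close>
    have det: "(b\<^sup>2 - a * c) * q = A1 * M1 + A2 * M2"
      unfolding A1_def A2_def M1_def M2_def q_def by algebra
    have P: "P1 = A1 - m * q * w1" "P2 = A2 - m * q * w2" "N1 = M1 - m * q * w1"
        "N2 = M2 - m * q * w2"
      by (simp_all add: P1_def P2_def N1_def N2_def A1_def A2_def M1_def M2_def w1_def w2_def m_def)
    have "2 * (P1 * N1 + P2 * N2) / q = 2 * ((b\<^sup>2 - a * c) * q
        - m * q * (w1 * (A1 + M1) + w2 * (A2 + M2))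
        + m\<^sup>2 * q\<^sup>2 * (w1\<^sup>2 + w2\<^sup>2)) / q"
      unfolding P det by (simp add: power2_eq_square algebra_simps)
    also have "\<dots> = 2 * ((b\<^sup>2 - a * c) - m * (w1 * (A1 + M1) + w2 * (A2 + M2))
        + m\<^sup>2 * q * (w1\<^sup>2 + w2\<^sup>2))"
      using q by (simp add: field_simps power2_eq_square)
    finally have 1: "2 * (P1 * N1 + P2 * N2) / q
        = 2 * ((b\<^sup>2 - a * c) - m * (w1 * (A1 + M1) + w2 * (A2 + M2)) + m\<^sup>2 * q * (w1\<^sup>2 + w2\<^sup>2))" .
    have 2: "2 * m * (y1 * N1 + y2 * N2) / \<kappa> = 2 * m * (w1 * N1 + w2 * N2)"
       "2 * (A1 * y1 + A2 * y2) / \<kappa> = 2 * (A1 * w1 + A2 * w2)"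
      unfolding w1_def w2_def using \<kappa> by (simp_all add: field_simps)
    show ?thesis unfolding 1 2 A1_def[symmetric] A2_def[symmetric] unfolding P
      by (simp add: power2_eq_square algebra_simps)
  qed
  \<comment> \<open>As \<tau>(\<sigma>) / q = k s, the differentiated field is \<zeta>^2 k s N. The
    derivative of \<open>k\<close> and the term 2 k s / q coming from \<open>PN\<close> add up to
    \<open>\<alpha>\<close>.\<close>
  have kt: "2 * ((1 - L) / (1 + \<sigma>)\<^sup>2) * s\<^sup>2 + k * s * (2 / q) = \<alpha>"
  proof -
    have "s\<^sup>2 = s * \<sigma> / q" using q by (simp add: \<sigma>_def power2_eq_square)
    then have "2 * ((1 - L) / (1 + \<sigma>)\<^sup>2) * s\<^sup>2 + k * s * (2 / q)
        = (2 * s / q) * ((1 - L) * \<sigma> / (1 + \<sigma>)\<^sup>2 + k)"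
      by (simp add: algebra_simps add_divide_distrib diff_divide_distrib)
    also have "(1 - L) * \<sigma> / (1 + \<sigma>)\<^sup>2 + k = t"
    proof -
      have "k = L * (1 + \<sigma>) / (1 + \<sigma>)\<^sup>2" using \<sigma> by (simp add: k_def power2_eq_square)
      then show ?thesis unfolding t_def by (simp add: add_divide_distrib[symmetric] algebra_simps)
    qed
    finally show ?thesis by (simp add: \<alpha>_def)
  qed
  define X where "X = P1\<^sup>2 + P2\<^sup>2"
  define W where "W = 2 * (b\<^sup>2 - a * c) - m * (2 * ((G1 * a + G2 * b) * y1 + (G1 * b + G2 * c) * y2)
      / \<kappa> + q * (2 * \<delta>\<^sup>2 / \<kappa>\<^sup>2))"
  have W: "W = 2 * (P1 * N1 + P2 * N2) / q - 2 * m * q * \<delta>\<^sup>2 / \<kappa>\<^sup>2 + 2 * m * (y1 * N1 + y2 * N2) / \<kappa>"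
    using PN unfolding W_def by simp
  have Zeq: "Z = 2 * \<zeta> * k * s * (z1 * N1 + z2 * N2) + \<zeta>\<^sup>2 * \<alpha> * (P1 * N1 + P2 * N2)
      - 2 * m * \<zeta>\<^sup>2 * (k * \<sigma>) * (\<delta>\<^sup>2 / \<kappa>\<^sup>2)"
  proof -
    have "Z = 2 * \<zeta> * k * s * (z1 * N1 + z2 * N2) +
      \<zeta>\<^sup>2 * (2 * ((1 - L) / (1 + \<sigma>)\<^sup>2) * s\<^sup>2 * (P1 * N1 + P2 * N2)
          + k * (- 2 * m * s * (y1 * N1 + y2 * N2) / \<kappa>) + k * s * W)"
      unfolding Z_def k_def[symmetric] W_def by (simp add: m_def)
    also have "\<dots> = 2 * \<zeta> * k * s * (z1 * N1 + z2 * N2) +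
      \<zeta>\<^sup>2 * ((2 * ((1 - L) / (1 + \<sigma>)\<^sup>2) * s\<^sup>2 + k * s * (2 / q)) * (P1 * N1 + P2 * N2)
          - k * s * (2 * m * q * \<delta>\<^sup>2 / \<kappa>\<^sup>2))"
      unfolding W by (simp add: divide_inverse algebra_simps)
    also have "\<dots> = 2 * \<zeta> * k * s * (z1 * N1 + z2 * N2) + \<zeta>\<^sup>2 * \<alpha> * (P1 * N1 + P2 * N2)
        - 2 * m * \<zeta>\<^sup>2 * (k * \<sigma>) * (\<delta>\<^sup>2 / \<kappa>\<^sup>2)"
      unfolding kt by (simp add: \<sigma>_def algebra_simps)
    finally show ?thesis .
  qed
  \<comment> \<open>Two completed squares, to absorb the terms with the gradient of \<zeta>. In
    \<open>lower\<close>, half of \<zeta>^2 \<alpha> X is spent on the term with \<open>d\<close>, a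
    quarter through \<open>am1\<close>, and a quarter remains. The costs add up to 5 = 4 + 1 and 3/2
    = 1/2 + 1.\<close>
  have am1: "0 \<le> \<zeta>\<^sup>2 * \<alpha> * x\<^sup>2 / 4 + 2 * \<zeta> * k * s * x * z + 4 * (k\<^sup>2 * s\<^sup>2 / \<alpha>) * z\<^sup>2" for x z
  proof -
    have "0 \<le> (\<zeta> * \<alpha> * x / 2 + 2 * k * s * z)\<^sup>2 / \<alpha>" using \<alpha> by simp
    also have "\<dots> = \<zeta>\<^sup>2 * \<alpha> * x\<^sup>2 / 4 + 2 * \<zeta> * k * s * x * z + 4 * (k\<^sup>2 * s\<^sup>2 / \<alpha>) * z\<^sup>2"
      using \<alpha> by (simp add: field_simps power2_eq_square)
    finally show ?thesis .
  qed
  have am2: "0 \<le> \<zeta>\<^sup>2 * \<alpha> * x\<^sup>2 - 2 * \<zeta> * k * s * x * z + (k\<^sup>2 * s\<^sup>2 / \<alpha>) * z\<^sup>2" for x z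
  proof -
    have "0 \<le> (\<zeta> * \<alpha> * x - k * s * z)\<^sup>2 / \<alpha>" using \<alpha> by simp
    also have "\<dots> = \<zeta>\<^sup>2 * \<alpha> * x\<^sup>2 - 2 * \<zeta> * k * s * x * z + (k\<^sup>2 * s\<^sup>2 / \<alpha>) * z\<^sup>2"
      using \<alpha> by (simp add: field_simps power2_eq_square)
    finally show ?thesis .
  qed
  have kk: "k\<^sup>2 * s\<^sup>2 / \<alpha> \<le> L\<^sup>2 / 2"
  proof -
    have "k\<^sup>2 * s\<^sup>2 / \<alpha> = k\<^sup>2 * \<sigma> / (2 * t)" using q s t
        by (simp add: \<alpha>_def \<sigma>_def field_simps power2_eq_square)
    also have "\<dots> = L\<^sup>2 / 2 * (\<sigma> / (L + \<sigma>))" using L \<sigma> by (simp add: k_def t_def power_divide)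
    also have "\<dots> \<le> L\<^sup>2 / 2 * 1" using L \<sigma> by (intro mult_left_mono) auto
    finally show ?thesis by simp
  qed
  \<comment> \<open>The bound has 1 + \<sigma> in the denominator, so that the factor of the squared
    Laplacian stays bounded where the gradient vanishes.\<close>
  have aq: "\<alpha> * q \<le> 4 * (s / (1 + \<sigma>))"
  proof -
    have "t \<le> 2 / (1 + \<sigma>)"
    proof -
      have "(L + \<sigma>) / (1 + \<sigma>)\<^sup>2 \<le> (2 * (1 + \<sigma>)) / (1 + \<sigma>)\<^sup>2" using L \<sigma>
          by (intro divide_right_mono) auto
      also have "(2 * (1 + \<sigma>)) / (1 + \<sigma>)\<^sup>2 = 2 / (1 + \<sigma>)"
        using \<sigma> unfolding power2_eq_square by (subst mult_divide_mult_cancel_right) auto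
      finally show ?thesis by (simp add: t_def)
    qed
    then have "2 * s * t \<le> 2 * s * (2 / (1 + \<sigma>))" using s by (intro mult_left_mono) auto
    then show ?thesis using q by (simp add: \<alpha>_def)
  qed
  have lower: "\<zeta>\<^sup>2 * \<alpha> * X / 4 \<le> Z + 5 * (k\<^sup>2 * s\<^sup>2 / \<alpha>) * (z1\<^sup>2 + z2\<^sup>2) + 3 / 2 * (\<zeta>\<^sup>2 * d\<^sup>2 * (\<alpha> * q))
      + 2 * m * \<zeta>\<^sup>2 * (k * \<sigma>) * (\<delta>\<^sup>2 / \<kappa>\<^sup>2)"
  proof -
    have "2 * (d * (P1 * G1 + P2 * G2)) \<le> X + d\<^sup>2 * q"
      using zero_le_square[of "P1 - d * G1"] zero_le_square[of "P2 - d * G2"]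
      by (simp add: X_def q_def power2_eq_square algebra_simps)
    then have dP: "d * (P1 * G1 + P2 * G2) \<le> X / 2 + d\<^sup>2 * q / 2" by simp
    have "\<zeta>\<^sup>2 * \<alpha> * (d * (P1 * G1 + P2 * G2)) \<le> \<zeta>\<^sup>2 * \<alpha> * (X / 2 + d\<^sup>2 * q / 2)"
      using dP \<alpha> by (intro mult_left_mono) auto
    also have "\<dots> = \<zeta>\<^sup>2 * \<alpha> * X / 2 + \<zeta>\<^sup>2 * d\<^sup>2 * (\<alpha> * q) / 2" by (simp add: algebra_simps)
    finally have "\<zeta>\<^sup>2 * \<alpha> * (d * (P1 * G1 + P2 * G2)) \<le> \<zeta>\<^sup>2 * \<alpha> * X / 2 + \<zeta>\<^sup>2 * d\<^sup>2 * (\<alpha> * q) / 2" .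
    moreover have "P1 * N1 + P2 * N2 = X - d * (P1 * G1 + P2 * G2)"
      by (simp add: N X_def power2_eq_square algebra_simps)
    then have "\<zeta>\<^sup>2 * \<alpha> * (P1 * N1 + P2 * N2) = \<zeta>\<^sup>2 * \<alpha> * X - \<zeta>\<^sup>2 * \<alpha> * (d * (P1 * G1 + P2 * G2))"
      by (simp only: right_diff_distrib)
    ultimately have e1: "\<zeta>\<^sup>2 * \<alpha> * (P1 * N1 + P2 * N2) \<ge> \<zeta>\<^sup>2 * \<alpha> * X / 2 - \<zeta>\<^sup>2 * d\<^sup>2 * (\<alpha> * q) / 2"
      by linarith
    have e2: "2 * \<zeta> * k * s * (z1 * N1 + z2 * N2) =
      2 * \<zeta> * k * s * P1 * z1 + 2 * \<zeta> * k * s * P2 * z2 - 2 * \<zeta> * k * s * (d * G1) * z1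
          - 2 * \<zeta> * k * s * (d * G2) * z2"
      by (simp add: N algebra_simps)
    have e3: "\<zeta>\<^sup>2 * \<alpha> * (d * G1)\<^sup>2 + \<zeta>\<^sup>2 * \<alpha> * (d * G2)\<^sup>2 = \<zeta>\<^sup>2 * d\<^sup>2 * (\<alpha> * q)"
      by (simp add: q_def power_mult_distrib algebra_simps)
    have e4: "\<zeta>\<^sup>2 * \<alpha> * P1\<^sup>2 / 4 + \<zeta>\<^sup>2 * \<alpha> * P2\<^sup>2 / 4 = \<zeta>\<^sup>2 * \<alpha> * X / 4"
      by (simp add: X_def algebra_simps)
    define Q where "Q = k\<^sup>2 * s\<^sup>2 / \<alpha>"
    have e5: "5 * Q * (z1\<^sup>2 + z2\<^sup>2) = 4 * Q * z1\<^sup>2 + 4 * Q * z2\<^sup>2 + Q * z1\<^sup>2 + Q * z2\<^sup>2"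
      by (simp add: algebra_simps)
    show ?thesis
      using am1[of P1 z1] am1[of P2 z2] am2[of "d * G1" z1] am2[of "d * G2" z2] e1 e2 e3 e4 e5
      unfolding Zeq Q_def[symmetric] by linarith
  qed
  have T: "\<sigma> * L / (1 + \<sigma>) = k * \<sigma>" by (simp add: k_def)
  have TL: "(k * \<sigma>)\<^sup>2 \<le> L\<^sup>2"
  proof (rule power_mono)
    have "L * (\<sigma> / (1 + \<sigma>)) \<le> L * 1" using L \<sigma> by (intro mult_left_mono) auto
    then show "k * \<sigma> \<le> L" by (simp add: k_def)
  qed (use k \<sigma> in auto)
  \<comment> \<open>Boundedness of \<sigma> \<tau>'(\<sigma>), here
    \<open>\<sigma> * t \<le> 2\<close>, bounds the square of the coefficient s t by a single
    \<alpha>.\<close>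
  have tt: "(t * (2 * s * P1))\<^sup>2 \<le> 4 * \<alpha> * X"
  proof -
    have "\<sigma> * (L + \<sigma>) \<le> 2 * (1 + \<sigma>)\<^sup>2"
    proof -
      have "\<sigma> * (L + \<sigma>) \<le> (1 + \<sigma>) * (2 * (1 + \<sigma>))" using L \<sigma> by (intro mult_mono) auto
      then show ?thesis by (simp add: power2_eq_square algebra_simps)
    qed
    then have "\<sigma> * t \<le> 2" using \<sigma> by (simp add: t_def divide_le_eq)
    then have "s * t \<le> 2 / q" using q by (simp add: \<sigma>_def field_simps)
    then have "(s * t) * (s * t) \<le> (s * t) * (2 / q)" using s t by (intro mult_left_mono) auto
    then have "(s * t)\<^sup>2 \<le> \<alpha>" by (simp add: \<alpha>_def power2_eq_square mult_ac)
    then have "4 * (s * t)\<^sup>2 * P1\<^sup>2 \<le> 4 * \<alpha> * X" using \<alpha> by (intro mult_mono) (auto simp: X_def)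
    then show ?thesis by (simp add: power_mult_distrib algebra_simps)
  qed
  have "(z1 * (k * \<sigma>) + \<zeta> * (t * (2 * s * P1)))\<^sup>2 \<le> 2 * (z1\<^sup>2 * (k * \<sigma>)\<^sup>2)
      + 2 * (\<zeta>\<^sup>2 * (t * (2 * s * P1))\<^sup>2)"
    using sum_squares_bound[of "z1 * (k * \<sigma>)" "\<zeta> * (t * (2 * s * P1))"]
    unfolding power2_sum power_mult_distrib[of z1] power_mult_distrib[of \<zeta>] by linarith
  also have "\<dots> \<le> 2 * ((z1\<^sup>2 + z2\<^sup>2) * L\<^sup>2) + 2 * (\<zeta>\<^sup>2 * (4 * \<alpha> * X))"
    by (intro add_mono mult_left_mono mult_mono TL tt) auto
  \<comment> \<open>The constants of the statement: 32 = 2 * 4 * 4, 82 = 2 + 32 * 5 / 2, 192 = 32 *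
    3 / 2 * 4 and 64 = 32 * 2.\<close>
  also have "2 * (\<zeta>\<^sup>2 * (4 * \<alpha> * X)) = 32 * (\<zeta>\<^sup>2 * \<alpha> * X / 4)" by simp
  also have "2 * ((z1\<^sup>2 + z2\<^sup>2) * L\<^sup>2) + 32 * (\<zeta>\<^sup>2 * \<alpha> * X / 4) \<le> 2 * ((z1\<^sup>2 + z2\<^sup>2) * L\<^sup>2) + 
     32 * (Z + 5 * (L\<^sup>2 / 2) * (z1\<^sup>2 + z2\<^sup>2) + 3 / 2 * (\<zeta>\<^sup>2 * d\<^sup>2 * (4 * (s / (1 + \<sigma>))))
         + 2 * m * \<zeta>\<^sup>2 * (k * \<sigma>) * (\<delta>\<^sup>2 / \<kappa>\<^sup>2))"
  proof -
    have "5 * (k\<^sup>2 * s\<^sup>2 / \<alpha>) * (z1\<^sup>2 + z2\<^sup>2) \<le> 5 * (L\<^sup>2 / 2) * (z1\<^sup>2 + z2\<^sup>2)"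
      using kk by (intro mult_right_mono mult_left_mono) auto
    moreover have "\<zeta>\<^sup>2 * d\<^sup>2 * (\<alpha> * q) \<le> \<zeta>\<^sup>2 * d\<^sup>2 * (4 * (s / (1 + \<sigma>)))"
      using aq by (intro mult_left_mono) auto
    ultimately have "\<zeta>\<^sup>2 * \<alpha> * X / 4 \<le> Z + 5 * (L\<^sup>2 / 2) * (z1\<^sup>2 + z2\<^sup>2)
        + 3 / 2 * (\<zeta>\<^sup>2 * d\<^sup>2 * (4 * (s / (1 + \<sigma>)))) + 2 * m * \<zeta>\<^sup>2 * (k * \<sigma>) * (\<delta>\<^sup>2 / \<kappa>\<^sup>2)"
      by (intro order_trans[OF lower] order_refl add_mono mult_left_mono[of "\<zeta>\<^sup>2 * d\<^sup>2 * (\<alpha> * q)"])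
          auto
    then show ?thesis by (intro add_left_mono mult_left_mono) auto
  qed
  finally show ?thesis
    unfolding T t_def[symmetric] d_def[symmetric]
    by (simp add: algebra_simps add_divide_distrib m_def)
qed


section \<open>Rules for partial derivatives, the regularised weight, and the integrated
  estimate\<close>

lemma has_partial_const: "has_partial i (\<lambda>x. c) (\<lambda>x. 0)"
  by (simp add: has_partial_def)

lemma has_partial_add: "has_partial i F F' \<Longrightarrow> has_partial i G G'
    \<Longrightarrow> has_partial i (\<lambda>x. F x + G x) (\<lambda>x. F' x + G' x)"
  by (auto simp: has_partial_def intro!: derivative_intros)

lemma has_partial_diff: "has_partial i F F' \<Longrightarrow> has_partial i G G'
    \<Longrightarrow> has_partial i (\<lambda>x. F x - G x) (\<lambda>x. F' x - G' x)"
  by (auto simp: has_partial_def intro!: derivative_intros)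

lemma has_partial_mult: "has_partial i F F' \<Longrightarrow> has_partial i G G'
    \<Longrightarrow> has_partial i (\<lambda>x. F x * G x) (\<lambda>x. F' x * G x + F x * G' x)"
  by (auto simp: has_partial_def intro!: derivative_eq_intros)

lemma has_partial_chain:
  assumes "has_partial i F F'" "\<And>x. (f has_real_derivative f' x) (at (F x))"
  shows "has_partial i (\<lambda>x. f (F x)) (\<lambda>x. f' x * F' x)"
  unfolding has_partial_def
proof
  fix x
  have "(f has_real_derivative f' x) (at (F (x + 0 *\<^sub>R axis i 1)))" using assms(2)[of x] by simp
  from DERIV_chain2[OF this has_partialD[OF assms(1)]]
  show "((\<lambda>t. f (F (x + t *\<^sub>R axis i 1))) has_real_derivative f' x * F' x) (at 0)" .
qed

lemma has_partial_cong: "has_partial i F F' \<Longrightarrow> (\<And>x. F' x = F'' x) \<Longrightarrow> has_partial i F F''"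
  by (simp add: has_partial_def)

lemma has_partial_coord: "has_partial i (\<lambda>x. x $ j - c) (\<lambda>x. if i = j then 1 else 0)"
  by (auto simp: has_partial_def axis_def intro!: derivative_eq_intros)

text \<open>The regularised squared distance. With \<delta> = 0 it is the squared distance itself,
  and in this form it enters the cutoff function.\<close>

definition kap :: "real^2 \<Rightarrow> real \<Rightarrow> real^2 \<Rightarrow> real" where
  "kap p \<delta> x = (x $ 1 - p $ 1)\<^sup>2 + (x $ 2 - p $ 2)\<^sup>2 + \<delta>\<^sup>2"

lemma kap_eq: "kap p \<delta> x = (dist x p)\<^sup>2 + \<delta>\<^sup>2"
  by (simp add: kap_def dist_norm norm_vec_def L2_set_def sum_2 add_nonneg_nonneg)

lemma kap_pos: "\<delta> > 0 \<Longrightarrow> kap p \<delta> x > 0"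
  by (simp add: kap_eq add_nonneg_pos)

lemma kap_continuous: "continuous_on S (kap p \<delta>)"
  unfolding kap_def by (intro continuous_intros)

lemma kap_has_partial: "has_partial i (kap p \<delta>) (\<lambda>x. 2 * (x $ i - p $ i))"
proof -
  have 12: "i = 1 \<or> i = 2" using exhaust_2 by blast
  show ?thesis unfolding kap_def[abs_def] power2_eq_square
    by (rule has_partial_cong, (rule has_partial_add has_partial_mult has_partial_coord
        has_partial_const)+) (use 12 in auto)
qed

lemma wt_has_partial:
  assumes "\<delta> > 0"
  shows "has_partial i (\<lambda>x. (r / kap p \<delta> x) ^ n)
      (\<lambda>x. - 2 * real n * (x $ i - p $ i) * (r / kap p \<delta> x) ^ n / kap p \<delta> x)"
proof -
  have "((\<lambda>t. (r / t) ^ n) has_real_derivative - real n * (r / t) ^ n / t) (at t)" if "t > 0"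
      for t :: real
  proof (cases n)
    case (Suc m)
    have "((\<lambda>t. r / t) has_real_derivative (- r / t\<^sup>2)) (at t)"
      using that by (auto intro!: derivative_eq_intros simp: power2_eq_square)
    from DERIV_power[OF this, of "Suc m"] show ?thesis
      unfolding Suc by (rule DERIV_cong) (use that in \<open>simp add: power2_eq_square field_simps\<close>)
  qed simp
  then have d: "((\<lambda>t. (r / t) ^ n) has_real_derivative - real n * (r / kap p \<delta> x) ^ n / kap p \<delta> x)
      (at (kap p \<delta> x))" for x
    using kap_pos[OF assms] by blast
  show ?thesis
    by (rule has_partial_cong[OF has_partial_chain[OF kap_has_partial[of i p \<delta>] d]]) simp
qed

text \<open>The divergence in \<open>key_inequality\<close> has integral 0, and a one-dimensional
  Poincare inequality bounds a function of bounded support by its first partial derivative. The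
  letters \<open>e1\<close> and \<open>e2\<close> occur twice each: this agreement of third
  derivatives makes them cancel in the divergence of N.\<close>

lemma energy_estimate:
  fixes p :: "real^2" and n :: nat
  assumes pos: "\<delta> > 0" "\<rho> > 0" "R > 0"
    and dG: "has_partial 1 G1 a" "has_partial 2 G1 b" "has_partial 1 G2 b" "has_partial 2 G2 c"
      "has_partial 1 b e1" "has_partial 2 b e2" "has_partial 1 c e2" "has_partial 2 a e1"
    and d\<zeta>: "has_partial 1 \<zeta> z1" "has_partial 2 \<zeta> z2"
    and cont: "continuous_on UNIV G1" "continuous_on UNIV G2" "continuous_on UNIV a"
        "continuous_on UNIV b"
      "continuous_on UNIV c" "continuous_on UNIV e1" "continuous_on UNIV e2"
      "continuous_on UNIV \<zeta>" "continuous_on UNIV z1" "continuous_on UNIV z2"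
    and supp: "\<And>x. x \<notin> cball p R \<Longrightarrow> \<zeta> x = 0" "\<And>x. x \<notin> cball p R \<Longrightarrow> z1 x = 0"
        "\<And>x. x \<notin> cball p R \<Longrightarrow> z2 x = 0"
  defines "\<sigma> \<equiv> \<lambda>x. (\<rho>\<^sup>2 / kap p \<delta> x) ^ n * ((G1 x)\<^sup>2 + (G2 x)\<^sup>2)"
  defines "B \<equiv> \<lambda>x. 82 * (((z1 x)\<^sup>2 + (z2 x)\<^sup>2) * (ln (1 + \<sigma> x))\<^sup>2)
     + 192 * ((\<zeta> x)\<^sup>2 * ((\<rho>\<^sup>2 / kap p \<delta> x) ^ n * (a x + c x)\<^sup>2 / (1 + \<sigma> x)))
     + 64 * real n * ((\<zeta> x)\<^sup>2 * (\<sigma> x * ln (1 + \<sigma> x) / (1 + \<sigma> x)) * (\<delta>\<^sup>2 / (kap p \<delta> x)\<^sup>2))"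
  shows "integrable lborel B" "integrable lborel (\<lambda>x. (\<zeta> x * (\<sigma> x * ln (1 + \<sigma> x) / (1 + \<sigma> x)))\<^sup>2)"
    "(LINT x|lborel. (\<zeta> x * (\<sigma> x * ln (1 + \<sigma> x) / (1 + \<sigma> x)))\<^sup>2) \<le> 4 * R\<^sup>2 * (LINT x|lborel. B x)"
proof -
  define \<kappa> where "\<kappa> = kap p \<delta>"
  define s where "s x = (\<rho>\<^sup>2 / \<kappa> x) ^ n" for x
  define q where "q x = (G1 x)\<^sup>2 + (G2 x)\<^sup>2" for x
  define y1 y2 where "y1 x = x $ 1 - p $ 1" and "y2 x = x $ 2 - p $ 2" for x :: "real^2"
  define L where "L x = ln (1 + \<sigma> x)" for x
  define k where "k x = L x / (1 + \<sigma> x)" for x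
  define P1 where "P1 x = G1 x * a x + G2 x * b x - n * q x * y1 x / \<kappa> x" for x
  define P2 where "P2 x = G1 x * b x + G2 x * c x - n * q x * y2 x / \<kappa> x" for x
  define N1 where "N1 x = G2 x * b x - G1 x * c x - n * q x * y1 x / \<kappa> x" for x
  define N2 where "N2 x = G1 x * b x - G2 x * a x - n * q x * y2 x / \<kappa> x" for x
  define T where "T x = \<sigma> x * L x / (1 + \<sigma> x)" for x
  define u where "u x = \<zeta> x * T x" for x
  define u1 where "u1 x = z1 x * T x + \<zeta> x * ((L x + \<sigma> x) / (1 + \<sigma> x)\<^sup>2 * (2 * s x * P1 x))" for x
  have \<sigma>_eq: "\<sigma> x = s x * q x" for x by (simp add: \<sigma>_def s_def q_def \<kappa>_def)
  have \<kappa>: "\<kappa> x > 0" for x using kap_pos[OF pos(1)] by (simp add: \<kappa>_def)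
  have \<sigma>: "\<sigma> x \<ge> 0" for x using \<kappa>[of x] by (simp add: \<sigma>_eq s_def q_def)
  have \<sigma>': "1 + \<sigma> x > 0" for x using \<sigma>[of x] by simp
  have [continuous_intros]: "continuous_on UNIV \<kappa>" "continuous_on UNIV y1" "continuous_on UNIV y2"
    unfolding \<kappa>_def y1_def y2_def by (intro kap_continuous continuous_intros)+
  note [continuous_intros] = cont
  have \<kappa>0: "\<kappa> x \<noteq> 0" "1 + \<sigma> x \<noteq> 0" "(1 + \<sigma> x)\<^sup>2 \<noteq> 0" for x using \<kappa>[of x] \<sigma>'[of x] by auto
  have [continuous_intros]: "continuous_on UNIV s" unfolding s_def[abs_def]
    by (intro continuous_intros ballI \<kappa>0)
  have [continuous_intros]: "continuous_on UNIV q" unfolding q_def[abs_def]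
    by (intro continuous_intros)
  have [continuous_intros]: "continuous_on UNIV \<sigma>" unfolding \<sigma>_eq[abs_def]
    by (intro continuous_intros)
  have [continuous_intros]: "continuous_on UNIV L" unfolding L_def[abs_def]
    by (intro continuous_intros ballI \<kappa>0)
  have [continuous_intros]: "continuous_on UNIV k" unfolding k_def[abs_def]
    by (intro continuous_intros ballI \<kappa>0)
  have [continuous_intros]: "continuous_on UNIV P1" "continuous_on UNIV N1" "continuous_on UNIV N2"
      "continuous_on UNIV P2"
    unfolding P1_def[abs_def] N1_def[abs_def] N2_def[abs_def] P2_def[abs_def]
    by (intro continuous_intros ballI \<kappa>0)+
  have [continuous_intros]: "continuous_on UNIV T" unfolding T_def[abs_def]
    by (intro continuous_intros ballI \<kappa>0)
  have [continuous_intros]: "continuous_on UNIV u" unfolding u_def[abs_def]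
    by (intro continuous_intros ballI \<kappa>0)
  have [continuous_intros]: "continuous_on UNIV u1" unfolding u1_def[abs_def]
    by (intro continuous_intros ballI \<kappa>0)
  have ds: "has_partial 1 s (\<lambda>x. - 2 * real n * y1 x * s x / \<kappa> x)"
      "has_partial 2 s (\<lambda>x. - 2 * real n * y2 x * s x / \<kappa> x)"
    unfolding s_def[abs_def] \<kappa>_def y1_def y2_def by (rule wt_has_partial[OF pos(1)])+
  have dq: "has_partial 1 q (\<lambda>x. 2 * (G1 x * a x + G2 x * b x))"
      "has_partial 2 q (\<lambda>x. 2 * (G1 x * b x + G2 x * c x))"
    unfolding q_def[abs_def] power2_eq_square
    by (rule has_partial_cong, (rule has_partial_add has_partial_mult dG)+, simp add:
        algebra_simps)+
  have d\<sigma>: "has_partial 1 \<sigma> (\<lambda>x. 2 * s x * P1 x)" "has_partial 2 \<sigma> (\<lambda>x. 2 * s x * P2 x)"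
    unfolding \<sigma>_eq[abs_def] P1_def P2_def
    by (rule has_partial_cong, (rule has_partial_mult ds dq)+, simp add: algebra_simps)+
  have "((\<lambda>t. ln (1 + t) / (1 + t)) has_real_derivative (1 - L x) / (1 + \<sigma> x)\<^sup>2) (at (\<sigma> x))" for x
    using \<sigma>'[of x] unfolding L_def by (auto intro!: derivative_eq_intros simp: power2_eq_square)
  then have dk: "has_partial 1 k (\<lambda>x. (1 - L x) / (1 + \<sigma> x)\<^sup>2 * (2 * s x * P1 x))"
      "has_partial 2 k (\<lambda>x. (1 - L x) / (1 + \<sigma> x)\<^sup>2 * (2 * s x * P2 x))"
    unfolding k_def[abs_def] L_def by (intro has_partial_chain d\<sigma>; simp)+
  have "((\<lambda>t. t * ln (1 + t) / (1 + t)) has_real_derivative (L x + \<sigma> x) / (1 + \<sigma> x)\<^sup>2) (at (\<sigma> x))"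
      for x
    using \<sigma>'[of x] unfolding L_def
    by (auto intro!: derivative_eq_intros simp: power2_eq_square) (simp add: field_simps)
  then have dT: "has_partial 1 T (\<lambda>x. (L x + \<sigma> x) / (1 + \<sigma> x)\<^sup>2 * (2 * s x * P1 x))"
    unfolding T_def[abs_def] L_def by (intro has_partial_chain d\<sigma>) simp
  have du: "has_partial 1 u u1"
    unfolding u_def[abs_def] u1_def[abs_def] by (rule has_partial_mult d\<zeta> dT)+
  have dy: "has_partial i y1 (\<lambda>x. if i = 1 then 1 else 0)"
      "has_partial i y2 (\<lambda>x. if i = 2 then 1 else 0)" for i
    unfolding y1_def y2_def by (rule has_partial_coord)+
  have dinv: "((\<lambda>t. 1 / t) has_real_derivative - 1 / (\<kappa> x)\<^sup>2) (at (\<kappa> x))" for x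
    using \<kappa>[of x] by (auto intro!: derivative_eq_intros simp: power2_eq_square)
  have dik: "has_partial 1 (\<lambda>x. 1 / \<kappa> x) (\<lambda>x. - 1 / (\<kappa> x)\<^sup>2 * (2 * y1 x))"
      "has_partial 2 (\<lambda>x. 1 / \<kappa> x) (\<lambda>x. - 1 / (\<kappa> x)\<^sup>2 * (2 * y2 x))"
    unfolding y1_def y2_def using has_partial_chain[OF kap_has_partial[of _ p \<delta>]
        dinv[unfolded \<kappa>_def]] by (auto simp: \<kappa>_def)
  define N1' where "N1' x = ((b x * b x + G2 x * e1 x) - (a x * c x + G1 x * e2 x))
     - n * (2 * (G1 x * a x + G2 x * b x) * y1 x / \<kappa> x + q x * (1 / \<kappa> x)
         - q x * y1 x * (2 * y1 x / (\<kappa> x)\<^sup>2))" for x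
  define N2' where "N2' x = ((b x * b x + G1 x * e2 x) - (c x * a x + G2 x * e1 x))
     - n * (2 * (G1 x * b x + G2 x * c x) * y2 x / \<kappa> x + q x * (1 / \<kappa> x)
         - q x * y2 x * (2 * y2 x / (\<kappa> x)\<^sup>2))" for x
  have N_eq: "N1 = (\<lambda>x. (G2 x * b x - G1 x * c x) - n * ((q x * y1 x) * (1 / \<kappa> x)))"
    "N2 = (\<lambda>x. (G1 x * b x - G2 x * a x) - n * ((q x * y2 x) * (1 / \<kappa> x)))"
    by (simp_all add: N1_def N2_def fun_eq_iff)
  have dN1: "has_partial 1 N1 N1'"
    unfolding N_eq
    by (rule has_partial_cong, (rule has_partial_diff has_partial_mult has_partial_const dG dq dy
        dik)+) (simp add: N1'_def algebra_simps add_divide_distrib)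
  have dN2: "has_partial 2 N2 N2'"
    unfolding N_eq
    by (rule has_partial_cong, (rule has_partial_diff has_partial_mult has_partial_const dG dq dy
        dik)+) (simp add: N2'_def algebra_simps add_divide_distrib)
  have cN': "continuous_on UNIV N1'" "continuous_on UNIV N2'"
    unfolding N1'_def[abs_def] N2'_def[abs_def]
        by (intro continuous_intros ballI \<kappa>0 power_not_zero)+
  \<comment> \<open>The field \<zeta>^2 \<tau>(\<sigma>) N / q, written with k s for
    \<tau>(\<sigma>) / q so that it is differentiable also where the gradient vanishes.\<close>
  define Z1 where "Z1 x = (\<zeta> x * \<zeta> x) * (k x * s x * N1 x)" for x
  define Z2 where "Z2 x = (\<zeta> x * \<zeta> x) * (k x * s x * N2 x)" for x
  define Z1' where "Z1' x = (z1 x * \<zeta> x + \<zeta> x * z1 x) * (k x * s x * N1 x) +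
     (\<zeta> x * \<zeta> x) * (((1 - L x) / (1 + \<sigma> x)\<^sup>2 * (2 * s x * P1 x) * s x
         + k x * (- 2 * real n * y1 x * s x / \<kappa> x)) * N1 x + k x * s x * N1' x)" for x
  define Z2' where "Z2' x = (z2 x * \<zeta> x + \<zeta> x * z2 x) * (k x * s x * N2 x) +
     (\<zeta> x * \<zeta> x) * (((1 - L x) / (1 + \<sigma> x)\<^sup>2 * (2 * s x * P2 x) * s x
         + k x * (- 2 * real n * y2 x * s x / \<kappa> x)) * N2 x + k x * s x * N2' x)" for x
  have dZ: "has_partial 1 Z1 Z1'" "has_partial 2 Z2 Z2'"
    unfolding Z1_def[abs_def] Z2_def[abs_def] Z1'_def[abs_def] Z2'_def[abs_def]
    by (rule has_partial_mult d\<zeta> dk ds dN1 dN2)+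
  have cZ: "continuous_on UNIV Z1" "continuous_on UNIV Z2" "continuous_on UNIV Z1'"
      "continuous_on UNIV Z2'"
    unfolding Z1_def[abs_def] Z2_def[abs_def] Z1'_def[abs_def] Z2'_def[abs_def]
    by (intro continuous_intros cN' ballI \<kappa>0)+
  \<comment> \<open>For the Poincare inequality: the first partial derivative of y1 u^2 has integral
    0, and |y1| \<le> R on the support.\<close>
  define Y where "Y x = y1 x * (u x * u x)" for x
  define Y' where "Y' x = u x * u x + y1 x * (u1 x * u x + u x * u1 x)" for x
  have dY: "has_partial 1 Y Y'"
    unfolding Y_def[abs_def] Y'_def[abs_def]
    by (rule has_partial_cong, (rule has_partial_mult dy du)+) simp
  have cY: "continuous_on UNIV Y" "continuous_on UNIV Y'"
    unfolding Y_def[abs_def] Y'_def[abs_def] by (intro continuous_intros)+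
  have zero: "Z1 x = 0" "Z2 x = 0" "Z1' x = 0" "Z2' x = 0" "Y x = 0" "Y' x = 0" "u x = 0" "B x = 0"
      if "x \<notin> cball p R" for x
    using supp[OF that] by (auto simp: Z1_def Z2_def Z1'_def Z2'_def Y_def Y'_def u_def u1_def
        B_def)
  have B_eq: "B x = 82 * (((z1 x)\<^sup>2 + (z2 x)\<^sup>2) * (L x)\<^sup>2)
      + 192 * ((\<zeta> x)\<^sup>2 * (s x * (a x + c x)\<^sup>2 / (1 + \<sigma> x)))
     + 64 * real n * ((\<zeta> x)\<^sup>2 * T x * (\<delta>\<^sup>2 / (\<kappa> x)\<^sup>2))" for x
    by (simp add: B_def L_def T_def s_def \<kappa>_def)
  have cB: "continuous_on UNIV B"
    unfolding B_eq[abs_def] by (intro continuous_intros ballI \<kappa>0 power_not_zero)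
  show iB: "integrable lborel B"
    by (rule integrable_continuous_bounded_support[OF cB zero(8)])
  have iu: "integrable lborel (\<lambda>x. (u x)\<^sup>2)"
    by (rule integrable_continuous_bounded_support[of _ p R])
        (use zero(7) in \<open>auto intro!: continuous_intros\<close>)
  then show "integrable lborel (\<lambda>x. (\<zeta> x * (\<sigma> x * ln (1 + \<sigma> x) / (1 + \<sigma> x)))\<^sup>2)"
    by (simp add: u_def T_def L_def)
  have iZ: "integrable lborel Z1'" "integrable lborel Z2'" "integrable lborel Y'"
    using integrable_continuous_bounded_support cZ cY zero by metis+
  have z: "(LINT x|lborel. Z1' x) = 0" "(LINT x|lborel. Z2' x) = 0" "(LINT x|lborel. Y' x) = 0"
    using integral_partial_eq_0[OF dZ(1) cZ(1,3) zero(1,3)]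
        integral_partial_eq_0[OF dZ(2) cZ(2,4) zero(2,4)]
      integral_partial_eq_0[OF dY cY zero(5,6)] by auto
  have key: "(u1 x)\<^sup>2 \<le> 32 * (Z1' x + Z2' x) + B x" for x
  proof -
    have div: "Z1' x + Z2' x = 2 * \<zeta> x * (L x / (1 + \<sigma> x)) * s x * (z1 x * N1 x + z2 x * N2 x) +
     (\<zeta> x)\<^sup>2 * (2 * ((1 - L x) / (1 + \<sigma> x)\<^sup>2) * (s x)\<^sup>2 * (P1 x * N1 x + P2 x * N2 x)
        + (L x / (1 + \<sigma> x)) * (- 2 * n * s x * (y1 x * N1 x + y2 x * N2 x) / \<kappa> x)
        + (L x / (1 + \<sigma> x)) * s x * (2 * ((b x)\<^sup>2 - a x * c x)
            - n * (2 * ((G1 x * a x + G2 x * b x) * y1 x + (G1 x * b x + G2 x * c x) * y2 x) / \<kappa> x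
            + q x * (2 * \<delta>\<^sup>2 / (\<kappa> x)\<^sup>2))))"
    proof -
      have \<kappa>y: "\<delta>\<^sup>2 = \<kappa> x - y1 x * y1 x - y2 x * y2 x"
          by (simp add: \<kappa>_def kap_def y1_def y2_def power2_eq_square)
      \<comment> \<open>The third derivatives cancel. Writing \<delta>^2 as \<kappa> - |y|^2
        identifies 2 / \<kappa> - 2 |y|^2 / \<kappa>^2 with 2 \<delta>^2 / \<kappa>^2.\<close>
      have N': "N1' x + N2' x = 2 * ((b x)\<^sup>2 - a x * c x)
          - n * (2 * ((G1 x * a x + G2 x * b x) * y1 x + (G1 x * b x + G2 x * c x) * y2 x) / \<kappa> x
          + q x * (2 * \<delta>\<^sup>2 / (\<kappa> x)\<^sup>2))"
        unfolding \<kappa>y N1'_def N2'_def using \<kappa>0(1)[of x] by (simp add: field_simps power2_eq_square)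
      show ?thesis unfolding N'[symmetric] Z1'_def Z2'_def k_def[symmetric]
        by (simp add: divide_inverse power2_eq_square algebra_simps)
    qed
    show ?thesis
      using key_inequality[OF pos(1,2), where ?z1.0 = "z1 x" and ?z2.0 = "z2 x" and ?G1.0 =
          "G1 x" and ?G2.0 = "G2 x"
        and ?y1.0 = "y1 x" and ?y2.0 = "y2 x" and n = n and \<zeta> = "\<zeta> x" and a = "a x" and b =
            "b x" and c = "c x"]
      unfolding B_eq div u1_def T_def L_def \<sigma>_eq P1_def N1_def N2_def P2_def s_def q_def \<kappa>_def
          kap_def y1_def y2_def
      by linarith
  qed
  have "(u x)\<^sup>2 \<le> 2 * Y' x + 128 * R\<^sup>2 * (Z1' x + Z2' x) + 4 * R\<^sup>2 * B x" for x
  proof (cases "x \<in> cball p R")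
    case True
    have "\<bar>y1 x\<bar> \<le> R"
    proof -
      have "\<bar>(x - p) $ 1\<bar> \<le> norm (x - p)" by (rule component_le_norm_cart)
      then show ?thesis using True by (simp add: y1_def dist_norm norm_minus_commute)
    qed
    then have "(y1 x)\<^sup>2 \<le> R\<^sup>2" using abs_le_square_iff[of "y1 x" R] pos(3) by simp
    then have 1: "(y1 x)\<^sup>2 * (u1 x)\<^sup>2 \<le> R\<^sup>2 * (u1 x)\<^sup>2" by (intro mult_right_mono) auto
    \<comment> \<open>This is the nonnegativity of (u + 2 y1 u1)^2. Inserting \<open>key\<close>
      then gives 128 = 4 * 32.\<close>
    have "(u x)\<^sup>2 \<le> 2 * Y' x + 4 * ((y1 x)\<^sup>2 * (u1 x)\<^sup>2)"
      using zero_le_power2[of "u x + 2 * (y1 x * u1 x)"]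
      by (simp add: Y'_def power2_sum power_mult_distrib power2_eq_square algebra_simps)
    also have "\<dots> \<le> 2 * Y' x + 4 * (R\<^sup>2 * (32 * (Z1' x + Z2' x) + B x))"
      using 1 mult_left_mono[OF key[of x], of "R\<^sup>2"] by simp
    finally show ?thesis by (simp add: algebra_simps)
  qed (use zero in auto)
  then have "(LINT x|lborel. (u x)\<^sup>2) \<le> (LINT x|lborel. 2 * Y' x + 128 * R\<^sup>2 * (Z1' x + Z2' x)
      + 4 * R\<^sup>2 * B x)"
    using iu iZ iB by (intro integral_mono) auto
  also have "\<dots> = 4 * R\<^sup>2 * (LINT x|lborel. B x)"
    using iZ iB z by simp
  finally show "(LINT x|lborel. (\<zeta> x * (\<sigma> x * ln (1 + \<sigma> x) / (1 + \<sigma> x)))\<^sup>2)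
      \<le> 4 * R\<^sup>2 * (LINT x|lborel. B x)"
    by (simp add: u_def T_def L_def)
qed

section \<open>Limits, cutoffs and mollifying sequences\<close>

text \<open>On the left of the estimates only almost everywhere convergence is available. The bounds
  may vary with \<open>m\<close> as long as they converge, and integrability of the limit is part of
  the gain.\<close>

lemma fatou_bound:
  fixes f :: "nat \<Rightarrow> 'b \<Rightarrow> real"
  assumes int: "\<And>m. integrable M (f m)" and nn: "\<And>m x. 0 \<le> f m x"
    and lim: "AE x in M. (\<lambda>m. f m x) \<longlonglongrightarrow> F x" and F: "F \<in> borel_measurable M"
    and le: "\<And>m. (LINT x|M. f m x) \<le> c m" and c: "c \<longlonglongrightarrow> C"
  shows "integrable M F" "(LINT x|M. F x) \<le> C"
proof -
  have "0 \<le> c m" for m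
    using order_trans[OF Bochner_Integration.integral_nonneg le] nn by blast
  then have C0: "C \<ge> 0" by (intro LIMSEQ_le_const[OF c]) auto
  have Fnn: "AE x in M. 0 \<le> F x"
    using lim by eventually_elim (auto intro!: LIMSEQ_le_const nn)
  have [measurable]: "f m \<in> borel_measurable M" for m using int by auto
  have "(\<integral>\<^sup>+x. ennreal (F x) \<partial>M) = (\<integral>\<^sup>+x. liminf (\<lambda>m. ennreal (f m x)) \<partial>M)"
  proof (rule nn_integral_cong_AE)
    show "AE x in M. ennreal (F x) = liminf (\<lambda>m. ennreal (f m x))"
      using lim
    proof eventually_elim
      fix x assume "(\<lambda>m. f m x) \<longlonglongrightarrow> F x"
      then have "(\<lambda>m. ennreal (f m x)) \<longlonglongrightarrow> ennreal (F x)" by (rule tendsto_ennrealI)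
      then show "ennreal (F x) = liminf (\<lambda>m. ennreal (f m x))"
        by (simp add: lim_imp_Liminf)
    qed
  qed
  also have "\<dots> \<le> liminf (\<lambda>m. \<integral>\<^sup>+x. ennreal (f m x) \<partial>M)"
    by (rule nn_integral_liminf) measurable
  also have "\<dots> \<le> liminf (\<lambda>m. ennreal (c m))"
  proof (intro Liminf_mono always_eventually allI)
    fix m
    have "(\<integral>\<^sup>+x. ennreal (f m x) \<partial>M) = ennreal (LINT x|M. f m x)"
      using nn int by (intro nn_integral_eq_integral) auto
    then show "(\<integral>\<^sup>+x. ennreal (f m x) \<partial>M) \<le> ennreal (c m)" using le by (simp add: ennreal_leI)
  qed
  also have "\<dots> = ennreal C"
    using c by (intro lim_imp_Liminf tendsto_ennrealI) auto
  finally have bound: "(\<integral>\<^sup>+x. ennreal (F x) \<partial>M) \<le> ennreal C" .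
  show iF: "integrable M F"
    using F Fnn bound by (intro integrableI_nonneg)
        (auto simp: le_less_trans[OF _ ennreal_less_top])
  have "ennreal (LINT x|M. F x) \<le> ennreal C"
    using bound nn_integral_eq_integral[OF iF Fnn] by simp
  then show "(LINT x|M. F x) \<le> C" using C0 by (simp add: ennreal_le_iff)
qed

text \<open>Split w_m f_m into w_m (f_m - F) and w_m F: the first is small because the weights are
  uniformly bounded, the second converges by domination. The terms with mollified squares pass to
  the limit in this way.\<close>

lemma weighted_L1_tendsto:
  fixes f :: "nat \<Rightarrow> 'b \<Rightarrow> real"
  assumes f: "\<And>m. integrable M (f m)" "integrable M F" "(\<lambda>m. LINT x|M. \<bar>f m x - F x\<bar>) \<longlonglongrightarrow> 0"
    and w: "\<And>m. w m \<in> borel_measurable M" "w0 \<in> borel_measurable M"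
      "\<And>m x. \<bar>w m x\<bar> \<le> W" "AE x in M. (\<lambda>m. w m x) \<longlonglongrightarrow> w0 x"
  shows "\<And>m. integrable M (\<lambda>x. w m x * f m x)" "integrable M (\<lambda>x. w0 x * F x)"
    "(\<lambda>m. LINT x|M. w m x * f m x) \<longlonglongrightarrow> (LINT x|M. w0 x * F x)"
proof -
  note [measurable] = w(1,2)
  have [measurable]: "f m \<in> borel_measurable M" "F \<in> borel_measurable M" for m using f by auto
  have b: "integrable M (\<lambda>x. w m x * G x)" if "integrable M G" for m G
  proof -
    have [measurable]: "G \<in> borel_measurable M" using that by auto
    show ?thesis
      by (rule Bochner_Integration.integrable_bound[of _ "\<lambda>x. W * G x"])
        (use that w(3)[of m] in \<open>auto simp: abs_mult intro!: AE_I2 mult_right_mono intro: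
            order_trans[OF _ abs_ge_self]\<close>)
  qed
  then show "integrable M (\<lambda>x. w m x * f m x)" for m using f by blast
  have dc: "integrable M (\<lambda>x. w0 x * F x)" "(\<lambda>m. LINT x|M. w m x * F x) \<longlonglongrightarrow> (LINT x|M. w0 x * F x)"
  proof -
    have *: "AE x in M. (\<lambda>m. w m x * F x) \<longlonglongrightarrow> w0 x * F x"
      using w(4) by eventually_elim (intro tendsto_intros)
    have **: "AE x in M. norm (w m x * F x) \<le> W * \<bar>F x\<bar>" for m
      using w(3)[of m] by (auto simp: abs_mult intro!: AE_I2 mult_right_mono)
    show "integrable M (\<lambda>x. w0 x * F x)"
      by (rule integrable_dominated_convergence[OF _ _ _ * **]) (use f in auto)
    show "(\<lambda>m. LINT x|M. w m x * F x) \<longlonglongrightarrow> (LINT x|M. w0 x * F x)"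
      by (rule integral_dominated_convergence[OF _ _ _ * **]) (use f in auto)
  qed
  show "integrable M (\<lambda>x. w0 x * F x)" by (rule dc)
  have "(\<lambda>m. LINT x|M. w m x * (f m x - F x)) \<longlonglongrightarrow> 0"
  proof (rule Lim_null_comparison)
    show "\<forall>\<^sub>F m in sequentially. norm (LINT x|M. w m x * (f m x - F x))
        \<le> W * (LINT x|M. \<bar>f m x - F x\<bar>)"
    proof (intro always_eventually allI)
      fix m
      have "norm (LINT x|M. w m x * (f m x - F x)) \<le> (LINT x|M. norm (w m x * (f m x - F x)))"
        by (rule integral_norm_bound)
      also have "\<dots> \<le> (LINT x|M. W * \<bar>f m x - F x\<bar>)"
      proof (rule integral_mono)
        show "integrable M (\<lambda>x. norm (w m x * (f m x - F x)))"
          by (intro integrable_norm b Bochner_Integration.integrable_diff f)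
      qed (use f w(3)[of m] in \<open>auto simp: abs_mult intro!: mult_right_mono\<close>)
      finally have "norm (LINT x|M. w m x * (f m x - F x)) \<le> (LINT x|M. W * \<bar>f m x - F x\<bar>)" .
      then show "norm (LINT x|M. w m x * (f m x - F x)) \<le> W * (LINT x|M. \<bar>f m x - F x\<bar>)" by simp
    qed
    show "(\<lambda>m. W * (LINT x|M. \<bar>f m x - F x\<bar>)) \<longlonglongrightarrow> 0"
      using tendsto_mult_left[OF f(3), of W] by simp
  qed
  then have "(\<lambda>m. (LINT x|M. w m x * (f m x - F x)) + (LINT x|M. w m x * F x)) \<longlonglongrightarrow> 0
      + (LINT x|M. w0 x * F x)"
    by (intro tendsto_add dc)
  moreover have "(LINT x|M. w m x * (f m x - F x)) + (LINT x|M. w m x * F x)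
      = (LINT x|M. w m x * f m x)" for m
    by (subst Bochner_Integration.integral_add[symmetric]) (use b f in \<open>auto simp: algebra_simps\<close>)
  ultimately show "(\<lambda>m. LINT x|M. w m x * f m x) \<longlonglongrightarrow> (LINT x|M. w0 x * F x)" by simp
qed

lemma pos_part_square_deriv: "((\<lambda>y. (max 0 y)\<^sup>2) has_real_derivative 2 * max 0 y) (at (y::real))"
proof -
  consider "y > 0" | "y < 0" | "y = 0" by linarith
  then show ?thesis
  proof cases
    case 1
    have "((\<lambda>y. y\<^sup>2) has_real_derivative 2 * max 0 y) (at y)"
      using 1 by (auto intro!: derivative_eq_intros)
    then show ?thesis
      by (rule DERIV_cong_ev[THEN iffD1, OF refl _ refl, rotated])
        (use 1 in \<open>auto intro!: eventually_mono[OF eventually_nhds_in_open[of "{0<..}"]]\<close>)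
  next
    case 2
    have "((\<lambda>y. 0) has_real_derivative 2 * max 0 y) (at y)"
      using 2 by (auto intro!: derivative_eq_intros)
    then show ?thesis
      by (rule DERIV_cong_ev[THEN iffD1, OF refl _ refl, rotated])
        (use 2 in \<open>auto intro!: eventually_mono[OF eventually_nhds_in_open[of "{..<0}"]]\<close>)
  next
    case 3
    have "((\<lambda>h. (max 0 h)\<^sup>2 / h) \<longlongrightarrow> (0::real)) (at 0)"
    proof (rule Lim_null_comparison)
      show "\<forall>\<^sub>F h in at 0. norm ((max 0 h)\<^sup>2 / h) \<le> \<bar>h\<bar>"
        by (intro always_eventually) (auto simp: max_def power2_eq_square)
      show "((\<lambda>h::real. \<bar>h\<bar>) \<longlongrightarrow> 0) (at 0)" by (auto intro!: tendsto_eq_intros)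
    qed
    then show ?thesis using 3 by (simp add: DERIV_def)
  qed
qed

text \<open>The energy estimate differentiates the cutoff only once, so C^1 is enough and squares of
  positive parts can be used: with w = |x - p|^2 / \<rho>^2 - 1 the cutoff is the squared positive
  part of 1 - (w^+)^2. It is 1 where w \<le> 0 and vanishes where w \<ge> 1, that is from the
  distance sqrt 2 \<rho> < 3/2 \<rho> on.\<close>

lemma cutoff_exists:
  fixes p :: "real^2"
  assumes "\<rho> > 0"
  shows "\<exists>\<zeta> z1 z2. has_partial 1 \<zeta> z1 \<and> has_partial 2 \<zeta> z2 \<and> continuous_on UNIV \<zeta>
      \<and> continuous_on UNIV z1 \<and> continuous_on UNIV z2 \<and>
    (\<forall>x. 0 \<le> \<zeta> x \<and> \<zeta> x \<le> 1 \<and> (z1 x)\<^sup>2 + (z2 x)\<^sup>2 \<le> 288 / \<rho>\<^sup>2) \<and>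
    (\<forall>x. dist x p \<le> \<rho> \<longrightarrow> \<zeta> x = 1 \<and> z1 x = 0 \<and> z2 x = 0) \<and>
    (\<forall>x. x \<notin> cball p (3/2 * \<rho>) \<longrightarrow> \<zeta> x = 0 \<and> z1 x = 0 \<and> z2 x = 0)"
proof -
  define w where "w x = kap p 0 x / \<rho>\<^sup>2 - 1" for x
  define h where "h x = 1 - (max 0 (w x))\<^sup>2" for x
  define \<zeta> where "\<zeta> x = (max 0 (h x))\<^sup>2" for x
  define z where "z i x = 2 * max 0 (h x) * - (2 * max 0 (w x) * (2 * (x $ i - p $ i) / \<rho>\<^sup>2))"
      for i x
  have "((\<lambda>t. t / \<rho>\<^sup>2 - 1) has_real_derivative 1 / \<rho>\<^sup>2) (at t)" for t
    by (rule DERIV_cong[OF DERIV_diff[OF DERIV_cdivide[OF DERIV_ident] DERIV_const]]) simp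
  from has_partial_chain[OF kap_has_partial this]
  have dw: "has_partial i w (\<lambda>x. 2 * (x $ i - p $ i) / \<rho>\<^sup>2)" for i
    unfolding w_def[abs_def] by simp
  have dh: "has_partial i h (\<lambda>x. - (2 * max 0 (w x) * (2 * (x $ i - p $ i) / \<rho>\<^sup>2)))" for i
    unfolding h_def[abs_def]
    by (rule has_partial_cong, rule has_partial_diff, rule has_partial_const, rule
        has_partial_chain[OF dw], rule pos_part_square_deriv) simp
  have dz: "has_partial i \<zeta> (z i)" for i
    unfolding \<zeta>_def[abs_def] z_def[abs_def]
    by (rule has_partial_chain[OF dh pos_part_square_deriv])
  have [continuous_intros]: "continuous_on UNIV w" "continuous_on UNIV h"
    unfolding w_def[abs_def] h_def[abs_def] using assms
        by (auto intro!: continuous_intros kap_continuous)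
  have cont: "continuous_on UNIV \<zeta>" "continuous_on UNIV (z i)" for i
    unfolding \<zeta>_def[abs_def] z_def[abs_def] using assms by (auto intro!: continuous_intros)
  have h1: "h x \<le> 1" for x by (simp add: h_def)
  have in1: "w x \<le> 0" if "dist x p \<le> \<rho>" for x
    using that assms power_mono[OF that, of 2] by (simp add: w_def kap_eq divide_le_eq)
  have out: "h x \<le> 0" if "w x \<ge> 1" for x
    using one_le_power[of "w x" 2] that by (simp add: h_def max_def)
  have out': "w x \<ge> 1" if "x \<notin> cball p (3/2 * \<rho>)" for x
  proof -
    have "(3/2 * \<rho>)\<^sup>2 \<le> (dist x p)\<^sup>2"
      using that assms by (intro power_mono) (auto simp: dist_commute)
    then have "2 * \<rho>\<^sup>2 \<le> (dist x p)\<^sup>2" by (simp add: power2_eq_square) (smt (verit) zero_le_square)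
    then show ?thesis using assms by (simp add: w_def kap_eq le_divide_eq)
  qed
  have zb: "(z 1 x)\<^sup>2 + (z 2 x)\<^sup>2 \<le> 288 / \<rho>\<^sup>2" for x
  proof (cases "w x \<ge> 1")
    case True
    then show ?thesis using out[OF True] by (simp add: z_def)
  next
    case False
    have k2: "kap p 0 x \<le> 2 * \<rho>\<^sup>2" using False assms by (simp add: w_def field_simps)
    \<comment> \<open>64 is the square of 2 * 2 * 2, one factor from each of the three nested
      squares.\<close>
    have "(z 1 x)\<^sup>2 + (z 2 x)\<^sup>2 = (max 0 (h x))\<^sup>2 * (max 0 (w x))\<^sup>2 * (64 * kap p 0 x / (\<rho>\<^sup>2 * \<rho>\<^sup>2))"
    proof -
      have "(2 * H * - (2 * W * (2 * y1 / r)))\<^sup>2 + (2 * H * - (2 * W * (2 * y2 / r)))\<^sup>2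
        = H\<^sup>2 * W\<^sup>2 * (64 * (y1\<^sup>2 + y2\<^sup>2) / (r * r))" for H W y1 y2 r :: real
        by (simp add: power2_eq_square add_divide_distrib algebra_simps)
      then show ?thesis by (simp only: z_def kap_def zero_power2 add_0_right)
    qed
    also have "\<dots> \<le> 1 * 1 * (64 * (2 * \<rho>\<^sup>2) / (\<rho>\<^sup>2 * \<rho>\<^sup>2))"
      using h1[of x] False k2 assms
      by (intro mult_mono divide_right_mono) (auto simp: power_le_one_iff max_def kap_eq
          abs_square_le_1)
    also have "\<dots> = 128 / \<rho>\<^sup>2"
    proof -
      have "1 * 1 * (64 * (2 * r) / (r * r)) = 128 / r" if "r > 0" for r :: real
        using that by (simp add: field_simps)
      then show ?thesis using assms by (meson zero_less_power)
    qed
    also have "\<dots> \<le> 288 / \<rho>\<^sup>2" using assms by (intro divide_right_mono) auto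
    finally show ?thesis .
  qed
  show ?thesis
  proof (intro exI conjI allI impI)
    show "has_partial 1 \<zeta> (z 1)" "has_partial 2 \<zeta> (z 2)" by (rule dz)+
    show "\<zeta> x \<le> 1" for x using h1[of x] by (auto simp: \<zeta>_def max_def power_le_one_iff)
    show "dist x p \<le> \<rho> \<Longrightarrow> \<zeta> x = 1" for x using in1[of x] by (simp add: \<zeta>_def h_def)
  qed (use in1 out out' zb cont in \<open>auto simp: z_def \<zeta>_def simp del: mem_cball\<close>)
qed

text \<open>L^1 convergence gives almost everywhere convergence only along a subsequence. The
  extraction for \<open>g2\<close> refines the one for \<open>g1\<close>.\<close>

lemma mollifier_sequence:
  assumes "r > 0" and g: "integrable lborel g1" "integrable lborel g2"
  shows "\<exists>\<epsilon> H. (\<forall>m. 0 < \<epsilon> m \<and> \<epsilon> m \<le> r \<and> mollifier (\<epsilon> m) (H m)) \<and> \<epsilon> \<longlonglongrightarrow> 0 \<and>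
    (AE x in lborel. (\<lambda>m. conv (H m) 0 0 g1 x) \<longlonglongrightarrow> g1 x)
        \<and> (AE x in lborel. (\<lambda>m. conv (H m) 0 0 g2 x) \<longlonglongrightarrow> g2 x)"
proof -
  define \<epsilon> where "\<epsilon> m = r / real (Suc m)" for m
  have \<epsilon>: "0 < \<epsilon> m" "\<epsilon> m \<le> r" for m using assms(1) by (auto simp: \<epsilon>_def field_simps)
  have \<epsilon>0: "\<epsilon> \<longlonglongrightarrow> 0"
    using tendsto_mult_left[OF LIMSEQ_inverse_real_of_nat, of r]
        by (simp add: \<epsilon>_def[abs_def] divide_inverse)
  obtain H where H: "\<And>m. mollifier (\<epsilon> m) (H m)" using mollifier_exists[OF \<epsilon>(1)] by metis
  have sub: "\<exists>r. strict_mono r \<and> (AE x in lborel. (\<lambda>m. conv (H (f (r m))) 0 0 g x) \<longlonglongrightarrow> g x)"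
    if "integrable lborel g" "strict_mono f" for g and f :: "nat \<Rightarrow> nat"
  proof -
    have "(\<lambda>m. LINT x|lborel. \<bar>conv (H (f m)) 0 0 g x - g x\<bar>) \<longlonglongrightarrow> 0"
      using LIMSEQ_subseq_LIMSEQ[OF \<epsilon>0 that(2)] \<epsilon> H
      by (intro conv_tendsto_L1[of _ "\<lambda>m. \<epsilon> (f m)"] that) (auto simp: o_def)
    then have "\<exists>r::nat\<Rightarrow>nat. strict_mono r \<and> (AE x in lborel. (\<lambda>n. conv (H (f (r n))) 0 0 g x - g x)
        \<longlonglongrightarrow> 0)"
      by (intro tendsto_L1_AE_subseq[of lborel "\<lambda>m x. conv (H (f m)) 0 0 g x - g x"]
          Bochner_Integration.integrable_diff
           conv_L1(1)[OF H] that) simp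
    then show ?thesis by (simp add: LIM_zero_iff)
  qed
  obtain r1 where r1: "strict_mono r1" "AE x in lborel. (\<lambda>m. conv (H (r1 m)) 0 0 g1 x) \<longlonglongrightarrow> g1 x"
    using sub[OF g(1) strict_mono_id] by auto
  obtain r2 where r2: "strict_mono r2" "AE x in lborel. (\<lambda>m. conv (H (r1 (r2 m))) 0 0 g2 x) \<longlonglongrightarrow> g2 x"
    using sub[OF g(2) r1(1)] by auto
  have "AE x in lborel. (\<lambda>m. conv (H (r1 (r2 m))) 0 0 g1 x) \<longlonglongrightarrow> g1 x"
    using r1(2) by eventually_elim (use LIMSEQ_subseq_LIMSEQ[OF _ r2(1)] in \<open>auto simp: o_def\<close>)
  moreover have "(\<lambda>m. \<epsilon> (r1 (r2 m))) \<longlonglongrightarrow> 0"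
    using LIMSEQ_subseq_LIMSEQ[OF LIMSEQ_subseq_LIMSEQ[OF \<epsilon>0 r1(1)] r2(1)] by (simp add: o_def)
  ultimately show ?thesis
    using r2 \<epsilon> H by (intro exI[of _ "\<lambda>m. \<epsilon> (r1 (r2 m))"] exI[of _ "\<lambda>m. H (r1 (r2 m))"]) auto
qed

text \<open>The divergence of \<phi> V \<nabla>V has integral 0. The factor \<phi> is left general
  because it will be a cutoff times a negative power of \<open>kap\<close>.\<close>

lemma caccioppoli_identity:
  fixes p :: "real^2"
  assumes dd: "has_partial 1 V G1" "has_partial 2 V G2" "has_partial 1 G1 a" "has_partial 2 G2 c"
      "has_partial 1 \<phi> \<phi>1" "has_partial 2 \<phi> \<phi>2"
    and cont: "continuous_on UNIV V" "continuous_on UNIV G1" "continuous_on UNIV G2"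
        "continuous_on UNIV a"
      "continuous_on UNIV c" "continuous_on UNIV \<phi>" "continuous_on UNIV \<phi>1" "continuous_on UNIV \<phi>2"
    and supp: "\<And>x. x \<notin> cball p R \<Longrightarrow> \<phi> x = 0" "\<And>x. x \<notin> cball p R \<Longrightarrow> \<phi>1 x = 0"
        "\<And>x. x \<notin> cball p R \<Longrightarrow> \<phi>2 x = 0"
  shows "integrable lborel (\<lambda>x. \<phi> x * ((G1 x)\<^sup>2 + (G2 x)\<^sup>2))"
    "integrable lborel (\<lambda>x. V x * (\<phi> x * (a x + c x) + \<phi>1 x * G1 x + \<phi>2 x * G2 x))"
    "(LINT x|lborel. \<phi> x * ((G1 x)\<^sup>2 + (G2 x)\<^sup>2)) =
        - (LINT x|lborel. V x * (\<phi> x * (a x + c x) + \<phi>1 x * G1 x + \<phi>2 x * G2 x))"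
proof -
  note [continuous_intros] = cont
  define D1 where "D1 x = (\<phi>1 x * V x + \<phi> x * G1 x) * G1 x + (\<phi> x * V x) * a x" for x
  define D2 where "D2 x = (\<phi>2 x * V x + \<phi> x * G2 x) * G2 x + (\<phi> x * V x) * c x" for x
  have c: "continuous_on UNIV D1" "continuous_on UNIV D2"
    unfolding D1_def[abs_def] D2_def[abs_def] by (intro continuous_intros)+
  have z: "D1 x = 0" "D2 x = 0" if "x \<notin> cball p R" for x using supp[OF that]
      by (simp_all add: D1_def D2_def)
  have "(LINT x|lborel. D1 x) = 0"
    by (rule integral_partial_eq_0[of 1 "\<lambda>x. \<phi> x * V x * G1 x" D1 p R])
      (use dd c z supp in \<open>auto simp: D1_def[abs_def] intro!: has_partial_mult continuous_intros
          simp del: mem_cball\<close>)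
  moreover have "(LINT x|lborel. D2 x) = 0"
    by (rule integral_partial_eq_0[of 2 "\<lambda>x. \<phi> x * V x * G2 x" D2 p R])
      (use dd c z supp in \<open>auto simp: D2_def[abs_def] intro!: has_partial_mult continuous_intros
          simp del: mem_cball\<close>)
  moreover have i: "integrable lborel D1" "integrable lborel D2"
    using integrable_continuous_bounded_support c z by metis+
  moreover show i1: "integrable lborel (\<lambda>x. \<phi> x * ((G1 x)\<^sup>2 + (G2 x)\<^sup>2))"
    by (rule integrable_continuous_bounded_support[of _ p R])
        (use supp in \<open>auto intro!: continuous_intros simp del: mem_cball\<close>)
  moreover show i2: "integrable lborel (\<lambda>x. V x * (\<phi> x * (a x + c x) + \<phi>1 x * G1 x + \<phi>2 x * G2 x))"
    by (rule integrable_continuous_bounded_support[of _ p R])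
        (use supp in \<open>auto intro!: continuous_intros simp del: mem_cball\<close>)
  ultimately have "0 = (LINT x|lborel. D1 x + D2 x)" by simp
  also have "\<dots> = (LINT x|lborel. \<phi> x * ((G1 x)\<^sup>2 + (G2 x)\<^sup>2)
      + V x * (\<phi> x * (a x + c x) + \<phi>1 x * G1 x + \<phi>2 x * G2 x))"
    by (intro Bochner_Integration.integral_cong)
        (auto simp: D1_def D2_def power2_eq_square algebra_simps)
  also have "\<dots> = (LINT x|lborel. \<phi> x * ((G1 x)\<^sup>2 + (G2 x)\<^sup>2))
      + (LINT x|lborel. V x * (\<phi> x * (a x + c x) + \<phi>1 x * G1 x + \<phi>2 x * G2 x))"
    by (rule Bochner_Integration.integral_add[OF i1 i2])
  finally show "(LINT x|lborel. \<phi> x * ((G1 x)\<^sup>2 + (G2 x)\<^sup>2)) =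
      - (LINT x|lborel. V x * (\<phi> x * (a x + c x) + \<phi>1 x * G1 x + \<phi>2 x * G2 x))"
    by linarith
qed

section \<open>Vanishing of the gradient near a zero of infinite order\<close>

text \<open>The multiplier \<tau> of \<open>key_inequality\<close>.\<close>

definition log_mean :: "real \<Rightarrow> real" where
  "log_mean t = t * ln (1 + t) / (1 + t)"

lemma log_mean_ge:
  assumes "1 \<le> a" "a \<le> t"
  shows "ln (1 + a) / 2 \<le> log_mean t"
proof -
  have "ln (1 + a) \<le> ln (1 + t)" using assms by (subst ln_le_cancel_iff) auto
  then have "1 / 2 * ln (1 + a) \<le> t / (1 + t) * ln (1 + t)"
    using assms by (intro mult_mono) (auto simp: field_simps)
  then show ?thesis by (simp add: log_mean_def)
qed

text \<open>From 1 + t \<le> (1 + sqrt t)^2. It makes the term with the gradient of the cutoff,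
  which is quadratic in the logarithm, linear in q and hence integrable.\<close>

lemma ln_one_plus_square_le: "t \<ge> 0 \<Longrightarrow> (ln (1 + t))\<^sup>2 \<le> 4 * (t::real)"
proof -
  assume t: "t \<ge> 0"
  have "ln (1 + t) \<le> ln ((1 + sqrt t)\<^sup>2)"
    using t by (subst ln_le_cancel_iff) (auto simp: power2_sum intro!: add_pos_nonneg)
  also have "\<dots> = 2 * ln (1 + sqrt t)" using t by (simp add: ln_realpow add_pos_nonneg)
  also have "\<dots> \<le> 2 * sqrt t" using t by (simp add: ln_add_one_self_le_self)
  finally have "(ln (1 + t))\<^sup>2 \<le> (2 * sqrt t)\<^sup>2" using t by (intro power_mono) auto
  then show ?thesis using t by (simp add: power_mult_distrib)
qed

text \<open>Near \<open>p\<close>, the functions \<open>g1, g2\<close> are the weak gradient and \<open>d\<close> the weak Laplacian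
  of \<open>u\<close>, expressed through mollifications. All functions are meant to be cut off outside
  \<open>cball p (2 * \<rho>)\<close>, so that they are integrable on the whole plane.\<close>

definition has_local_gradient ::
  "real^2 \<Rightarrow> real \<Rightarrow> (real^2 \<Rightarrow> real) \<Rightarrow> (real^2 \<Rightarrow> real) \<Rightarrow> (real^2 \<Rightarrow> real) \<Rightarrow> (real^2 \<Rightarrow> real) \<Rightarrow> bool"
      where
  "has_local_gradient p \<rho> u g1 g2 d \<longleftrightarrow>
     integrable lborel u \<and> integrable lborel g1 \<and> integrable lborel g2 \<and> integrable lborel d \<and>
     (\<forall>\<epsilon> H x. mollifier \<epsilon> H \<longrightarrow> \<epsilon> \<le> \<rho> / 4 \<longrightarrow> x \<in> cball p (3/2 * \<rho>) \<longrightarrow>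
        conv H 1 0 u x = conv H 0 0 g1 x \<and> conv H 0 1 u x = conv H 0 0 g2 x \<and>
        conv H 2 0 u x + conv H 0 2 u x = conv H 0 0 d x)"

text \<open>Testing \<open>\<Delta>u\<close> against \<open>\<zeta> \<kappa>\<^sup>-\<^sup>M u\<close> transfers the infinite order of vanishing from
  \<open>u\<close> to its gradient. The bound must not depend on \<open>\<delta>\<close>.\<close>

lemma gradient_weighted_bound:
  fixes p :: "real^2"
  assumes \<rho>: "\<rho> > 0" and grad: "has_local_gradient p \<rho> u g1 g2 d"
    and cont: "continuous_on (cball p (2 * \<rho>)) u"
    and van: "\<And>x. x \<in> cball p (2 * \<rho>) \<Longrightarrow> \<bar>u x\<bar> \<le> C * dist x p ^ (2 * M + 2)"
    and \<zeta>: "has_partial 1 \<zeta> z1" "has_partial 2 \<zeta> z2" "continuous_on UNIV \<zeta>" "continuous_on UNIV z1"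
        "continuous_on UNIV z2"
      "\<And>x. 0 \<le> \<zeta> x" "\<And>x. \<zeta> x \<le> 1" "\<And>x. (z1 x)\<^sup>2 + (z2 x)\<^sup>2 \<le> 288 / \<rho>\<^sup>2"
      "\<And>x. x \<notin> cball p (3/2 * \<rho>) \<Longrightarrow> \<zeta> x = 0" "\<And>x. x \<notin> cball p (3/2 * \<rho>) \<Longrightarrow> z1 x = 0"
          "\<And>x. x \<notin> cball p (3/2 * \<rho>) \<Longrightarrow> z2 x = 0"
  shows "\<exists>C'. \<forall>\<delta>. 0 < \<delta> \<longrightarrow> \<delta> \<le> \<rho> \<longrightarrow>
    integrable lborel (\<lambda>x. \<zeta> x * (1 / kap p \<delta> x) ^ M * ((g1 x)\<^sup>2 + (g2 x)\<^sup>2)) \<and>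
    (LINT x|lborel. \<zeta> x * (1 / kap p \<delta> x) ^ M * ((g1 x)\<^sup>2 + (g2 x)\<^sup>2)) \<le> C'"
proof -
  have int: "integrable lborel u" "integrable lborel g1" "integrable lborel g2"
      "integrable lborel d"
    and rel: "\<And>\<epsilon> H x. mollifier \<epsilon> H \<Longrightarrow> \<epsilon> \<le> \<rho> / 4 \<Longrightarrow> x \<in> cball p (3/2 * \<rho>) \<Longrightarrow>
        conv H 1 0 u x = conv H 0 0 g1 x \<and> conv H 0 1 u x = conv H 0 0 g2 x \<and>
        conv H 2 0 u x + conv H 0 2 u x = conv H 0 0 d x"
    using grad unfolding has_local_gradient_def by blast+
  have [measurable]: "g1 \<in> borel_measurable borel" "g2 \<in> borel_measurable borel"
      "d \<in> borel_measurable borel"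
    using int by auto
  obtain \<epsilon> H where \<epsilon>: "\<And>m. 0 < \<epsilon> m" "\<And>m. \<epsilon> m \<le> \<rho> / 4" "\<epsilon> \<longlonglongrightarrow> 0" and H: "\<And>m. mollifier (\<epsilon> m) (H m)"
    and lim: "AE x in lborel. (\<lambda>m. conv (H m) 0 0 g1 x) \<longlonglongrightarrow> g1 x"
        "AE x in lborel. (\<lambda>m. conv (H m) 0 0 g2 x) \<longlonglongrightarrow> g2 x"
    using mollifier_sequence[of "\<rho> / 4" g1 g2] int \<rho> by auto
  define S where "S = (LINT x|lborel. \<bar>d x\<bar>) + (LINT x|lborel. \<bar>g1 x\<bar>) + (LINT x|lborel. \<bar>g2 x\<bar>)"
  \<comment> \<open>\<open>K\<close> times the power M + 1 of 1 / kap has to bound \<phi> and its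
    partial derivatives. The factor 5 \<rho>^2 bounds kap on the support and so raises the power
    from M to M + 1, 17 / \<rho> bounds the derivatives of the cutoff, and the last summand comes
    from differentiating the weight.\<close>
  define K where "K = 5 * \<rho>\<^sup>2 + 17 / \<rho> * (5 * \<rho>\<^sup>2) + 2 * real M * (2 * \<rho>)"
  have K: "K \<ge> 0" using \<rho> by (simp add: K_def)
  have S: "S \<ge> 0" by (simp add: S_def)
  \<comment> \<open>Differentiating the weight costs one more power of 1 / kap, hence the order
    \<open>2 * M + 2\<close> for \<open>u\<close>. As kap dominates the squared distance, the bound
    does not depend on \<delta>.\<close>
  have C: "\<bar>u x\<bar> * (1 / kap p \<delta> x) ^ Suc M \<le> max C 0" if "x \<in> cball p (2 * \<rho>)" "\<delta> > 0" for x \<delta>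
  proof -
    have "dist x p ^ (2 * M + 2) = ((dist x p)\<^sup>2) ^ Suc M"
      using power_mult[of "dist x p" 2 "Suc M"] by simp
    also have "\<dots> \<le> kap p \<delta> x ^ Suc M" by (intro power_mono) (auto simp: kap_eq)
    finally have "C * dist x p ^ (2 * M + 2) \<le> max C 0 * kap p \<delta> x ^ Suc M"
      by (intro mult_mono) auto
    then have "\<bar>u x\<bar> \<le> max C 0 * kap p \<delta> x ^ Suc M" using van[OF that(1)] by linarith
    then show ?thesis using kap_pos[OF that(2), of p x]
        by (simp add: power_divide divide_le_eq del: power_Suc)
  qed
  \<comment> \<open>The convergence must be uniform, because the error is multiplied by the weight.
    For fixed \<delta> the weight is bounded by a power of 1 / \<delta>^2, so the product still
    tends to 0.\<close>
  have "\<exists>\<eta>. (\<forall>m. \<forall>x\<in>cball p (3/2 * \<rho>). \<bar>conv (H m) 0 0 u x - u x\<bar> \<le> \<eta> m) \<and> \<eta> \<longlonglongrightarrow> 0"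
  proof -
    define \<eta> where "\<eta> m = (SUP x\<in>cball p (3/2 * \<rho>). \<bar>conv (H m) 0 0 u x - u x\<bar>)" for m
    have bdd: "bdd_above ((\<lambda>x. \<bar>conv (H m) 0 0 u x - u x\<bar>) ` cball p (3/2 * \<rho>))" for m
    proof (intro bounded_imp_bdd_above compact_imp_bounded compact_continuous_image compact_cball
        continuous_intros)
      show "continuous_on (cball p (3/2 * \<rho>)) u"
        using continuous_on_subset[OF cont] \<rho> by (simp add: subset_iff)
      show "continuous_on (cball p (3/2 * \<rho>)) (conv (H m) 0 0 u)"
        using continuous_on_subset[OF conv_continuous[OF H int(1)]] by blast
    qed
    have le: "\<bar>conv (H m) 0 0 u x - u x\<bar> \<le> \<eta> m" if "x \<in> cball p (3/2 * \<rho>)" for m x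
      unfolding \<eta>_def by (intro cSUP_upper that bdd)
    have "\<eta> \<longlonglongrightarrow> 0"
    proof (rule tendstoI)
      fix e :: real assume e: "e > 0"
      have "uniformly_continuous_on (cball p (2 * \<rho>)) u"
        by (intro compact_uniformly_continuous cont compact_cball)
      then obtain r where r: "r > 0" "\<And>x y. x \<in> cball p (2 * \<rho>) \<Longrightarrow> y \<in> cball p (2 * \<rho>) \<Longrightarrow> dist y x < r
          \<Longrightarrow> dist (u y) (u x) < e / 2"
        using e unfolding uniformly_continuous_on_def by (metis half_gt_zero)
      have "eventually (\<lambda>m. \<epsilon> m < r / 2) sequentially"
        using \<epsilon>(3) r(1) by (intro order_tendstoD) auto
      then show "\<forall>\<^sub>F m in sequentially. dist (\<eta> m) 0 < e"
      proof eventually_elim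
        case (elim m)
        have "\<bar>conv (H m) 0 0 u x - u x\<bar> \<le> e / 2" if x: "x \<in> cball p (3/2 * \<rho>)" for x
        proof (rule conv_local[OF H int(1)])
          fix y assume y: "dist x y \<le> 2 * \<epsilon> m"
          have "dist p y \<le> dist p x + dist x y" by (rule dist_triangle)
          then have "y \<in> cball p (2 * \<rho>)" "x \<in> cball p (2 * \<rho>)" using x y \<epsilon>(2)[of m] \<rho> by auto
          moreover have "dist y x < r" using y elim by (simp add: dist_commute)
          ultimately show "\<bar>u y - u x\<bar> \<le> e / 2" using r(2)[of x y] by (simp add: dist_real_def)
        qed
        then have "\<eta> m \<le> e / 2" unfolding \<eta>_def using \<rho> by (intro cSUP_least) auto
        moreover have "p \<in> cball p (3/2 * \<rho>)" using \<rho> by simp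
        then have "0 \<le> \<eta> m" by (rule order_trans[OF abs_ge_zero le])
        ultimately show ?case using e by (simp add: dist_real_def)
      qed
    qed
    then show ?thesis using le by blast
  qed
  then obtain \<eta> where \<eta>: "\<And>m x. x \<in> cball p (3/2 * \<rho>) \<Longrightarrow> \<bar>conv (H m) 0 0 u x - u x\<bar> \<le> \<eta> m" "\<eta> \<longlonglongrightarrow> 0"
    by blast
  have "p \<in> cball p (3/2 * \<rho>)" using \<rho> by simp
  then have \<eta>0: "\<eta> m \<ge> 0" for m by (rule order_trans[OF abs_ge_zero \<eta>(1)])
  show ?thesis
  proof (intro exI[of _ "K * max C 0 * S"] allI impI)
    fix \<delta> :: real assume \<delta>: "0 < \<delta>" "\<delta> \<le> \<rho>"
    define \<kappa> where "\<kappa> x = 1 / kap p \<delta> x" for x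
    have kp: "kap p \<delta> x > 0" for x by (rule kap_pos[OF \<delta>(1)])
    have \<kappa>p: "\<kappa> x > 0" for x using kp by (simp add: \<kappa>_def)
    have \<kappa>le: "\<kappa> x \<le> 1 / \<delta>\<^sup>2" for x
      unfolding \<kappa>_def using \<delta> by (intro divide_left_mono)
          (auto simp: kap_eq intro!: mult_pos_pos add_nonneg_pos)
    have c\<kappa>: "continuous_on UNIV \<kappa>"
      unfolding \<kappa>_def[abs_def] using kp by (intro continuous_intros kap_continuous)
          (auto simp: less_le)
    define \<phi> where "\<phi> x = \<zeta> x * \<kappa> x ^ M" for x
    define f where "f i x = - 2 * real M * (x $ i - p $ i) * \<kappa> x ^ M * \<kappa> x" for i x
    define \<phi>1 where "\<phi>1 x = z1 x * \<kappa> x ^ M + \<zeta> x * f 1 x" for x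
    define \<phi>2 where "\<phi>2 x = z2 x * \<kappa> x ^ M + \<zeta> x * f 2 x" for x
    have d\<kappa>: "has_partial i (\<lambda>x. \<kappa> x ^ M) (f i)" for i
      unfolding \<kappa>_def f_def[abs_def] using wt_has_partial[OF \<delta>(1), of i 1 p M] by simp
    have d\<phi>: "has_partial 1 \<phi> \<phi>1" "has_partial 2 \<phi> \<phi>2"
      unfolding \<phi>_def[abs_def] \<phi>1_def[abs_def] \<phi>2_def[abs_def] by (intro has_partial_mult \<zeta> d\<kappa>)+
    have cf: "continuous_on UNIV (f i)" for i unfolding f_def[abs_def]
        by (intro continuous_intros c\<kappa>)
    have c\<phi>: "continuous_on UNIV \<phi>" "continuous_on UNIV \<phi>1" "continuous_on UNIV \<phi>2"
      unfolding \<phi>_def[abs_def] \<phi>1_def[abs_def] \<phi>2_def[abs_def] by (intro continuous_intros \<zeta> cf c\<kappa>)+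
    have s\<phi>: "\<phi> x = 0" "\<phi>1 x = 0" "\<phi>2 x = 0" if "x \<notin> cball p (3/2 * \<rho>)" for x
      using \<zeta>(9-11)[OF that] by (auto simp: \<phi>_def \<phi>1_def \<phi>2_def)
    have \<phi>b: "\<bar>\<phi> x\<bar> \<le> K * \<kappa> x ^ Suc M" "\<bar>\<phi>1 x\<bar> \<le> K * \<kappa> x ^ Suc M" "\<bar>\<phi>2 x\<bar> \<le> K * \<kappa> x ^ Suc M"
      if x: "x \<in> cball p (3/2 * \<rho>)" for x
    proof -
      have "kap p \<delta> x \<le> (3/2 * \<rho>)\<^sup>2 + \<rho>\<^sup>2"
        unfolding kap_eq using x \<delta> by (intro add_mono power_mono) (auto simp: dist_commute)
      also have "\<dots> \<le> 5 * \<rho>\<^sup>2" by (simp add: power2_eq_square) 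
      finally have "\<kappa> x * kap p \<delta> x \<le> \<kappa> x * (5 * \<rho>\<^sup>2)" using \<kappa>p[of x] by (intro mult_left_mono) auto
      then have "1 \<le> 5 * \<rho>\<^sup>2 * \<kappa> x" using kp[of x] by (simp add: \<kappa>_def mult_ac)
      then have "1 * \<kappa> x ^ M \<le> (5 * \<rho>\<^sup>2 * \<kappa> x) * \<kappa> x ^ M" using \<kappa>p[of x]
          by (intro mult_right_mono) auto
      then have \<kappa>M: "\<kappa> x ^ M \<le> 5 * \<rho>\<^sup>2 * \<kappa> x ^ Suc M" by (simp add: mult_ac)
      have \<kappa>S: "0 \<le> \<kappa> x ^ Suc M" using \<kappa>p[of x] by simp
      have z17: "\<bar>z1 x\<bar> \<le> 17 / \<rho>" "\<bar>z2 x\<bar> \<le> 17 / \<rho>"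
      proof -
        \<comment> \<open>17 is the least integer whose square, 289, is at least 288.\<close>
        have "288 / \<rho>\<^sup>2 \<le> (17 / \<rho>)\<^sup>2" unfolding power_divide by (intro divide_right_mono) auto
        then have "(z1 x)\<^sup>2 \<le> (17 / \<rho>)\<^sup>2" "(z2 x)\<^sup>2 \<le> (17 / \<rho>)\<^sup>2"
          using \<zeta>(8)[of x] by (smt (verit) zero_le_power2)+
        then show "\<bar>z1 x\<bar> \<le> 17 / \<rho>" "\<bar>z2 x\<bar> \<le> 17 / \<rho>" using \<rho>
            by (simp_all add: abs_le_square_iff[symmetric])
      qed
      have zM: "\<bar>z\<bar> * \<kappa> x ^ M \<le> 17 / \<rho> * (5 * \<rho>\<^sup>2 * \<kappa> x ^ Suc M)" if "\<bar>z\<bar> \<le> 17 / \<rho>" for z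
        using that \<kappa>M \<rho> \<kappa>p[of x] by (intro mult_mono) auto
      have fM: "\<bar>\<zeta> x * f i x\<bar> \<le> 2 * real M * (2 * \<rho>) * \<kappa> x ^ Suc M" for i
      proof -
        have "\<bar>(x - p) $ i\<bar> \<le> norm (x - p)" by (rule component_le_norm_cart)
        then have "\<bar>x $ i - p $ i\<bar> \<le> 2 * \<rho>" using x \<rho> by (simp add: dist_norm norm_minus_commute)
        then have "2 * real M * \<bar>x $ i - p $ i\<bar> * \<kappa> x ^ Suc M \<le> 2 * real M * (2 * \<rho>) * \<kappa> x ^ Suc M"
          using \<kappa>S by (intro mult_right_mono mult_left_mono) auto
        moreover have "\<bar>f i x\<bar> = 2 * real M * \<bar>x $ i - p $ i\<bar> * \<kappa> x ^ Suc M"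
          using \<kappa>p[of x] by (simp add: f_def abs_mult)
        moreover have "\<bar>\<zeta> x * f i x\<bar> \<le> 1 * \<bar>f i x\<bar>" unfolding abs_mult using \<zeta>(6,7)[of x]
            by (intro mult_right_mono) auto
        ultimately show ?thesis by linarith
      qed
      have Keq: "K * \<kappa> x ^ Suc M = 5 * \<rho>\<^sup>2 * \<kappa> x ^ Suc M + 17 / \<rho> * (5 * \<rho>\<^sup>2 * \<kappa> x ^ Suc M)
          + 2 * real M * (2 * \<rho>) * \<kappa> x ^ Suc M"
        unfolding K_def distrib_right mult.assoc ..
      have nn: "0 \<le> 5 * \<rho>\<^sup>2 * \<kappa> x ^ Suc M" "0 \<le> 17 / \<rho> * (5 * \<rho>\<^sup>2 * \<kappa> x ^ Suc M)"
          "0 \<le> 2 * real M * (2 * \<rho>) * \<kappa> x ^ Suc M"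
        using \<kappa>S \<rho> by (auto intro!: mult_nonneg_nonneg simp del: power_Suc)
      have "\<bar>\<phi> x\<bar> \<le> 1 * \<kappa> x ^ M"
        unfolding \<phi>_def abs_mult using \<zeta>(6,7)[of x] \<kappa>p[of x] by (intro mult_mono) auto
      then show "\<bar>\<phi> x\<bar> \<le> K * \<kappa> x ^ Suc M" unfolding Keq using \<kappa>M nn by linarith
      have "\<bar>z1 x * \<kappa> x ^ M\<bar> \<le> 17 / \<rho> * (5 * \<rho>\<^sup>2 * \<kappa> x ^ Suc M)"
          "\<bar>z2 x * \<kappa> x ^ M\<bar> \<le> 17 / \<rho> * (5 * \<rho>\<^sup>2 * \<kappa> x ^ Suc M)"
        using zM[OF z17(1)] zM[OF z17(2)] \<kappa>p[of x] by (auto simp: abs_mult)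
      then show "\<bar>\<phi>1 x\<bar> \<le> K * \<kappa> x ^ Suc M" "\<bar>\<phi>2 x\<bar> \<le> K * \<kappa> x ^ Suc M"
        unfolding Keq \<phi>1_def \<phi>2_def using fM[of 1] fM[of 2] nn by linarith+
    qed
    define F where "F m x = \<phi> x * ((conv (H m) 1 0 u x)\<^sup>2 + (conv (H m) 0 1 u x)\<^sup>2)" for m x
    define cc where "cc m = K * (max C 0 + \<eta> m * (1 / \<delta>\<^sup>2) ^ Suc M) * S" for m
    \<comment> \<open>\<open>conv_has_partial\<close> raises an index by \<open>Suc\<close>, so the
      numerals are unfolded for the instantiation and folded back afterwards.\<close>
    have 2: "(2::nat) = Suc 1" "(1::nat) = Suc 0" by auto
    note cacc = caccioppoli_identity[of "conv (H m) 0 0 u" "conv (H m) 1 0 u" "conv (H m) 0 1 u"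
        "conv (H m) 2 0 u" "conv (H m) 0 2 u" \<phi> \<phi>1 \<phi>2 p "3/2 * \<rho>" for m,
      OF _ _ _ _ d\<phi> conv_continuous[OF H int(1)] conv_continuous[OF H int(1)]
          conv_continuous[OF H int(1)] conv_continuous[OF H int(1)] conv_continuous[OF H int(1)] c\<phi>
          s\<phi>,
      unfolded 2, OF conv_has_partial[OF H int(1)] conv_has_partial(1)[OF H int(1)]
          conv_has_partial(2)[OF H int(1)], folded 2]
    have Fint: "integrable lborel (F m)" for m unfolding F_def[abs_def] by (rule cacc(1))
    have \<phi>0: "0 \<le> \<phi> x" for x using \<zeta>(6)[of x] \<kappa>p[of x] by (simp add: \<phi>_def)
    have F0: "0 \<le> F m x" for m x using \<phi>0 by (simp add: F_def)
    have Flim: "AE x in lborel. (\<lambda>m. F m x) \<longlonglongrightarrow> \<zeta> x * (1 / kap p \<delta> x) ^ M * ((g1 x)\<^sup>2 + (g2 x)\<^sup>2)"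
      using lim
    proof eventually_elim
      fix x assume l: "(\<lambda>m. conv (H m) 0 0 g1 x) \<longlonglongrightarrow> g1 x" "(\<lambda>m. conv (H m) 0 0 g2 x) \<longlonglongrightarrow> g2 x"
      show "(\<lambda>m. F m x) \<longlonglongrightarrow> \<zeta> x * (1 / kap p \<delta> x) ^ M * ((g1 x)\<^sup>2 + (g2 x)\<^sup>2)"
      proof (cases "x \<in> cball p (3/2 * \<rho>)")
        case True
        have "F m x = \<phi> x * ((conv (H m) 0 0 g1 x)\<^sup>2 + (conv (H m) 0 0 g2 x)\<^sup>2)" for m
          using rel[OF H \<epsilon>(2) True] by (simp add: F_def)
        then show ?thesis unfolding \<phi>_def \<kappa>_def by (auto intro!: tendsto_intros l)
      qed (use s\<phi> \<zeta>(9) in \<open>simp add: F_def del: mem_cball\<close>)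
    qed
    have Fle: "(LINT x|lborel. F m x) \<le> cc m" for m
    proof -
      define V where "V = conv (H m) 0 0 u"
      let ?g = "\<lambda>x. \<bar>conv (H m) 0 0 d x\<bar> + \<bar>conv (H m) 0 0 g1 x\<bar> + \<bar>conv (H m) 0 0 g2 x\<bar>"
      have ig: "integrable lborel ?g" using conv_L1(1)[OF H] int by auto
      have pt: "- (V x * (\<phi> x * (conv (H m) 2 0 u x + conv (H m) 0 2 u x)
          + \<phi>1 x * conv (H m) 1 0 u x + \<phi>2 x * conv (H m) 0 1 u x))
         \<le> K * (max C 0 + \<eta> m * (1 / \<delta>\<^sup>2) ^ Suc M) * ?g x" for x
      proof (cases "x \<in> cball p (3/2 * \<rho>)")
        case True
        let ?k = "\<kappa> x ^ Suc M"
        have k0: "?k \<ge> 0" using \<kappa>p[of x] by simp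
        have "x \<in> cball p (2 * \<rho>)" using True \<rho> by auto
        from C[OF this \<delta>(1)] have uC: "\<bar>u x\<bar> * ?k \<le> max C 0" by (simp add: \<kappa>_def)
        have "?k \<le> (1 / \<delta>\<^sup>2) ^ Suc M" using \<kappa>le[of x] \<kappa>p[of x] by (intro power_mono) auto
        then have "\<eta> m * ?k \<le> \<eta> m * (1 / \<delta>\<^sup>2) ^ Suc M" by (intro mult_left_mono \<eta>0)
        moreover have "\<bar>V x\<bar> * ?k \<le> (\<bar>u x\<bar> + \<eta> m) * ?k"
          using \<eta>(1)[OF True, of m] k0 unfolding V_def by (intro mult_right_mono) auto
        ultimately have Vk: "\<bar>V x\<bar> * ?k \<le> max C 0 + \<eta> m * (1 / \<delta>\<^sup>2) ^ Suc M"
          using uC by (simp only: distrib_right)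
        have g0: "?g x \<ge> 0" by simp
        have "\<bar>\<phi> x * conv (H m) 0 0 d x + \<phi>1 x * conv (H m) 0 0 g1 x + \<phi>2 x * conv (H m) 0 0 g2 x\<bar>
          \<le> \<bar>\<phi> x * conv (H m) 0 0 d x\<bar> + \<bar>\<phi>1 x * conv (H m) 0 0 g1 x\<bar>
              + \<bar>\<phi>2 x * conv (H m) 0 0 g2 x\<bar>" by linarith
        also have "\<dots> \<le> K * ?k * \<bar>conv (H m) 0 0 d x\<bar> + K * ?k * \<bar>conv (H m) 0 0 g1 x\<bar>
            + K * ?k * \<bar>conv (H m) 0 0 g2 x\<bar>"
          unfolding abs_mult by (intro add_mono mult_right_mono \<phi>b[OF True] abs_ge_zero)
        also have "\<dots> = K * ?k * ?g x" by (simp only: distrib_left)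
        finally have "\<bar>V x\<bar> * \<bar>\<phi> x * conv (H m) 0 0 d x + \<phi>1 x * conv (H m) 0 0 g1 x
            + \<phi>2 x * conv (H m) 0 0 g2 x\<bar> \<le> \<bar>V x\<bar> * (K * ?k * ?g x)"
          by (rule mult_left_mono) simp
        also have "\<dots> = K * (\<bar>V x\<bar> * ?k) * ?g x" by (simp only: mult_ac)
        also have "\<dots> \<le> K * (max C 0 + \<eta> m * (1 / \<delta>\<^sup>2) ^ Suc M) * ?g x"
          using Vk K g0 by (intro mult_right_mono mult_left_mono)
        finally show ?thesis using rel[OF H \<epsilon>(2) True] by (simp add: abs_mult[symmetric])
      next
        case False
        have "0 \<le> K * (max C 0 + \<eta> m * (1 / \<delta>\<^sup>2) ^ Suc M) * ?g x"
          using K \<eta>0[of m] by (intro mult_nonneg_nonneg add_nonneg_nonneg) auto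
        then show ?thesis using s\<phi>[OF False] by simp
      qed
      have "(LINT x|lborel. F m x) = (LINT x|lborel.
          - (V x * (\<phi> x * (conv (H m) 2 0 u x + conv (H m) 0 2 u x) + \<phi>1 x * conv (H m) 1 0 u x
          + \<phi>2 x * conv (H m) 0 1 u x)))"
        unfolding F_def V_def using cacc(3)[of m] by simp
      also have "\<dots> \<le> (LINT x|lborel. K * (max C 0 + \<eta> m * (1 / \<delta>\<^sup>2) ^ Suc M) * ?g x)"
        using cacc(2)[of m] ig pt by (intro integral_mono) (auto simp: V_def)
      also have "\<dots> = K * (max C 0 + \<eta> m * (1 / \<delta>\<^sup>2) ^ Suc M) * (LINT x|lborel. ?g x)" by simp
      also have "(LINT x|lborel. ?g x) = (LINT x|lborel. \<bar>conv (H m) 0 0 d x\<bar>)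
          + (LINT x|lborel. \<bar>conv (H m) 0 0 g1 x\<bar>) + (LINT x|lborel. \<bar>conv (H m) 0 0 g2 x\<bar>)"
        using conv_L1(1)[OF H] int by simp
      also have "K * (max C 0 + \<eta> m * (1 / \<delta>\<^sup>2) ^ Suc M) * \<dots>
          \<le> K * (max C 0 + \<eta> m * (1 / \<delta>\<^sup>2) ^ Suc M) * S"
        unfolding S_def using K \<eta>0[of m] by (intro mult_left_mono add_mono conv_L1_bound[OF H] int
            mult_nonneg_nonneg add_nonneg_nonneg) auto
      finally show ?thesis by (simp add: cc_def)
    qed
    have clim: "cc \<longlonglongrightarrow> K * max C 0 * S"
    proof -
      have "cc \<longlonglongrightarrow> K * (max C 0 + 0 * (1 / \<delta>\<^sup>2) ^ Suc M) * S"
        unfolding cc_def[abs_def] by (intro tendsto_intros \<eta>)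
      then show ?thesis by simp
    qed
    have meas: "(\<lambda>x. \<zeta> x * (1 / kap p \<delta> x) ^ M * ((g1 x)\<^sup>2 + (g2 x)\<^sup>2)) \<in> borel_measurable lborel"
    proof -
      have [measurable]: "\<zeta> \<in> borel_measurable borel" "kap p \<delta> \<in> borel_measurable borel"
        by (intro borel_measurable_continuous_onI \<zeta> kap_continuous)+
      show ?thesis by simp
    qed
    show "integrable lborel (\<lambda>x. \<zeta> x * (1 / kap p \<delta> x) ^ M * ((g1 x)\<^sup>2 + (g2 x)\<^sup>2)) \<and>
      (LINT x|lborel. \<zeta> x * (1 / kap p \<delta> x) ^ M * ((g1 x)\<^sup>2 + (g2 x)\<^sup>2)) \<le> K * max C 0 * S"
      using fatou_bound[OF Fint F0 Flim meas Fle clim] by blast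
  qed
qed

text \<open>With the weight \<open>(\<rho>\<^sup>2 / \<kappa>) ^ n\<close>, the energy estimate bounds
  \<open>\<integral> (\<zeta> log_mean (s q))\<^sup>2\<close> independently of \<open>n\<close>: the weight is at most \<open>1\<close> where
  \<open>\<nabla>\<zeta> \<noteq> 0\<close>, the term with \<open>d\<^sup>2\<close> is bounded by \<open>\<integral> A\<close>, and the error caused by
  \<open>\<delta> > 0\<close> is made small after \<open>n\<close> is fixed. But the weight is at least \<open>2 ^ n\<close> on
  \<open>cball p (\<rho> / 2)\<close>.\<close>

lemma gradient_zero_near:
  fixes p :: "real^2"
  assumes \<rho>: "\<rho> > 0" and grad: "has_local_gradient p \<rho> u g1 g2 d"
    and sq: "integrable lborel (\<lambda>x. (g1 x)\<^sup>2)" "integrable lborel (\<lambda>x. (g2 x)\<^sup>2)"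
        "integrable lborel (\<lambda>x. (d x)\<^sup>2)"
    and A: "integrable lborel A" "\<And>x. 0 \<le> A x" "AE x in lborel. (d x)\<^sup>2 \<le> A x * ((g1 x)\<^sup>2 + (g2 x)\<^sup>2)"
    and cont: "continuous_on (cball p (2 * \<rho>)) u"
    and van: "\<And>N. \<exists>C. \<forall>x\<in>cball p (2 * \<rho>). \<bar>u x\<bar> \<le> C * dist x p ^ N"
  shows "AE x in lborel. x \<in> cball p (\<rho> / 2) \<longrightarrow> g1 x = 0 \<and> g2 x = 0"
proof -
  have int: "integrable lborel u" "integrable lborel g1" "integrable lborel g2"
      "integrable lborel d"
    and rel: "\<And>\<epsilon> H x. mollifier \<epsilon> H \<Longrightarrow> \<epsilon> \<le> \<rho> / 4 \<Longrightarrow> x \<in> cball p (3/2 * \<rho>) \<Longrightarrow>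
        conv H 1 0 u x = conv H 0 0 g1 x \<and> conv H 0 1 u x = conv H 0 0 g2 x \<and>
        conv H 2 0 u x + conv H 0 2 u x = conv H 0 0 d x"
    using grad unfolding has_local_gradient_def by blast+
  have [measurable]: "g1 \<in> borel_measurable borel" "g2 \<in> borel_measurable borel"
      "d \<in> borel_measurable borel"
    "A \<in> borel_measurable borel"
    using int A by auto
  obtain \<epsilon> H where \<epsilon>: "\<And>m. 0 < \<epsilon> m" "\<And>m. \<epsilon> m \<le> \<rho> / 4" "\<epsilon> \<longlonglongrightarrow> 0" and H: "\<And>m. mollifier (\<epsilon> m) (H m)"
    and lim: "AE x in lborel. (\<lambda>m. conv (H m) 0 0 g1 x) \<longlonglongrightarrow> g1 x"
        "AE x in lborel. (\<lambda>m. conv (H m) 0 0 g2 x) \<longlonglongrightarrow> g2 x"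
    using mollifier_sequence[of "\<rho> / 4" g1 g2] int \<rho> by auto
  obtain \<zeta> z1 z2 where \<zeta>: "has_partial 1 \<zeta> z1" "has_partial 2 \<zeta> z2" "continuous_on UNIV \<zeta>"
      "continuous_on UNIV z1" "continuous_on UNIV z2"
      "\<And>x. 0 \<le> \<zeta> x" "\<And>x. \<zeta> x \<le> 1" "\<And>x. (z1 x)\<^sup>2 + (z2 x)\<^sup>2 \<le> 288 / \<rho>\<^sup>2"
      "\<And>x. x \<notin> cball p (3/2 * \<rho>) \<Longrightarrow> \<zeta> x = 0" "\<And>x. x \<notin> cball p (3/2 * \<rho>) \<Longrightarrow> z1 x = 0"
          "\<And>x. x \<notin> cball p (3/2 * \<rho>) \<Longrightarrow> z2 x = 0"
      and \<zeta>1: "\<And>x. dist x p \<le> \<rho> \<Longrightarrow> \<zeta> x = 1 \<and> z1 x = 0 \<and> z2 x = 0"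
    using cutoff_exists[OF \<rho>, of p] by metis
  have [measurable]: "\<zeta> \<in> borel_measurable borel" "kap p \<delta> \<in> borel_measurable borel" for \<delta>
    by (intro borel_measurable_continuous_onI \<zeta> kap_continuous)+
  define q where "q x = (g1 x)\<^sup>2 + (g2 x)\<^sup>2" for x
  have qint: "integrable lborel q" unfolding q_def[abs_def] using sq by simp
  have q0: "q x \<ge> 0" for x by (simp add: q_def)
  define s where "s \<delta> n x = (\<rho>\<^sup>2 / kap p \<delta> x) ^ n" for \<delta> n x
  \<comment> \<open>Independent of n and \<delta>. The factor 9 \<rho>^2 is 4 R^2 for the support
    radius R = 3/2 \<rho>, and the last 1 is the allowance for the error caused by \<delta>.\<close>
  define K where "K = 9 * \<rho>\<^sup>2 * (82 * (288 / \<rho>\<^sup>2 * (4 * (LINT x|lborel. q x)))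
      + 192 * (LINT x|lborel. A x) + 1)"
  have [measurable]: "s \<delta> n \<in> borel_measurable borel" "q \<in> borel_measurable borel" for \<delta> n
    unfolding s_def[abs_def] q_def[abs_def] by measurable
  let ?T = "\<lambda>\<delta> n x. (\<zeta> x * log_mean (s \<delta> n x * q x))\<^sup>2"
  let ?w0 = "\<lambda>\<delta> n x. (\<zeta> x)\<^sup>2 * s \<delta> n x / (1 + s \<delta> n x * q x)"
  let ?w1 = "\<lambda>\<delta> n x. (\<zeta> x)\<^sup>2 * s \<delta> n x * (\<delta>\<^sup>2 / (kap p \<delta> x)\<^sup>2)"
  \<comment> \<open>The limit of the mollifications for fixed n and \<delta>, where all weights are
    bounded. The Laplacian is kept as \<open>d\<close>; the equation is inserted only
    afterwards.\<close>
  have limit_bound: "integrable lborel (\<lambda>x. ?T \<delta> n x) \<and>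
      (LINT x|lborel. ?T \<delta> n x) \<le> 9 * \<rho>\<^sup>2 * (82 * (288 / \<rho>\<^sup>2 * (4 * (LINT x|lborel. q x)))
       + 192 * (LINT x|lborel. ?w0 \<delta> n x * (d x)\<^sup>2)
       + 64 * real n * (LINT x|lborel. ?w1 \<delta> n x * q x))"
    and w0int: "integrable lborel (\<lambda>x. ?w0 \<delta> n x * (d x)\<^sup>2)"
    and w1int: "integrable lborel (\<lambda>x. ?w1 \<delta> n x * q x)"
    if \<delta>: "0 < \<delta>" for \<delta> n
  proof -
    define G1 where "G1 m = conv (H m) 1 0 u" for m
    define G2 where "G2 m = conv (H m) 0 1 u" for m
    define \<sigma> where "\<sigma> m x = s \<delta> n x * ((G1 m x)\<^sup>2 + (G2 m x)\<^sup>2)" for m x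
    define Q where "Q m = conv (H m) 0 0 q" for m
    define dd where "dd m = conv (H m) 0 0 (\<lambda>x. (d x)\<^sup>2)" for m
    define w where "w m x = (\<zeta> x)\<^sup>2 * s \<delta> n x / (1 + \<sigma> m x)" for m x
    define w0 where "w0 x = (\<zeta> x)\<^sup>2 * s \<delta> n x / (1 + s \<delta> n x * q x)" for x
    define w1 where "w1 x = (\<zeta> x)\<^sup>2 * s \<delta> n x * (\<delta>\<^sup>2 / (kap p \<delta> x)\<^sup>2)" for x
    have kp: "kap p \<delta> x > 0" for x by (rule kap_pos[OF \<delta>])
    have kd: "\<delta>\<^sup>2 \<le> kap p \<delta> x" for x by (simp add: kap_eq)
    have s0: "s \<delta> n x > 0" for x using kp \<rho> by (simp add: s_def)
    define W where "W = (\<rho>\<^sup>2 / \<delta>\<^sup>2) ^ n"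
    have sW: "s \<delta> n x \<le> W" for x
      unfolding s_def W_def using kd[of x] kp[of x] \<delta> by (intro power_mono divide_left_mono) auto
    have \<sigma>0: "\<sigma> m x \<ge> 0" for m x using s0[of x] by (simp add: \<sigma>_def)
    have \<zeta>2: "0 \<le> (\<zeta> x)\<^sup>2" "(\<zeta> x)\<^sup>2 \<le> 1" for x using \<zeta>(6,7)[of x] by (auto simp: power_le_one)
    have G: "G1 m x = conv (H m) 0 0 g1 x" "G2 m x = conv (H m) 0 0 g2 x" if "x \<in> cball p (3/2 * \<rho>)"
        for m x
      using rel[OF H \<epsilon>(2) that] by (auto simp: G1_def G2_def)
    have Q0: "Q m x \<ge> 0" "dd m x \<ge> 0" for m x
      unfolding Q_def dd_def by (intro conv_nonneg[OF H] q0 zero_le_power2)+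
    have GQ: "(G1 m x)\<^sup>2 + (G2 m x)\<^sup>2 \<le> Q m x" if "x \<in> cball p (3/2 * \<rho>)" for m x
      unfolding G[OF that] Q_def q_def[abs_def] conv_add[OF H sq(1,2)]
      by (intro add_mono conv_square_le[OF H] int sq)
    have DD: "(conv (H m) 2 0 u x + conv (H m) 0 2 u x)\<^sup>2 \<le> dd m x" if "x \<in> cball p (3/2 * \<rho>)"
        for m x
      using conv_square_le[OF H int(4) sq(3)] rel[OF H \<epsilon>(2) that] by (simp add: dd_def)
    have wle: "0 \<le> w m x" "w m x \<le> W" for m x
    proof -
      show "0 \<le> w m x" using s0[of x] \<sigma>0[of m x] by (simp add: w_def less_imp_le)
      have "w m x \<le> (\<zeta> x)\<^sup>2 * s \<delta> n x / 1"
        unfolding w_def using s0[of x] \<sigma>0[of m x] by (intro divide_left_mono) auto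
      also have "(\<zeta> x)\<^sup>2 * s \<delta> n x / 1 \<le> 1 * W"
        unfolding div_by_1 using sW[of x] s0[of x] \<zeta>2[of x] by (intro mult_mono) auto
      finally show "w m x \<le> W" by simp
    qed
    have w1le: "0 \<le> w1 x" "w1 x \<le> W * (1 / \<delta>\<^sup>2)" for x
    proof -
      show "0 \<le> w1 x" using s0[of x] by (simp add: w1_def less_imp_le)
      have "\<delta>\<^sup>2 * \<delta>\<^sup>2 \<le> (kap p \<delta> x)\<^sup>2" 
        unfolding power2_eq_square[of "kap p \<delta> x"] using kd[of x] kp[of x] by (intro mult_mono) auto
      then have "\<delta>\<^sup>2 / (kap p \<delta> x)\<^sup>2 \<le> 1 / \<delta>\<^sup>2" using \<delta> kp[of x] by (simp add: field_simps)
      moreover have "(\<zeta> x)\<^sup>2 * s \<delta> n x \<le> 1 * W" using sW[of x] s0[of x] \<zeta>2[of x]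
          by (intro mult_mono) auto
      ultimately show "w1 x \<le> W * (1 / \<delta>\<^sup>2)" unfolding w1_def using s0[of x] sW[of x]
          by (intro mult_mono) auto
    qed
    have cG: "continuous_on UNIV (G1 m)" "continuous_on UNIV (G2 m)" for m
      unfolding G1_def G2_def by (rule conv_continuous[OF H int(1)])+
    have [measurable]: "G1 m \<in> borel_measurable borel" "G2 m \<in> borel_measurable borel" for m
      by (intro borel_measurable_continuous_onI cG)+
    have [measurable]: "\<sigma> m \<in> borel_measurable borel" for m unfolding \<sigma>_def[abs_def] by measurable
    have wm[measurable]: "w m \<in> borel_measurable lborel" "w0 \<in> borel_measurable lborel"
        "w1 \<in> borel_measurable lborel" for m
      unfolding w_def[abs_def] w0_def[abs_def] w1_def[abs_def] by measurable
    have Qint: "integrable lborel (Q m)" "(LINT x|lborel. Q m x) = (LINT x|lborel. q x)" for m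
      unfolding Q_def by (rule conv_L1[OF H qint])+
    have ddint: "integrable lborel (dd m)" for m unfolding dd_def by (rule conv_L1[OF H sq(3)])
    have QL1: "(\<lambda>m. LINT x|lborel. \<bar>Q m x - q x\<bar>) \<longlonglongrightarrow> 0"
      unfolding Q_def by (rule conv_tendsto_L1[OF qint H \<epsilon>(1,3)])
    have ddL1: "(\<lambda>m. LINT x|lborel. \<bar>dd m x - (d x)\<^sup>2\<bar>) \<longlonglongrightarrow> 0"
      unfolding dd_def by (rule conv_tendsto_L1[OF sq(3) H \<epsilon>(1,3)])
    have \<sigma>lim: "AE x in lborel. x \<in> cball p (3/2 * \<rho>) \<longrightarrow> (\<lambda>m. \<sigma> m x) \<longlonglongrightarrow> s \<delta> n x * q x"
      using lim
    proof eventually_elim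
      fix x assume l: "(\<lambda>m. conv (H m) 0 0 g1 x) \<longlonglongrightarrow> g1 x" "(\<lambda>m. conv (H m) 0 0 g2 x) \<longlonglongrightarrow> g2 x"
      show "x \<in> cball p (3/2 * \<rho>) \<longrightarrow> (\<lambda>m. \<sigma> m x) \<longlonglongrightarrow> s \<delta> n x * q x"
        unfolding \<sigma>_def q_def using G by (auto intro!: tendsto_intros l simp del: mem_cball)
    qed
    have sq0: "1 + s \<delta> n x * q x > 0" for x using s0[of x] q0[of x] by (simp add: add_pos_nonneg)
    have wlim: "AE x in lborel. (\<lambda>m. w m x) \<longlonglongrightarrow> w0 x"
      using \<sigma>lim
    proof eventually_elim
      fix x assume l: "x \<in> cball p (3/2 * \<rho>) \<longrightarrow> (\<lambda>m. \<sigma> m x) \<longlonglongrightarrow> s \<delta> n x * q x"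
      show "(\<lambda>m. w m x) \<longlonglongrightarrow> w0 x"
      proof (cases "x \<in> cball p (3/2 * \<rho>)")
        case True
        then show ?thesis unfolding w_def w0_def using l sq0[of x] by (intro tendsto_intros) auto
      qed (use \<zeta>(9) in \<open>simp add: w_def w0_def del: mem_cball\<close>)
    qed
    have W0: "\<bar>w m x\<bar> \<le> W" "\<bar>w1 x\<bar> \<le> W * (1 / \<delta>\<^sup>2)" for m x
      using wle[of m x] w1le[of x] by (auto simp: abs_le_iff)
    note L1 = weighted_L1_tendsto[OF ddint sq(3) ddL1 wm(1) wm(2) W0(1) wlim]
    note L2 = weighted_L1_tendsto[OF Qint(1) qint QL1 wm(3) wm(3) W0(2) AE_I2[OF tendsto_const]]
    show "integrable lborel (\<lambda>x. ?w0 \<delta> n x * (d x)\<^sup>2)"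
      using L1(2) by (simp add: w0_def)
    show "integrable lborel (\<lambda>x. ?w1 \<delta> n x * q x)"
      using L2(2) by (simp add: w1_def)
    have R: "3/2 * \<rho> > 0" using \<rho> by simp
    have nums: "(2::nat) = Suc 1" "(1::nat) = Suc 0" by auto
    note en = energy_estimate[OF \<delta> \<rho> R, of "G1 m" "conv (H m) 2 0 u" "conv (H m) 1 1 u" "G2 m"
        "conv (H m) 0 2 u" "conv (H m) 2 1 u" "conv (H m) 1 2 u" \<zeta> z1 z2 p n for m,
      OF _ _ _ _ _ _ _ _ \<zeta>(1,2) cG conv_continuous[OF H int(1)] conv_continuous[OF H int(1)]
          conv_continuous[OF H int(1)] conv_continuous[OF H int(1)] conv_continuous[OF H int(1)]
          \<zeta>(3-5) \<zeta>(9-11),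
      folded s_def, folded \<sigma>_def, folded log_mean_def, unfolded G1_def G2_def nums,
      OF conv_has_partial[OF H int(1)] conv_has_partial[OF H int(1)] conv_has_partial[OF H int(1)]
          conv_has_partial(1)[OF H int(1)] conv_has_partial(2)[OF H int(1)], folded nums]
    define B where "B m x = 82 * (288 / \<rho>\<^sup>2 * (4 * Q m x)) + 192 * (w m x * dd m x)
        + 64 * real n * (w1 x * Q m x)" for m x
    have Bint: "integrable lborel (B m)" for m
      unfolding B_def[abs_def] using Qint(1) L1(1) L2(1) by simp
    have pt: "82 * (((z1 x)\<^sup>2 + (z2 x)\<^sup>2) * (ln (1 + \<sigma> m x))\<^sup>2)
     + 192 * ((\<zeta> x)\<^sup>2 * (s \<delta> n x * (conv (H m) 2 0 u x + conv (H m) 0 2 u x)\<^sup>2 / (1 + \<sigma> m x)))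
     + 64 * real n * ((\<zeta> x)\<^sup>2 * log_mean (\<sigma> m x) * (\<delta>\<^sup>2 / (kap p \<delta> x)\<^sup>2)) \<le> B m x" for m x
    proof (cases "x \<in> cball p (3/2 * \<rho>)")
      case True
      have 1: "((z1 x)\<^sup>2 + (z2 x)\<^sup>2) * (ln (1 + \<sigma> m x))\<^sup>2 \<le> 288 / \<rho>\<^sup>2 * (4 * Q m x)"
      proof (cases "dist x p \<le> \<rho>")
        case False
        have "\<rho>\<^sup>2 \<le> (dist x p)\<^sup>2" using False \<rho> by (intro power_mono) auto
        then have "\<rho>\<^sup>2 \<le> kap p \<delta> x" unfolding kap_eq by (smt (verit) zero_le_power2)
        then have "s \<delta> n x \<le> 1" unfolding s_def using kp[of x] by (intro power_le_one) auto
        then have "\<sigma> m x \<le> 1 * Q m x" unfolding \<sigma>_def using GQ[OF True] s0[of x]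
            by (intro mult_mono) auto
        then have "(ln (1 + \<sigma> m x))\<^sup>2 \<le> 4 * Q m x" using ln_one_plus_square_le[OF \<sigma>0[of m x]]
            by linarith
        then show ?thesis using \<zeta>(8)[of x] by (intro mult_mono) auto
      qed (use \<zeta>1 Q0 in auto)
      have "(\<zeta> x)\<^sup>2 * (s \<delta> n x * (conv (H m) 2 0 u x + conv (H m) 0 2 u x)\<^sup>2 / (1 + \<sigma> m x))
        = w m x * (conv (H m) 2 0 u x + conv (H m) 0 2 u x)\<^sup>2" by (simp add: w_def)
      also have "\<dots> \<le> w m x * dd m x" using DD[OF True] wle by (intro mult_left_mono)
      finally have 2: "(\<zeta> x)\<^sup>2 * (s \<delta> n x * (conv (H m) 2 0 u x + conv (H m) 0 2 u x)\<^sup>2 / (1 + \<sigma> m x))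
          \<le> w m x * dd m x" .
      have "ln (1 + \<sigma> m x) \<le> 1 + \<sigma> m x" using ln_add_one_self_le_self[OF \<sigma>0[of m x]] by simp
      then have "\<sigma> m x * ln (1 + \<sigma> m x) \<le> \<sigma> m x * (1 + \<sigma> m x)" using \<sigma>0[of m x]
          by (intro mult_left_mono) auto
      then have "log_mean (\<sigma> m x) \<le> \<sigma> m x" unfolding log_mean_def using \<sigma>0[of m x]
          by (simp add: divide_le_eq)
      also have "\<dots> \<le> s \<delta> n x * Q m x" unfolding \<sigma>_def using GQ[OF True] s0[of x]
          by (intro mult_left_mono) auto
      finally have "(\<zeta> x)\<^sup>2 * log_mean (\<sigma> m x) * (\<delta>\<^sup>2 / (kap p \<delta> x)\<^sup>2)
          \<le> (\<zeta> x)\<^sup>2 * (s \<delta> n x * Q m x) * (\<delta>\<^sup>2 / (kap p \<delta> x)\<^sup>2)"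
        by (intro mult_right_mono mult_left_mono) auto
      also have "\<dots> = w1 x * Q m x" by (simp add: w1_def)
      finally have 3: "(\<zeta> x)\<^sup>2 * log_mean (\<sigma> m x) * (\<delta>\<^sup>2 / (kap p \<delta> x)\<^sup>2) \<le> w1 x * Q m x" .
      show ?thesis unfolding B_def by (intro add_mono mult_left_mono 1 2 3) auto
    next
      case False
      have "0 \<le> B m x" unfolding B_def using Q0 wle w1le
          by (intro add_nonneg_nonneg mult_nonneg_nonneg) auto
      then show ?thesis using \<zeta>(9-11)[OF False] by simp
    qed
    define F where "F m x = (\<zeta> x * log_mean (\<sigma> m x))\<^sup>2" for m x
    have Fint: "integrable lborel (F m)" for m
      unfolding F_def by (rule en(2))
    define c where "c m = 9 * \<rho>\<^sup>2 * (82 * (288 / \<rho>\<^sup>2 * (4 * (LINT x|lborel. q x)))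
       + 192 * (LINT x|lborel. w m x * dd m x) + 64 * real n * (LINT x|lborel. w1 x * Q m x))" for m
    have Fle: "(LINT x|lborel. F m x) \<le> c m" for m
    proof -
      have "(LINT x|lborel. F m x) \<le> 4 * (3/2 * \<rho>)\<^sup>2 * (LINT x|lborel. B m x)"
        unfolding F_def
        by (rule order_trans[OF en(3) mult_left_mono[OF integral_mono[OF en(1) Bint pt]]])
          simp_all
      also have "(LINT x|lborel. B m x) = 82 * (288 / \<rho>\<^sup>2 * (4 * (LINT x|lborel. q x)))
       + 192 * (LINT x|lborel. w m x * dd m x) + 64 * real n * (LINT x|lborel. w1 x * Q m x)"
        unfolding B_def using Qint L1(1) L2(1) by simp
      finally show ?thesis by (simp add: c_def power_mult_distrib power_divide)
    qed
    have Flim: "AE x in lborel. (\<lambda>m. F m x) \<longlonglongrightarrow> ?T \<delta> n x"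
      using \<sigma>lim
    proof eventually_elim
      fix x assume l: "x \<in> cball p (3/2 * \<rho>) \<longrightarrow> (\<lambda>m. \<sigma> m x) \<longlonglongrightarrow> s \<delta> n x * q x"
      show "(\<lambda>m. F m x) \<longlonglongrightarrow> ?T \<delta> n x"
      proof (cases "x \<in> cball p (3/2 * \<rho>)")
        case True
        then show ?thesis unfolding F_def log_mean_def using l sq0[of x]
            by (intro tendsto_intros) auto
      qed (use \<zeta>(9) in \<open>simp add: F_def del: mem_cball\<close>)
    qed
    have clim: "c \<longlonglongrightarrow> 9 * \<rho>\<^sup>2 * (82 * (288 / \<rho>\<^sup>2 * (4 * (LINT x|lborel. q x)))
       + 192 * (LINT x|lborel. w0 x * (d x)\<^sup>2) + 64 * real n * (LINT x|lborel. w1 x * q x))"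
      unfolding c_def[abs_def] by (intro tendsto_intros L1(3) L2(3))
    have "(\<lambda>x. ?T \<delta> n x) \<in> borel_measurable lborel"
      unfolding log_mean_def by measurable
    from fatou_bound[OF Fint _ Flim this Fle clim]
    show "integrable lborel (\<lambda>x. ?T \<delta> n x) \<and>
      (LINT x|lborel. ?T \<delta> n x) \<le> 9 * \<rho>\<^sup>2 * (82 * (288 / \<rho>\<^sup>2 * (4 * (LINT x|lborel. q x)))
       + 192 * (LINT x|lborel. ?w0 \<delta> n x * (d x)\<^sup>2)
       + 64 * real n * (LINT x|lborel. ?w1 \<delta> n x * q x))"
      by (simp add: F_def w0_def w1_def)
  qed
  have uniform: "\<exists>\<delta>. 0 < \<delta> \<and> \<delta> \<le> \<rho> / 2 \<and> integrable lborel (\<lambda>x. ?T \<delta> n x) \<and>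
      (LINT x|lborel. ?T \<delta> n x) \<le> K" for n
  proof -
    \<comment> \<open>The error term carries s \<delta>^2 / kap^2, a constant times \<delta>^2 /
      kap^(n + 2). So \<open>gradient_weighted_bound\<close> is needed with
      \<open>M = n + 2\<close>.\<close>
    obtain C where C: "\<And>x. x \<in> cball p (2 * \<rho>) \<Longrightarrow> \<bar>u x\<bar> \<le> C * dist x p ^ (2 * (n + 2) + 2)"
      using van by blast
    have "\<exists>C'. \<forall>\<delta>. 0 < \<delta> \<longrightarrow> \<delta> \<le> \<rho> \<longrightarrow>
      integrable lborel (\<lambda>x. \<zeta> x * (1 / kap p \<delta> x) ^ (n + 2) * ((g1 x)\<^sup>2 + (g2 x)\<^sup>2)) \<and>
      (LINT x|lborel. \<zeta> x * (1 / kap p \<delta> x) ^ (n + 2) * ((g1 x)\<^sup>2 + (g2 x)\<^sup>2)) \<le> C'"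
      by (rule gradient_weighted_bound[OF \<rho> grad cont _ \<zeta>(1-8)]) (fact C \<zeta>(9-11))+
    then obtain C' where C': "\<And>\<delta>. 0 < \<delta> \<Longrightarrow> \<delta> \<le> \<rho> \<Longrightarrow>
      integrable lborel (\<lambda>x. \<zeta> x * (1 / kap p \<delta> x) ^ (n + 2) * ((g1 x)\<^sup>2 + (g2 x)\<^sup>2)) \<and>
      (LINT x|lborel. \<zeta> x * (1 / kap p \<delta> x) ^ (n + 2) * ((g1 x)\<^sup>2 + (g2 x)\<^sup>2)) \<le> C'"
      by blast
    define E where "E = 64 * real n * ((\<rho>\<^sup>2) ^ n * max C' 0)"
    have E: "E \<ge> 0" by (simp add: E_def)
    \<comment> \<open>1 / (E + 1) makes the error at most E \<delta>^2 \<le> 1, and \<rho> / 2 makes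
      the weight at least 2 ^ n on \<open>cball p (\<rho> / 2)\<close>.\<close>
    define \<delta> where "\<delta> = min (\<rho> / 2) (1 / (E + 1))"
    have \<delta>: "0 < \<delta>" "\<delta> \<le> \<rho> / 2" "\<delta> \<le> 1 / (E + 1)" using \<rho> E by (auto simp: \<delta>_def)
    have "1 / (E + 1) \<le> 1" using E by simp
    then have "\<delta> \<le> 1" using \<delta>(3) by linarith
    then have "\<delta> * \<delta> \<le> 1 / (E + 1) * 1" using \<delta> E by (intro mult_mono) auto
    then have "E * \<delta>\<^sup>2 \<le> E * (1 / (E + 1))" using E
        by (intro mult_left_mono) (auto simp: power2_eq_square)
    also have "\<dots> \<le> 1" using E by simp
    finally have E\<delta>: "E * \<delta>\<^sup>2 \<le> 1" .
    have kp: "kap p \<delta> x > 0" for x by (rule kap_pos[OF \<delta>(1)])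
    have s0: "s \<delta> n x > 0" for x using kp \<rho> by (simp add: s_def)
    have C'': "integrable lborel (\<lambda>x. \<zeta> x * (1 / kap p \<delta> x) ^ (n + 2) * q x)"
      "(LINT x|lborel. \<zeta> x * (1 / kap p \<delta> x) ^ (n + 2) * q x) \<le> C'"
      using C'[of \<delta>] \<delta> \<rho> by (auto simp: q_def)
    have "(LINT x|lborel. ?w1 \<delta> n x * q x) \<le>
      (LINT x|lborel. (\<rho>\<^sup>2) ^ n * \<delta>\<^sup>2 * (\<zeta> x * (1 / kap p \<delta> x) ^ (n + 2) * q x))"
    proof (intro integral_mono w1int \<delta>(1) integrable_mult_right C'')
      fix x
      have e: "s \<delta> n x * (\<delta>\<^sup>2 / (kap p \<delta> x)\<^sup>2) = (\<rho>\<^sup>2) ^ n * \<delta>\<^sup>2 * (1 / kap p \<delta> x) ^ (n + 2)"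
        using kp[of x] by (simp add: s_def power_divide power_add power2_eq_square)
      have l: "?w1 \<delta> n x * q x = (\<zeta> x)\<^sup>2 * ((s \<delta> n x * (\<delta>\<^sup>2 / (kap p \<delta> x)\<^sup>2)) * q x)"
        by (simp only: mult.assoc)
      have "(\<zeta> x)\<^sup>2 \<le> \<zeta> x" using \<zeta>(6,7)[of x] by (simp add: power2_eq_square mult_left_le)
      then have "(\<zeta> x)\<^sup>2 * ((s \<delta> n x * (\<delta>\<^sup>2 / (kap p \<delta> x)\<^sup>2)) * q x)
          \<le> \<zeta> x * ((s \<delta> n x * (\<delta>\<^sup>2 / (kap p \<delta> x)\<^sup>2)) * q x)"
        using s0[of x] q0[of x] by (intro mult_right_mono)
            (auto intro!: mult_nonneg_nonneg simp: less_imp_le)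
      then show "?w1 \<delta> n x * q x \<le> (\<rho>\<^sup>2) ^ n * \<delta>\<^sup>2 * (\<zeta> x * (1 / kap p \<delta> x) ^ (n + 2) * q x)"
        unfolding l e by (simp only: mult_ac)
    qed
    also have "\<dots> = (\<rho>\<^sup>2) ^ n * \<delta>\<^sup>2 * (LINT x|lborel. \<zeta> x * (1 / kap p \<delta> x) ^ (n + 2) * q x)"
        by (rule integral_mult_right_zero)
    also have "\<dots> \<le> (\<rho>\<^sup>2) ^ n * \<delta>\<^sup>2 * max C' 0" using C''(2) by (intro mult_left_mono) auto
    finally have "64 * real n * (LINT x|lborel. ?w1 \<delta> n x * q x)
        \<le> 64 * real n * ((\<rho>\<^sup>2) ^ n * \<delta>\<^sup>2 * max C' 0)"
      by (intro mult_left_mono) auto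
    also have "\<dots> = E * \<delta>\<^sup>2" by (simp add: E_def)
    finally have third: "64 * real n * (LINT x|lborel. ?w1 \<delta> n x * q x) \<le> 1"
      using E\<delta> by linarith
    \<comment> \<open>The equation enters here: s d^2 \<le> A s q \<le> A (1 + s q).\<close>
    have "AE x in lborel. ?w0 \<delta> n x * (d x)\<^sup>2 \<le> A x"
      using A(3)
    proof eventually_elim
      fix x assume dA: "(d x)\<^sup>2 \<le> A x * ((g1 x)\<^sup>2 + (g2 x)\<^sup>2)"
      have p1: "1 + s \<delta> n x * q x > 0" using s0[of x] q0[of x] by (simp add: add_pos_nonneg)
      have "(\<zeta> x)\<^sup>2 * (s \<delta> n x * (d x)\<^sup>2) \<le> 1 * (s \<delta> n x * (A x * q x))"
        using dA s0[of x] \<zeta>(6,7)[of x] by (intro mult_mono) (auto simp: q_def power_le_one)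
      also have "\<dots> \<le> A x * (1 + s \<delta> n x * q x)" using A(2)[of x] by (simp add: algebra_simps)
      finally show "?w0 \<delta> n x * (d x)\<^sup>2 \<le> A x"
        using p1 by (simp add: divide_le_eq mult_ac)
    qed
    then have second: "(LINT x|lborel. ?w0 \<delta> n x * (d x)\<^sup>2) \<le> (LINT x|lborel. A x)"
      by (intro integral_mono_AE w0int \<delta>(1) A(1))
    have "(LINT x|lborel. ?T \<delta> n x) \<le> K"
      unfolding K_def
      by (rule order_trans[OF limit_bound[OF \<delta>(1), THEN conjunct2]])
        (intro mult_left_mono add_mono second third order_refl, auto)
    then show ?thesis using \<delta> limit_bound[OF \<delta>(1)] by blast
  qed
  have null: "AE x in lborel. \<not> (x \<in> cball p (\<rho> / 2) \<and> q x \<ge> 1 / real (Suc j))" for j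
  proof -
    define S where "S = {x \<in> cball p (\<rho> / 2). q x \<ge> 1 / real (Suc j)}"
    have Sm[measurable]: "S \<in> sets borel"
    proof -
      have "S = cball p (\<rho> / 2) \<inter> q -` {1 / real (Suc j)..}" by (auto simp: S_def)
      moreover have "q -` {1 / real (Suc j)..} \<in> sets borel"
        using measurable_sets[of q borel borel "{1 / real (Suc j)..}"] by simp
      ultimately show ?thesis by simp
    qed
    have "bounded S" by (rule bounded_subset[of "cball p (\<rho> / 2)"]) (auto simp: S_def)
    then have fin: "emeasure lborel S < \<infinity>" by (rule emeasure_bounded_finite)
    define \<mu> where "\<mu> = measure lborel S"
    have "\<mu> = 0"
    proof (rule ccontr)
      assume "\<mu> \<noteq> 0"
      then have \<mu>: "\<mu> > 0" by (simp add: \<mu>_def less_le)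
      have K0: "0 \<le> K" unfolding K_def using q0 A(2)
        by (intro mult_nonneg_nonneg add_nonneg_nonneg Bochner_Integration.integral_nonneg) auto
      \<comment> \<open>Chosen so that K = (X - 1) \<mu>; then X^2 \<mu> \<le> K is impossible for X
        \<ge> 1.\<close>
      define X where "X = K / \<mu> + 1"
      have X: "X \<ge> 1" using K0 \<mu> by (simp add: X_def)
      \<comment> \<open>On \<open>S\<close> the argument s q of \<open>log_mean\<close> is at least
        a = 2 ^ n / (j + 1). This n makes ln a exceed 2 X, and \<open>log_mean\<close> is at least
        half of ln (1 + a).\<close>
      obtain n :: nat where n: "(ln (real (Suc j)) + 2 * X) / ln 2 < real n"
          using reals_Archimedean2 by blast
      then have n': "ln (real (Suc j)) + 2 * X < real n * ln 2" by (simp add: divide_less_eq)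
      define a where "a = 2 ^ n / real (Suc j)"
      have a0: "a > 0" by (simp add: a_def)
      have lna: "ln a = real n * ln 2 - ln (real (Suc j))"
        unfolding a_def by (subst ln_div) (auto simp: ln_realpow)
      have "2 * X < ln a" using n' lna by simp
      moreover have "ln a \<le> ln (1 + a)" using a0 by (subst ln_le_cancel_iff) auto
      ultimately have lnX: "X \<le> ln (1 + a) / 2" by simp
      have "ln a > 0" using \<open>2 * X < ln a\<close> X by simp
      then have a1: "1 \<le> a" using a0 by (simp add: ln_gt_zero_iff)
      obtain \<delta> where \<delta>: "0 < \<delta>" "\<delta> \<le> \<rho> / 2" "integrable lborel (\<lambda>x. ?T \<delta> n x)"
        "(LINT x|lborel. ?T \<delta> n x) \<le> K"
        using uniform by blast
      have "X\<^sup>2 * \<mu> = (LINT x|lborel. X\<^sup>2 * indicator S x)" using fin by (simp add: \<mu>_def)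
      also have "\<dots> \<le> (LINT x|lborel. ?T \<delta> n x)"
      proof (intro integral_mono \<delta>)
        show "integrable lborel (\<lambda>x. X\<^sup>2 * indicator S x)" using fin
            by (intro integrable_mult_right integrable_real_indicator) auto
        fix x
        show "X\<^sup>2 * indicator S x \<le> ?T \<delta> n x"
        proof (cases "x \<in> S")
          case True
          then have xd: "dist x p \<le> \<rho> / 2" and xq: "q x \<ge> 1 / real (Suc j)"
              by (auto simp: S_def dist_commute)
          have "kap p \<delta> x \<le> (\<rho> / 2)\<^sup>2 + (\<rho> / 2)\<^sup>2"
            unfolding kap_eq using xd \<delta> by (intro add_mono power_mono) auto
          then have "2 * kap p \<delta> x \<le> \<rho>\<^sup>2" by (simp add: power2_eq_square)
          then have "2 \<le> \<rho>\<^sup>2 / kap p \<delta> x" using kap_pos[OF \<delta>(1), of p x] by (simp add: le_divide_eq)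
          then have "2 ^ n \<le> s \<delta> n x" unfolding s_def by (intro power_mono) auto
          then have "2 ^ n * (1 / real (Suc j)) \<le> s \<delta> n x * q x" using xq
              by (intro mult_mono order_trans[OF _ \<open>2 ^ n \<le> s \<delta> n x\<close>]) auto
          then have "ln (1 + a) / 2 \<le> log_mean (s \<delta> n x * q x)"
              by (intro log_mean_ge a1) (simp add: a_def)
          then have "X \<le> \<zeta> x * log_mean (s \<delta> n x * q x)" using lnX \<zeta>1[of x] xd \<rho> by simp
          then show ?thesis using True X by (simp add: power_mono)
        qed simp
      qed
      also have "\<dots> \<le> K" by (rule \<delta>)
      also have "\<dots> = (X - 1) * \<mu>" using \<mu> by (simp add: X_def)
      finally have "X\<^sup>2 \<le> X - 1" using \<mu> by simp
      moreover have "X \<le> X\<^sup>2" using X by (simp add: power2_eq_square)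
      ultimately show False by simp
    qed
    then have "emeasure lborel S = 0" using fin by (simp add: \<mu>_def emeasure_eq_ennreal_measure)
    then have "S \<in> null_sets lborel" using Sm by (auto simp: null_sets_def)
    then have "AE x in lborel. x \<notin> S" by (rule AE_not_in)
    then show ?thesis by eventually_elim (simp add: S_def)
  qed
  have "AE x in lborel. \<forall>j. \<not> (x \<in> cball p (\<rho> / 2) \<and> q x \<ge> 1 / real (Suc j))"
    unfolding AE_all_countable using null by (intro allI)
  then show ?thesis
  proof eventually_elim
    fix x assume a: "\<forall>j. \<not> (x \<in> cball p (\<rho> / 2) \<and> q x \<ge> 1 / real (Suc j))"
    show "x \<in> cball p (\<rho> / 2) \<longrightarrow> g1 x = 0 \<and> g2 x = 0"
    proof
      assume "x \<in> cball p (\<rho> / 2)"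
      then have lt: "q x < 1 / real (Suc j)" for j using a by (auto simp: not_le)
      have "q x = 0"
      proof (rule ccontr)
        assume "q x \<noteq> 0"
        then have "q x > 0" using q0[of x] by simp
        then obtain j where "inverse (real (Suc j)) < q x" using reals_Archimedean by blast
        then show False using lt[of j] by (simp add: inverse_eq_divide)
      qed
      then show "g1 x = 0 \<and> g2 x = 0" by (simp add: q_def sum_power2_eq_zero_iff)
    qed
  qed
qed

section \<open>Weak derivatives\<close>

text \<open>Each derivative in \<open>y\<close> produces a sign. The constant \<open>c\<close>
  absorbs it, so the family is closed under \<open>partial_deriv\<close> and the induction on
  \<open>k\<close> goes through.\<close>

lemma test_kernel_Ck:
  fixes x :: "real^2"
  assumes M: "mollifier \<epsilon> H"
  shows "Ck k (\<lambda>y :: real^2. c * (H i (x $ 1 - y $ 1) * H j (x $ 2 - y $ 2)))"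
    and "partial_deriv 1 (\<lambda>y :: real^2. c * (H i (x $ 1 - y $ 1) * H j (x $ 2 - y $ 2)))
        = (\<lambda>y. - c * (H (Suc i) (x $ 1 - y $ 1) * H j (x $ 2 - y $ 2)))"
    and "partial_deriv 2 (\<lambda>y :: real^2. c * (H i (x $ 1 - y $ 1) * H j (x $ 2 - y $ 2)))
        = (\<lambda>y. - c * (H i (x $ 1 - y $ 1) * H (Suc j) (x $ 2 - y $ 2)))"
proof -
  have comp: "((\<lambda>y :: real^2. H n (x $ l - y $ l)) has_derivative
      (\<lambda>h. - H (Suc n) (x $ l - y $ l) * h $ l)) (at y)" for n and l :: 2 and y
  proof -
    have "((\<lambda>y :: real^2. x $ l - y $ l) has_derivative (\<lambda>h. 0 - h $ l)) (at y)"
      by (intro has_derivative_diff has_derivative_const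
          bounded_linear.has_derivative[OF bounded_linear_vec_nth] has_derivative_ident)
    moreover have "(H n has_derivative (*) (H (Suc n) (x $ l - y $ l))) (at (x $ l - y $ l))"
      using mollD(1)[OF M, of n] by (simp add: has_field_derivative_def)
    ultimately have "((\<lambda>y :: real^2. H n (x $ l - y $ l)) has_derivative
        (\<lambda>h. H (Suc n) (x $ l - y $ l) * (0 - h $ l))) (at y)"
      by (rule has_derivative_compose)
    then show ?thesis by simp
  qed
  have der: "((\<lambda>y :: real^2. c * (H i (x $ 1 - y $ 1) * H j (x $ 2 - y $ 2))) has_derivative
      (\<lambda>h. c * (H i (x $ 1 - y $ 1) * (- H (Suc j) (x $ 2 - y $ 2) * h $ 2)
          + (- H (Suc i) (x $ 1 - y $ 1) * h $ 1) * H j (x $ 2 - y $ 2)))) (at y)"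
    for c i j y
    by (intro has_derivative_mult_right has_derivative_mult comp)
  have p1: "partial_deriv 1 (\<lambda>y :: real^2. c * (H i (x $ 1 - y $ 1) * H j (x $ 2 - y $ 2)))
      = (\<lambda>y. - c * (H (Suc i) (x $ 1 - y $ 1) * H j (x $ 2 - y $ 2)))" for c i j
    unfolding partial_deriv_def frechet_derivative_at[OF der, symmetric]
        by (simp add: axis_def fun_eq_iff)
  have p2: "partial_deriv 2 (\<lambda>y :: real^2. c * (H i (x $ 1 - y $ 1) * H j (x $ 2 - y $ 2)))
      = (\<lambda>y. - c * (H i (x $ 1 - y $ 1) * H (Suc j) (x $ 2 - y $ 2)))" for c i j
    unfolding partial_deriv_def frechet_derivative_at[OF der, symmetric]
        by (simp add: axis_def fun_eq_iff)
  show "Ck k (\<lambda>y :: real^2. c * (H i (x $ 1 - y $ 1) * H j (x $ 2 - y $ 2)))"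
  proof (induction k arbitrary: c i j)
    case 0
    show ?case by (auto intro!: continuous_intros kernel_continuous[OF M])
  next
    case (Suc k)
    have "(\<lambda>y :: real^2. c * (H i (x $ 1 - y $ 1) * H j (x $ 2 - y $ 2))) differentiable (at y)"
        for y
      using der unfolding differentiable_def by blast
    moreover have "Ck k (partial_deriv l (\<lambda>y :: real^2. c *
        (H i (x $ 1 - y $ 1) * H j (x $ 2 - y $ 2))))" for l
      using exhaust_2[of l] by (elim disjE) (simp_all only: p1 p2 Suc)
    ultimately show ?case by simp
  qed
  show "partial_deriv 1 (\<lambda>y :: real^2. c * (H i (x $ 1 - y $ 1) * H j (x $ 2 - y $ 2)))
      = (\<lambda>y. - c * (H (Suc i) (x $ 1 - y $ 1) * H j (x $ 2 - y $ 2)))"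
    by (rule p1)
  show "partial_deriv 2 (\<lambda>y :: real^2. c * (H i (x $ 1 - y $ 1) * H j (x $ 2 - y $ 2)))
      = (\<lambda>y. - c * (H i (x $ 1 - y $ 1) * H (Suc j) (x $ 2 - y $ 2)))"
    by (rule p2)
qed

lemma test_kernel:
  assumes M: "mollifier \<epsilon> H" and sub: "cball x (2 * \<epsilon>) \<subseteq> \<Omega>"
  shows "test_function \<Omega> (\<lambda>y :: real^2. 1 * (H i (x $ 1 - y $ 1) * H j (x $ 2 - y $ 2)))"
proof -
  let ?S = "{y :: real^2. 1 * (H i (x $ 1 - y $ 1) * H j (x $ 2 - y $ 2)) \<noteq> 0}"
  have "?S \<subseteq> cball x (2 * \<epsilon>)" using kernel_support[OF M] by auto
  then have cl: "closure ?S \<subseteq> cball x (2 * \<epsilon>)" by (simp add: closure_minimal)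
  then have "compact (closure ?S)" by (meson bounded_cball bounded_subset closed_closure
      compact_eq_bounded_closed)
  then show ?thesis unfolding test_function_def using cl sub test_kernel_Ck(1)[OF M, of _ 1]
      by blast
qed

text \<open>Weak derivatives are only Lebesgue measurable, while the estimates above are made with
  \<open>lborel\<close>. This is the passage from one to the other, combined with cutting off
  outside \<open>K\<close>.\<close>

lemma borel_representative:
  fixes f :: "real^2 \<Rightarrow> real"
  assumes "set_integrable lebesgue K f"
  shows "\<exists>f0. integrable lborel f0 \<and> (AE y in lebesgue. f0 y = indicator K y * f y)"
proof -
  have int: "integrable lebesgue (\<lambda>y. indicator K y * f y)" using assms
      by (simp add: set_integrable_def)
  then obtain f0 where f0: "f0 \<in> borel_measurable lborel"
      "AE y in lborel. indicator K y * f y = f0 y"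
    using completion_ex_borel_measurable_real[of "\<lambda>y. indicator K y * f y" lborel] by auto
  have ae: "AE y in lebesgue. indicator K y * f y = f0 y" using f0(2) by (rule AE_completion)
  have "integrable lebesgue f0"
    by (rule integrable_cong_AE_imp[OF int measurable_completion[OF f0(1)] ae])
  then have "integrable lborel f0" using integrable_completion[OF f0(1)] by simp
  moreover have "AE y in lebesgue. f0 y = indicator K y * f y" using ae by eventually_elim simp
  ultimately show ?thesis by blast
qed

lemma borel_representative_power2:
  fixes f :: "real^2 \<Rightarrow> real"
  assumes f0: "integrable lborel f0" "AE y in lebesgue. f0 y = indicator K y * f y"
    and sq: "set_integrable lebesgue K (\<lambda>y. (f y)\<^sup>2)"
  shows "integrable lborel (\<lambda>y. (f0 y)\<^sup>2)"
proof -
  have m: "(\<lambda>y. (f0 y)\<^sup>2) \<in> borel_measurable lborel" using f0(1) by simp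
  have "AE y in lebesgue. indicator K y *\<^sub>R (f y)\<^sup>2 = (f0 y)\<^sup>2"
    using f0(2) by eventually_elim (simp add: indicator_def)
  then have "integrable lebesgue (\<lambda>y. (f0 y)\<^sup>2)"
    using sq unfolding set_integrable_def by (rule integrable_cong_AE_imp[rotated 2])
        (rule measurable_completion[OF m])
  then show ?thesis using integrable_completion[OF m] by simp
qed

text \<open>The kernel centred at \<open>x\<close> vanishes outside \<open>K\<close>, so integrating
  over \<Omega> and cutting \<open>f\<close> off at \<open>K\<close> give the same value.\<close>

lemma conv_lebesgue:
  assumes M: "mollifier \<epsilon> H" and sub: "cball x (2 * \<epsilon>) \<subseteq> K" "K \<subseteq> \<Omega>"
    and f: "set_integrable lebesgue K f"
    and f0: "integrable lborel f0" "AE y in lebesgue. f0 y = indicator K y * f y"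
  shows "(LINT y:\<Omega>|lebesgue. (c * (H i (x $ 1 - y $ 1) * H j (x $ 2 - (y::real^2) $ 2))) *\<^sub>R
      (f y :: real)) = c * conv H i j f0 x"
proof -
  let ?k = "\<lambda>y. c * (H i (x $ 1 - y $ 1) * H j (x $ 2 - (y::real^2) $ 2))"
  have k: "?k \<in> borel_measurable borel"
    by (intro borel_measurable_continuous_onI continuous_intros kernel_continuous[OF M])
  have eq: "indicator \<Omega> y *\<^sub>R (?k y *\<^sub>R f y) = ?k y * (indicator K y *\<^sub>R f y)" for y
  proof (cases "H i (x $ 1 - y $ 1) * H j (x $ 2 - y $ 2) = 0")
    case True
    then have "?k y = 0" by (simp only: mult_zero_right)
    then show ?thesis by (simp only: scaleR_zero_left scaleR_zero_right mult_zero_left)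
  next
    case False
    then have "dist x y \<le> 2 * \<epsilon>" by (rule kernel_support[OF M])
    then have "y \<in> K" "y \<in> \<Omega>" using sub by auto
    then show ?thesis by simp
  qed
  have "(LINT y:\<Omega>|lebesgue. ?k y *\<^sub>R f y) = (LINT y|lebesgue. ?k y * (indicator K y *\<^sub>R f y))"
    unfolding set_lebesgue_integral_def eq ..
  also have "\<dots> = (LINT y|lebesgue. ?k y * f0 y)"
  proof (rule integral_cong_AE)
    have k': "?k \<in> borel_measurable lebesgue" using k by (intro measurable_completion) simp
    show "(\<lambda>y. ?k y * (indicator K y *\<^sub>R f y)) \<in> borel_measurable lebesgue"
      using f by (intro borel_measurable_times k') (auto simp: set_integrable_def)
    show "(\<lambda>y. ?k y * f0 y) \<in> borel_measurable lebesgue"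
      using f0(1) by (intro borel_measurable_times k' measurable_completion) auto
    show "AE y in lebesgue. ?k y * (indicator K y *\<^sub>R f y) = ?k y * f0 y"
      using f0(2) by eventually_elim simp
  qed
  also have "\<dots> = (LINT y|lborel. ?k y * f0 y)"
    by (rule integral_completion, rule borel_measurable_times) (use f0(1) k in auto)
  also have "\<dots> = c * conv H i j f0 x"
    unfolding conv_def by (simp add: mult.assoc)
  finally show ?thesis .
qed

text \<open>The kernel, as a function of \<open>y\<close>, is taken as test function. Its derivative
  in \<open>y\<close> is minus the one in \<open>x\<close>, and this sign cancels the one in the
  definition of the weak derivative.\<close>

lemma weak_partial_conv:
  fixes u g :: "real^2 \<Rightarrow> real"
  assumes M: "mollifier \<epsilon> H" and sub: "cball x (2 * \<epsilon>) \<subseteq> K" "K \<subseteq> \<Omega>" "compact K"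
    and u0: "integrable lborel u0" "AE y in lebesgue. u0 y = indicator K y * u y"
    and g0: "integrable lborel g0" "AE y in lebesgue. g0 y = indicator K y * g y"
  shows "has_weak_partial \<Omega> 1 u g \<Longrightarrow> conv H (Suc i) j u0 x = conv H i j g0 x"
    and "has_weak_partial \<Omega> 2 u g \<Longrightarrow> conv H i (Suc j) u0 x = conv H i j g0 x"
proof -
  let ?\<phi> = "\<lambda>y :: real^2. 1 * (H i (x $ 1 - y $ 1) * H j (x $ 2 - y $ 2))"
  have test: "test_function \<Omega> ?\<phi>" using test_kernel[OF M, of x] sub by blast
  have int: "(LINT y:\<Omega>|lebesgue. partial_deriv l ?\<phi> y *\<^sub>R u y) = - conv H i j g0 x"
    "set_integrable lebesgue K u" if "has_weak_partial \<Omega> l u g" for l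
  proof -
    have iu: "set_integrable lebesgue K u" "set_integrable lebesgue K g"
      using that sub unfolding has_weak_partial_def L1_loc_def by blast+
    have "(LINT y:\<Omega>|lebesgue. partial_deriv l ?\<phi> y *\<^sub>R u y) = - (LINT y:\<Omega>|lebesgue. ?\<phi> y *\<^sub>R g y)"
      using that test unfolding has_weak_partial_def by blast
    also have "(LINT y:\<Omega>|lebesgue. ?\<phi> y *\<^sub>R g y) = 1 * conv H i j g0 x"
      by (rule conv_lebesgue[OF M sub(1,2) iu(2) g0])
    finally show "(LINT y:\<Omega>|lebesgue. partial_deriv l ?\<phi> y *\<^sub>R u y) = - conv H i j g0 x" by simp
    show "set_integrable lebesgue K u" by (rule iu)
  qed
  show "conv H (Suc i) j u0 x = conv H i j g0 x" if w: "has_weak_partial \<Omega> 1 u g"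
    using int(1)[OF w] unfolding test_kernel_Ck(2)[OF M]
        conv_lebesgue[OF M sub(1,2) int(2)[OF w] u0] by simp
  show "conv H i (Suc j) u0 x = conv H i j g0 x" if w: "has_weak_partial \<Omega> 2 u g"
    using int(1)[OF w] unfolding test_kernel_Ck(3)[OF M]
        conv_lebesgue[OF M sub(1,2) int(2)[OF w] u0] by simp
qed

text \<open>The du Bois-Reymond lemma. Mollifier kernels are test functions, so near each point of
  \<Omega> the mollifications of \<open>w\<close> vanish, while they converge to \<open>w\<close>
  almost everywhere. A locally negligible set is negligible.\<close>

lemma weak_zero_AE:
  fixes w :: "real^2 \<Rightarrow> real"
  assumes "open \<Omega>" and w: "L1_loc \<Omega> w"
    and zero: "\<And>\<phi>. test_function \<Omega> \<phi> \<Longrightarrow> (LINT x:\<Omega>|lebesgue. \<phi> x *\<^sub>R w x) = 0"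
  shows "AE x in lebesgue. x \<in> \<Omega> \<longrightarrow> w x = 0"
proof -
  let ?S = "{x \<in> \<Omega>. w x \<noteq> 0}"
  have "\<exists>U. openin (top_of_set ?S) U \<and> x \<in> U \<and> negligible U" if x: "x \<in> ?S" for x
  proof -
    have "x \<in> \<Omega>" using x by simp
    from open_contains_cball[THEN iffD1, rule_format, OF \<open>open \<Omega>\<close> this]
    obtain r where r: "r > 0" "cball x r \<subseteq> \<Omega>" by metis
    let ?K = "cball x r"
    have wK: "set_integrable lebesgue ?K w" 
      using w r(2) compact_cball[of x r] unfolding L1_loc_def by blast
    then obtain w0 where w0: "integrable lborel w0" "AE y in lebesgue. w0 y = indicator ?K y * w y"
      using borel_representative by blast
    obtain \<epsilon> H where \<epsilon>: "\<And>m. 0 < \<epsilon> m" "\<And>m. \<epsilon> m \<le> r / 4" and H: "\<And>m. mollifier (\<epsilon> m) (H m)"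
      and lim: "AE y in lborel. (\<lambda>m. conv (H m) 0 0 w0 y) \<longlonglongrightarrow> w0 y"
      using mollifier_sequence[of "r / 4" w0 w0] w0 r by auto
    have cz: "conv (H m) 0 0 w0 y = 0" if y: "y \<in> ball x (r / 2)" for m y
    proof -
      have sub: "cball y (2 * \<epsilon> m) \<subseteq> ?K"
      proof
        fix z assume "z \<in> cball y (2 * \<epsilon> m)"
        then show "z \<in> ?K" using y \<epsilon>(2)[of m] dist_triangle[of x z y] by auto
      qed
      have "1 * conv (H m) 0 0 w0 y = 0"
        using conv_lebesgue[OF H sub r(2) wK w0, of 1 0 0]
            zero[OF test_kernel[OF H[of m] order_trans[OF sub r(2)]], of 0 0] by simp
      then show ?thesis by simp
    qed
    have "AE y in lborel. y \<in> ball x (r / 2) \<longrightarrow> w0 y = 0"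
      using lim by eventually_elim (use cz in \<open>auto simp: LIMSEQ_const_iff simp del: mem_ball\<close>)
    then have "AE y in lebesgue. y \<in> ball x (r / 2) \<longrightarrow> w0 y = 0" by (rule AE_completion)
    then have "AE y in lebesgue. \<not> (y \<in> ball x (r / 2) \<and> w y \<noteq> 0)"
      using w0(2) by eventually_elim (use r in auto)
    then obtain N where N: "N \<in> null_sets lebesgue" "{y. y \<in> ball x (r / 2) \<and> w y \<noteq> 0} \<subseteq> N"
      unfolding eventually_ae_filter by auto
    have "negligible N" using N(1) by (simp add: negligible_iff_null_sets)
    then have "negligible (?S \<inter> ball x (r / 2))"
      by (rule negligible_subset) (use N(2) in auto)
    moreover have "openin (top_of_set ?S) (?S \<inter> ball x (r / 2))" by (simp add: openin_open_Int)
    ultimately show ?thesis using x r by (intro exI[of _ "?S \<inter> ball x (r / 2)"]) auto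
  qed
  then have "negligible ?S" by (subst locally_negligible_alt) blast
  then have "AE x in lebesgue. x \<notin> ?S" unfolding negligible_iff_null_sets by (rule AE_not_in)
  then show ?thesis by eventually_elim auto
qed

lemma test_function_partial:
  assumes "test_function \<Omega> \<phi>"
  shows "has_partial i \<phi> (partial_deriv i \<phi>)" "continuous_on UNIV \<phi>"
      "continuous_on UNIV (partial_deriv i \<phi>)"
    "\<exists>K p r. compact K \<and> K \<subseteq> \<Omega> \<and> K \<subseteq> cball p r \<and> (\<forall>x. x \<notin> K \<longrightarrow> \<phi> x = 0 \<and> partial_deriv i \<phi> x = 0)"
proof -
  have Ck: "Ck 0 \<phi>" "Ck (Suc 0) \<phi>" using assms by (auto simp: test_function_def simp del: Ck.simps)
  show "continuous_on UNIV \<phi>" "continuous_on UNIV (partial_deriv i \<phi>)" using Ck by auto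
  have D: "(\<phi> has_derivative frechet_derivative \<phi> (at x)) (at x)" for x
    using Ck by (simp add: frechet_derivative_works)
  show "has_partial i \<phi> (partial_deriv i \<phi>)"
    unfolding has_partial_def
  proof
    fix x
    have "((\<lambda>t. x + t *\<^sub>R axis i 1) has_derivative (\<lambda>t. t *\<^sub>R axis i (1::real))) (at (0::real))"
      by (auto intro!: derivative_eq_intros)
    from has_derivative_compose[OF this, of \<phi> "frechet_derivative \<phi> (at x)"] D
    have "((\<lambda>t. \<phi> (x + t *\<^sub>R axis i 1)) has_derivative
        (\<lambda>t. frechet_derivative \<phi> (at x) (t *\<^sub>R axis i 1))) (at 0)"
      by simp
    moreover have "frechet_derivative \<phi> (at x) (t *\<^sub>R axis i 1) = partial_deriv i \<phi> x * t" for t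
      using linear_scale[OF has_derivative_linear[OF D]]
          by (simp add: partial_deriv_def mult.commute)
    ultimately show "((\<lambda>t. \<phi> (x + t *\<^sub>R axis i 1)) has_real_derivative partial_deriv i \<phi> x) (at 0)"
      by (simp add: has_field_derivative_def)
  qed
  let ?K = "closure {x. \<phi> x \<noteq> 0}"
  have K: "compact ?K" "?K \<subseteq> \<Omega>" using assms by (auto simp: test_function_def)
  have z: "\<phi> x = 0" if "x \<notin> ?K" for x using that closure_subset[of "{x. \<phi> x \<noteq> 0}"] by auto
  have "partial_deriv i \<phi> x = 0" if x: "x \<notin> ?K" for x
  proof -
    have "(\<phi> has_derivative (\<lambda>h. 0)) (at x)"
    proof (rule has_derivative_transform_within_open[OF has_derivative_const[of 0]])
      show "open (- ?K)" by (intro open_Compl closed_closure)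
      show "x \<in> - ?K" using x by (simp only: Compl_iff not_False_eq_True)
      show "0 = \<phi> y" if "y \<in> - ?K" for y using z[OF that[unfolded Compl_iff]] by (rule sym)
    qed
    then have "frechet_derivative \<phi> (at x) = (\<lambda>h. 0)" by (rule frechet_derivative_at[symmetric])
    then show ?thesis by (simp add: partial_deriv_def)
  qed
  moreover obtain p r where "?K \<subseteq> cball p r" using K(1)
      by (meson bounded_subset_cball compact_imp_bounded)
  ultimately show "\<exists>K p r. compact K \<and> K \<subseteq> \<Omega> \<and> K \<subseteq> cball p r
      \<and> (\<forall>x. x \<notin> K \<longrightarrow> \<phi> x = 0 \<and> partial_deriv i \<phi> x = 0)"
    using K z by blast
qed

lemma test_integrable:
  fixes f :: "real^'n::finite \<Rightarrow> 'a::euclidean_space"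
  assumes f: "L1_loc \<Omega> f" and \<psi>: "continuous_on UNIV \<psi>" and K: "compact K" "K \<subseteq> \<Omega>"
      "\<And>x. x \<notin> K \<Longrightarrow> \<psi> x = 0"
  shows "set_integrable lebesgue \<Omega> (\<lambda>x. \<psi> x *\<^sub>R f x)"
proof -
  have fK: "integrable lebesgue (\<lambda>x. indicator K x *\<^sub>R f x)"
    using f K unfolding L1_loc_def set_integrable_def by blast
  have "bounded (\<psi> ` K)"
    by (intro compact_imp_bounded compact_continuous_image K continuous_on_subset[OF \<psi>]) auto
  then obtain B where B: "\<And>x. x \<in> K \<Longrightarrow> norm (\<psi> x) \<le> B" unfolding bounded_iff by auto
  have "integrable lebesgue (\<lambda>x. \<psi> x *\<^sub>R (indicator K x *\<^sub>R f x))"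
  proof (rule Bochner_Integration.integrable_bound[OF integrable_scaleR_right[OF fK, of B]])
    show "(\<lambda>x. \<psi> x *\<^sub>R (indicator K x *\<^sub>R f x)) \<in> borel_measurable lebesgue"
    proof (rule borel_measurable_scaleR[OF _ borel_measurable_integrable[OF fK]])
      show "\<psi> \<in> borel_measurable lebesgue"
        by (intro measurable_completion) (auto intro: borel_measurable_continuous_onI \<psi>)
    qed
    show "AE x in lebesgue. norm (\<psi> x *\<^sub>R (indicator K x *\<^sub>R f x))
        \<le> norm (B *\<^sub>R (indicator K x *\<^sub>R f x))"
    proof (rule AE_I2)
      fix x
      show "norm (\<psi> x *\<^sub>R (indicator K x *\<^sub>R f x)) \<le> norm (B *\<^sub>R (indicator K x *\<^sub>R f x))"
        using B[of x] by (cases "x \<in> K") (auto intro!: mult_right_mono intro: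
            order_trans[OF _ abs_ge_self])
    qed
  qed
  moreover have "\<psi> x *\<^sub>R (indicator K x *\<^sub>R f x) = indicator \<Omega> x *\<^sub>R (\<psi> x *\<^sub>R f x)" for x
    using K by (cases "x \<in> K") auto
  ultimately show ?thesis by (simp only: set_integrable_def)
qed

lemma test_function_integrable:
  fixes f :: "real^'n::finite \<Rightarrow> 'a::euclidean_space"
  assumes f: "L1_loc \<Omega> f" and \<phi>: "test_function \<Omega> \<phi>"
  shows "set_integrable lebesgue \<Omega> (\<lambda>x. partial_deriv i \<phi> x *\<^sub>R f x)"
    "set_integrable lebesgue \<Omega> (\<lambda>x. \<phi> x *\<^sub>R f x)"
proof -
  obtain K where K: "compact K" "K \<subseteq> \<Omega>" "\<And>x. x \<notin> K \<Longrightarrow> \<phi> x = 0 \<and> partial_deriv i \<phi> x = 0"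
    using test_function_partial(4)[OF \<phi>, of i] by metis
  show "set_integrable lebesgue \<Omega> (\<lambda>x. partial_deriv i \<phi> x *\<^sub>R f x)"
    by (rule test_integrable[OF f test_function_partial(3)[OF \<phi>] K(1,2)]) (use K(3) in blast)
  show "set_integrable lebesgue \<Omega> (\<lambda>x. \<phi> x *\<^sub>R f x)"
    by (rule test_integrable[OF f test_function_partial(2)[OF \<phi>] K(1,2)]) (use K(3) in blast)
qed

lemma test_partial_integral:
  fixes \<phi> :: "real^'n::finite \<Rightarrow> real"
  assumes "test_function \<Omega> \<phi>"
  shows "(LINT x:\<Omega>|lebesgue. partial_deriv i \<phi> x) = 0"
proof -
  note T = test_function_partial(1,3,4)[OF assms, of i] and c\<phi> = test_function_partial(2)[OF assms]
  obtain K p r where K: "K \<subseteq> \<Omega>" "K \<subseteq> cball p r" "\<And>x. x \<notin> K \<Longrightarrow> \<phi> x = 0 \<and> partial_deriv i \<phi> x = 0"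
    using T(3) by metis
  have "indicator \<Omega> x *\<^sub>R partial_deriv i \<phi> x = partial_deriv i \<phi> x" for x
    using K(1,3) by (cases "x \<in> K") (auto simp: indicator_def)
  then have "(LINT x:\<Omega>|lebesgue. partial_deriv i \<phi> x) = (LINT x|lebesgue. partial_deriv i \<phi> x)"
    by (simp only: set_lebesgue_integral_def)
  also have "\<dots> = (LINT x|lborel. partial_deriv i \<phi> x)"
    using T(2) by (intro integral_completion) (auto intro: borel_measurable_continuous_onI)
  also have "\<dots> = 0"
    by (rule integral_partial_eq_0[OF T(1) c\<phi> T(2), of p r]) (use K(2,3) in blast)+
  finally show ?thesis .
qed

lemma L1_loc_const:
  fixes \<Omega> :: "(real^'n::finite) set"
  shows "L1_loc \<Omega> (\<lambda>x. c)"
  unfolding L1_loc_def set_integrable_def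
proof (intro allI impI)
  fix K :: "(real^'n) set" assume "compact K \<and> K \<subseteq> \<Omega>"
  then have "integrable lborel (\<lambda>x. indicator K x *\<^sub>R c)"
    by (intro borel_integrable_compact continuous_on_const) simp
  then show "integrable lebesgue (\<lambda>x. indicator K x *\<^sub>R c)"
    using integrable_completion[OF borel_measurable_integrable] by blast
qed

text \<open>The reduction to real-valued functions. The constant drops out because the partial
  derivative of a test function has integral 0.\<close>

lemma has_weak_partial_inner:
  fixes v :: "real^'n::finite \<Rightarrow> 'a::euclidean_space"
  assumes "has_weak_partial \<Omega> i v g"
  shows "has_weak_partial \<Omega> i (\<lambda>x. (v x - c) \<bullet> b) (\<lambda>x. g x \<bullet> b)"
proof -
  have L1: "L1_loc \<Omega> v" "L1_loc \<Omega> g" and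
    eq: "\<And>\<phi>. test_function \<Omega> \<phi> \<Longrightarrow>
        (LINT x:\<Omega>|lebesgue. partial_deriv i \<phi> x *\<^sub>R v x) = - (LINT x:\<Omega>|lebesgue. \<phi> x *\<^sub>R g x)"
    using assms by (auto simp: has_weak_partial_def)
  have inner: "L1_loc \<Omega> (\<lambda>x. f x \<bullet> b)" if "L1_loc \<Omega> f" for f :: "real^'n \<Rightarrow> 'a"
    unfolding L1_loc_def set_integrable_def
  proof (intro allI impI)
    fix K :: "(real^'n) set" assume "compact K \<and> K \<subseteq> \<Omega>"
    then have "integrable lebesgue (\<lambda>x. indicator K x *\<^sub>R f x)"
      using that by (simp add: L1_loc_def set_integrable_def)
    then have "integrable lebesgue (\<lambda>x. (indicator K x *\<^sub>R f x) \<bullet> b)"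
        by (intro integrable_inner_left)
    then show "integrable lebesgue (\<lambda>x. indicator K x *\<^sub>R (f x \<bullet> b))" by simp
  qed
  have diff: "L1_loc \<Omega> (\<lambda>x. v x - c)"
    using L1(1) L1_loc_const[of \<Omega> c] unfolding L1_loc_def by (auto intro: set_integral_diff)
  have "(LINT x:\<Omega>|lebesgue. partial_deriv i \<phi> x *\<^sub>R ((v x - c) \<bullet> b)) =
      - (LINT x:\<Omega>|lebesgue. \<phi> x *\<^sub>R (g x \<bullet> b))"
    if \<phi>: "test_function \<Omega> \<phi>" for \<phi>
  proof -
    have I: "set_integrable lebesgue \<Omega> (\<lambda>x. partial_deriv i \<phi> x *\<^sub>R v x)"
      "set_integrable lebesgue \<Omega> (\<lambda>x. partial_deriv i \<phi> x *\<^sub>R c)"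
          "set_integrable lebesgue \<Omega> (\<lambda>x. \<phi> x *\<^sub>R g x)"
      "set_integrable lebesgue \<Omega> (\<lambda>x. partial_deriv i \<phi> x *\<^sub>R (v x - c))"
      by (rule test_function_integrable[OF _ \<phi>], rule L1 L1_loc_const diff)+
    have inn: "(LINT x:\<Omega>|lebesgue. \<psi> x *\<^sub>R (f x \<bullet> b)) = (LINT x:\<Omega>|lebesgue. \<psi> x *\<^sub>R f x) \<bullet> b"
      if "set_integrable lebesgue \<Omega> (\<lambda>x. \<psi> x *\<^sub>R f x)" for \<psi> and f :: "real^'n \<Rightarrow> 'a"
      using integral_inner_left[where c = b, OF that[unfolded set_integrable_def]]
      by (simp add: set_lebesgue_integral_def mult.assoc)
    have "(LINT x:\<Omega>|lebesgue. partial_deriv i \<phi> x *\<^sub>R c)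
        = (LINT x:\<Omega>|lebesgue. partial_deriv i \<phi> x) *\<^sub>R c"
    proof (cases "c = 0")
      case False
      have "integrable lebesgue (\<lambda>x. indicator \<Omega> x *\<^sub>R partial_deriv i \<phi> x)"
        using test_function_integrable(1)[OF L1_loc_const[of \<Omega> "1::real"] \<phi>]
            by (simp add: set_integrable_def)
      from integral_scaleR_left[OF this, of c] show ?thesis by (simp add: set_lebesgue_integral_def)
    qed simp
    then have z: "(LINT x:\<Omega>|lebesgue. partial_deriv i \<phi> x *\<^sub>R c) = 0"
      by (simp add: test_partial_integral[OF \<phi>])
    have "(LINT x:\<Omega>|lebesgue. partial_deriv i \<phi> x *\<^sub>R ((v x - c) \<bullet> b))
        = (LINT x:\<Omega>|lebesgue. partial_deriv i \<phi> x *\<^sub>R (v x - c)) \<bullet> b"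
      by (rule inn[OF I(4)])
    also have "(LINT x:\<Omega>|lebesgue. partial_deriv i \<phi> x *\<^sub>R (v x - c))
        = (LINT x:\<Omega>|lebesgue. partial_deriv i \<phi> x *\<^sub>R v x)
        - (LINT x:\<Omega>|lebesgue. partial_deriv i \<phi> x *\<^sub>R c)"
      unfolding scaleR_diff_right by (rule set_integral_diff(2)[OF I(1,2)])
    also have "\<dots> = - (LINT x:\<Omega>|lebesgue. \<phi> x *\<^sub>R g x)" using eq[OF \<phi>] z by simp
    also have "\<dots> \<bullet> b = - (LINT x:\<Omega>|lebesgue. \<phi> x *\<^sub>R (g x \<bullet> b))"
        by (simp only: inn[OF I(3)] inner_minus_left)
    finally show ?thesis .
  qed
  then show ?thesis unfolding has_weak_partial_def
    by (intro conjI allI impI inner[OF diff] inner[OF L1(2)])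
qed

text \<open>\<open>weak_zero_AE\<close> applied to each component of the difference. It is needed
  because \<open>weak_partial\<close> selects an arbitrary representative.\<close>

lemma has_weak_partial_unique:
  fixes v :: "real^2 \<Rightarrow> 'a::euclidean_space"
  assumes "open \<Omega>" and g: "has_weak_partial \<Omega> i v g" and h: "has_weak_partial \<Omega> i v h"
  shows "AE x in lebesgue. x \<in> \<Omega> \<longrightarrow> g x = h x"
proof -
  have "AE x in lebesgue. x \<in> \<Omega> \<longrightarrow> g x \<bullet> b - h x \<bullet> b = 0" for b
  proof (rule weak_zero_AE[OF \<open>open \<Omega>\<close>])
    have G: "L1_loc \<Omega> (\<lambda>x. g x \<bullet> b)" "L1_loc \<Omega> (\<lambda>x. h x \<bullet> b)"
      using has_weak_partial_inner[OF g] has_weak_partial_inner[OF h]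
          by (auto simp: has_weak_partial_def)
    then show "L1_loc \<Omega> (\<lambda>x. g x \<bullet> b - h x \<bullet> b)"
      unfolding L1_loc_def by (auto intro: set_integral_diff)
    fix \<phi> assume \<phi>: "test_function \<Omega> \<phi>"
    have I: "set_integrable lebesgue \<Omega> (\<lambda>x. \<phi> x *\<^sub>R (g x \<bullet> b))"
        "set_integrable lebesgue \<Omega> (\<lambda>x. \<phi> x *\<^sub>R (h x \<bullet> b))"
      by (rule test_function_integrable(2)[OF _ \<phi>], rule G)+
    have "(LINT x:\<Omega>|lebesgue. \<phi> x *\<^sub>R (g x \<bullet> b - h x \<bullet> b)) = (LINT x:\<Omega>|lebesgue. \<phi> x *\<^sub>R (g x \<bullet> b))
        - (LINT x:\<Omega>|lebesgue. \<phi> x *\<^sub>R (h x \<bullet> b))"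
      unfolding scaleR_diff_right by (rule set_integral_diff(2)[OF I])
    also have "\<dots> = 0"
    proof -
      have "(LINT x:\<Omega>|lebesgue. partial_deriv i \<phi> x *\<^sub>R ((v x - 0) \<bullet> b)) =
          - (LINT x:\<Omega>|lebesgue. \<phi> x *\<^sub>R (g x \<bullet> b))"
        "(LINT x:\<Omega>|lebesgue. partial_deriv i \<phi> x *\<^sub>R ((v x - 0) \<bullet> b)) =
            - (LINT x:\<Omega>|lebesgue. \<phi> x *\<^sub>R (h x \<bullet> b))"
        using has_weak_partial_inner[OF g, of 0 b] has_weak_partial_inner[OF h, of 0 b] \<phi>
        unfolding has_weak_partial_def by blast+
      then show ?thesis by linarith
    qed
    finally show "(LINT x:\<Omega>|lebesgue. \<phi> x *\<^sub>R (g x \<bullet> b - h x \<bullet> b)) = 0" .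
  qed
  then have "AE x in lebesgue. \<forall>b\<in>Basis. x \<in> \<Omega> \<longrightarrow> g x \<bullet> b - h x \<bullet> b = 0"
    by (intro AE_finite_allI) auto
  then show ?thesis by eventually_elim (auto intro: euclidean_eqI)
qed

text \<open>Once the weak gradient vanishes near \<open>p\<close>, the mollifications of
  \<open>u\<close> are constant there. They converge to the continuous function \<open>u\<close>,
  which is 0 at \<open>p\<close>. The radius depends on \<rho> alone, neither on \<open>A\<close>
  nor on the constants in the vanishing condition.\<close>

lemma zero_near_point:
  fixes p :: "real^2" and u :: "real^2 \<Rightarrow> real" and g e :: "2 \<Rightarrow> real^2 \<Rightarrow> real" and A ::
      "real^2 \<Rightarrow> real^2"
  assumes \<rho>: "\<rho> > 0" and sub: "cball p (2 * \<rho>) \<subseteq> \<Omega>"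
    and wp: "\<And>i. has_weak_partial \<Omega> i u (g i)" "\<And>i. has_weak_partial \<Omega> i (g i) (e i)"
    and sq: "\<And>i. set_integrable lebesgue (cball p (2 * \<rho>)) (\<lambda>x. (g i x)\<^sup>2)"
      "\<And>i. set_integrable lebesgue (cball p (2 * \<rho>)) (\<lambda>x. (e i x)\<^sup>2)"
      "set_integrable lebesgue (cball p (2 * \<rho>)) (\<lambda>x. (norm (A x))\<^sup>2)"
    and pde: "AE x in lebesgue. x \<in> \<Omega> \<longrightarrow> e 1 x + e 2 x + (A x $ 1 * g 1 x + A x $ 2 * g 2 x) = 0"
    and cont: "continuous_on \<Omega> u"
    and van: "\<And>N::nat. \<exists>C>0. \<exists>r>0. \<forall>z\<in>\<Omega>. norm (z - p) < r \<longrightarrow> \<bar>u z\<bar> \<le> C * norm (z - p) ^ N"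
    and x: "x \<in> ball p (\<rho> / 4)"
  shows "u x = 0"
proof -
  let ?K = "cball p (2 * \<rho>)"
  have K: "compact ?K" by simp
  define u0 where "u0 y = indicator ?K y * u y" for y
  have u0: "integrable lborel u0"
    using borel_integrable_compact[OF K continuous_on_subset[OF cont sub]]
        by (simp add: u0_def[abs_def])
  have u0ae: "AE y in lebesgue. u0 y = indicator ?K y * u y" by (simp add: u0_def)
  have "\<forall>i. \<exists>f0. integrable lborel f0 \<and> (AE y in lebesgue. f0 y = indicator ?K y * g i y)"
    using wp(2) K sub by (intro allI borel_representative)
        (auto simp: has_weak_partial_def L1_loc_def)
  then obtain g0 where g0: "\<And>i. integrable lborel (g0 i)"
      "\<And>i. AE y in lebesgue. g0 i y = indicator ?K y * g i y"
    by metis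
  have "\<forall>i. \<exists>f0. integrable lborel f0 \<and> (AE y in lebesgue. f0 y = indicator ?K y * e i y)"
    using wp(2) K sub by (intro allI borel_representative)
        (auto simp: has_weak_partial_def L1_loc_def)
  then obtain e0 where e0: "\<And>i. integrable lborel (e0 i)"
      "\<And>i. AE y in lebesgue. e0 i y = indicator ?K y * e i y"
    by metis
  obtain A0' where A0': "integrable lborel A0'"
      "AE y in lebesgue. A0' y = indicator ?K y * (norm (A y))\<^sup>2"
    using borel_representative[OF sq(3)] by blast
  \<comment> \<open>The Borel representative may be negative on a null set; the absolute value makes
    it nonnegative everywhere.\<close>
  define A0 where "A0 y = \<bar>A0' y\<bar>" for y
  have A0: "integrable lborel A0" "\<And>y. 0 \<le> A0 y" using A0'(1) by (auto simp: A0_def[abs_def])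
  define d0 where "d0 y = e0 1 y + e0 2 y" for y
  have d0: "integrable lborel d0" using e0 by (simp add: d0_def[abs_def])
  have sq0: "integrable lborel (\<lambda>y. (g0 i y)\<^sup>2)" "integrable lborel (\<lambda>y. (e0 i y)\<^sup>2)" for i
    using borel_representative_power2[OF g0 sq(1)] borel_representative_power2[OF e0 sq(2)] by auto
  have d0sq: "integrable lborel (\<lambda>y. (d0 y)\<^sup>2)"
  proof (rule Bochner_Integration.integrable_bound[of _ "\<lambda>y. 2 * (e0 1 y)\<^sup>2 + 2 * (e0 2 y)\<^sup>2"])
    show "integrable lborel (\<lambda>y. 2 * (e0 1 y)\<^sup>2 + 2 * (e0 2 y)\<^sup>2)" using sq0 by simp
    show "(\<lambda>y. (d0 y)\<^sup>2) \<in> borel_measurable lborel" using d0 by simp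
    show "AE y in lborel. norm ((d0 y)\<^sup>2) \<le> norm (2 * (e0 1 y)\<^sup>2 + 2 * (e0 2 y)\<^sup>2)"
    proof (rule AE_I2)
      fix y
      show "norm ((d0 y)\<^sup>2) \<le> norm (2 * (e0 1 y)\<^sup>2 + 2 * (e0 2 y)\<^sup>2)"
        using sum_squares_bound[of "e0 1 y" "e0 2 y"] zero_le_power2[of "d0 y"]
        unfolding d0_def real_norm_def power2_sum by linarith
    qed
  qed
  have "AE y in lebesgue. (d0 y)\<^sup>2 \<le> A0 y * ((g0 1 y)\<^sup>2 + (g0 2 y)\<^sup>2)"
    using e0(2)[of 1] e0(2)[of 2] g0(2)[of 1] g0(2)[of 2] A0'(2) pde
  proof eventually_elim
    fix y assume y: "e0 1 y = indicator ?K y * e 1 y" "e0 2 y = indicator ?K y * e 2 y"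
      "g0 1 y = indicator ?K y * g 1 y" "g0 2 y = indicator ?K y * g 2 y"
      "A0' y = indicator ?K y * (norm (A y))\<^sup>2"
      "y \<in> \<Omega> \<longrightarrow> e 1 y + e 2 y + (A y $ 1 * g 1 y + A y $ 2 * g 2 y) = 0"
    show "(d0 y)\<^sup>2 \<le> A0 y * ((g0 1 y)\<^sup>2 + (g0 2 y)\<^sup>2)"
    proof (cases "y \<in> ?K")
      case True
      then have "y \<in> \<Omega>" using sub by blast
      then have d: "d0 y = - (A y $ 1 * g 1 y + A y $ 2 * g 2 y)" using y True
          by (simp add: d0_def del: mem_cball)
      have n: "(norm (A y))\<^sup>2 = (A y $ 1)\<^sup>2 + (A y $ 2)\<^sup>2"
        by (simp add: norm_vec_def L2_set_def sum_2 add_nonneg_nonneg)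
      have "(A y $ 1 * g 1 y + A y $ 2 * g 2 y)\<^sup>2
          \<le> ((A y $ 1)\<^sup>2 + (A y $ 2)\<^sup>2) * ((g 1 y)\<^sup>2 + (g 2 y)\<^sup>2)"
        using zero_le_power2[of "A y $ 1 * g 2 y - A y $ 2 * g 1 y"]
            by (simp add: power2_eq_square algebra_simps)
      then show ?thesis using y True unfolding d power2_minus n[symmetric]
          by (simp add: A0_def del: mem_cball)
    next
      case False
      then show ?thesis using y by (simp add: d0_def del: mem_cball)
    qed
  qed
  then have dA: "AE y in lborel. (d0 y)\<^sup>2 \<le> A0 y * ((g0 1 y)\<^sup>2 + (g0 2 y)\<^sup>2)"
      by (simp add: AE_completion_iff)
  have rel: "conv H (Suc i) j u0 y = conv H i j (g0 1) y"
      "conv H i (Suc j) u0 y = conv H i j (g0 2) y"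
    "conv H (Suc i) j (g0 1) y = conv H i j (e0 1) y"
        "conv H i (Suc j) (g0 2) y = conv H i j (e0 2) y"
    if "mollifier \<epsilon> H" "\<epsilon> \<le> \<rho> / 4" "y \<in> cball p (3/2 * \<rho>)" for \<epsilon> H i j y
  proof -
    have c: "cball y (2 * \<epsilon>) \<subseteq> ?K"
    proof
      fix z assume "z \<in> cball y (2 * \<epsilon>)"
      then show "z \<in> ?K" using that dist_triangle[of p z y] by auto
    qed
    note W1 = weak_partial_conv[OF that(1) c sub K u0 u0ae g0(1) g0(2)]
    note W2 = weak_partial_conv[OF that(1) c sub K g0(1) g0(2) e0(1) e0(2)]
    show "conv H (Suc i) j u0 y = conv H i j (g0 1) y" "conv H i (Suc j) u0 y = conv H i j (g0 2) y"
      by (rule W1 wp)+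
    show "conv H (Suc i) j (g0 1) y = conv H i j (e0 1) y"
        "conv H i (Suc j) (g0 2) y = conv H i j (e0 2) y"
      by (rule W2 wp)+
  qed
  have grad: "has_local_gradient p \<rho> u0 (g0 1) (g0 2) d0"
    unfolding has_local_gradient_def
  proof (intro conjI allI impI u0 g0 d0)
    fix \<epsilon> H y assume a: "mollifier \<epsilon> H" "\<epsilon> \<le> \<rho> / 4" "y \<in> cball p (3/2 * \<rho>)"
    show "conv H 1 0 u0 y = conv H 0 0 (g0 1) y" using rel(1)[OF a, of 0 0] by simp
    show "conv H 0 1 u0 y = conv H 0 0 (g0 2) y" using rel(2)[OF a, of 0 0] by simp
    have "conv H 2 0 u0 y = conv H 0 0 (e0 1) y" "conv H 0 2 u0 y = conv H 0 0 (e0 2) y"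
      using rel(1)[OF a, of 1 0] rel(3)[OF a, of 0 0] rel(2)[OF a, of 0 1] rel(4)[OF a, of 0 0]
          by (simp_all add: numeral_2_eq_2)
    then show "conv H 2 0 u0 y + conv H 0 2 u0 y = conv H 0 0 d0 y"
      unfolding d0_def[abs_def] conv_add[OF a(1) e0(1) e0(1)] by simp
  qed
  have u0K: "u0 y = u y" if "y \<in> ?K" for y using that by (simp add: u0_def del: mem_cball)
  have cont0: "continuous_on ?K u0"
    using continuous_on_subset[OF cont sub] by (rule continuous_on_eq)
        (simp add: u0K del: mem_cball)
  have van0: "\<exists>C. \<forall>y\<in>?K. \<bar>u0 y\<bar> \<le> C * dist y p ^ N" for N
  proof -
    obtain C r where C: "C > 0" "r > 0" "\<And>z. z \<in> \<Omega> \<Longrightarrow> norm (z - p) < r \<Longrightarrow> \<bar>u z\<bar>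
        \<le> C * norm (z - p) ^ N"
      using van by metis
    have "bounded (u ` ?K)"
      by (intro compact_imp_bounded compact_continuous_image K continuous_on_subset[OF cont sub])
    then obtain B where B: "\<And>z. z \<in> ?K \<Longrightarrow> \<bar>u z\<bar> \<le> B" unfolding bounded_iff
        by (auto simp del: mem_cball)
    \<comment> \<open>The bound of order \<open>N\<close> is given only within distance
      \<open>r\<close> of \<open>p\<close>. Further out \<open>dist y p ^ N\<close> is at least
      \<open>r ^ N\<close>, so the maximum \<open>B\<close> of |u| divided by \<open>r ^ N\<close>
      serves as constant.\<close>
    have "\<bar>u0 y\<bar> \<le> max C (B / r ^ N) * dist y p ^ N" if y: "y \<in> ?K" for y
    proof (cases "dist y p < r")
      case True
      have "\<bar>u y\<bar> \<le> C * dist y p ^ N" using C(3)[of y] True y sub by (auto simp: dist_norm)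
      also have "\<dots> \<le> max C (B / r ^ N) * dist y p ^ N" by (intro mult_right_mono) auto
      finally show ?thesis by (simp add: u0K[OF y])
    next
      case False
      have B0: "0 \<le> B" using B[OF y] by linarith
      have "r ^ N \<le> dist y p ^ N" using False C(2) by (intro power_mono) auto
      then have "B / r ^ N * r ^ N \<le> max C (B / r ^ N) * dist y p ^ N"
        using B0 C by (intro mult_mono) auto
      then show ?thesis using B[OF y] C(2) by (simp add: u0K[OF y])
    qed
    then show ?thesis by blast
  qed
  have zero: "AE y in lborel. y \<in> cball p (\<rho> / 2) \<longrightarrow> g0 1 y = 0 \<and> g0 2 y = 0"
    by (rule gradient_zero_near[OF \<rho> grad sq0(1) sq0(1) d0sq A0 dA cont0 van0])
  \<comment> \<open>With \<epsilon> \<le> \<rho> / 8 the kernel centred in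
    \<open>ball p (\<rho> / 4)\<close> lives in \<open>cball p (\<rho> / 2)\<close>, where the
    gradient vanishes.\<close>
  obtain \<epsilon> H where \<epsilon>: "\<And>m. 0 < \<epsilon> m" "\<And>m. \<epsilon> m \<le> \<rho> / 8" "\<epsilon> \<longlonglongrightarrow> 0" and H: "\<And>m. mollifier (\<epsilon> m) (H m)"
    using mollifier_sequence[of "\<rho> / 8" u0 u0] u0 \<rho> by auto
  have cz: "conv (H m) 1 0 u0 y = 0 \<and> conv (H m) 0 1 u0 y = 0" if y: "y \<in> ball p (\<rho> / 4)" for m y
  proof -
    have y': "y \<in> cball p (3/2 * \<rho>)" "\<epsilon> m \<le> \<rho> / 4" using y \<rho> \<epsilon>(2)[of m] by auto
    have cc: "conv (H m) 0 0 (g0 i) y = 0" if i: "i = 1 \<or> i = 2" for i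
    proof -
      have "AE z in lborel. H m 0 (y $ 1 - z $ 1) * H m 0 (y $ 2 - z $ 2) * g0 i z = 0"
        using zero
      proof eventually_elim
        fix z assume z: "z \<in> cball p (\<rho> / 2) \<longrightarrow> g0 1 z = 0 \<and> g0 2 z = 0"
        show "H m 0 (y $ 1 - z $ 1) * H m 0 (y $ 2 - z $ 2) * g0 i z = 0"
        proof (cases "H m 0 (y $ 1 - z $ 1) * H m 0 (y $ 2 - z $ 2) = 0")
          case False
          then have "dist y z \<le> 2 * \<epsilon> m" by (rule kernel_support[OF H])
          then have "z \<in> cball p (\<rho> / 2)" using y \<epsilon>(2)[of m] dist_triangle[of p z y] by auto
          then show ?thesis using z i by auto
        qed (simp only: mult_zero_left)
      qed
      then show ?thesis unfolding conv_def by (rule integral_eq_zero_AE)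
    qed
    show ?thesis using cc[of 1] cc[of 2] rel(1,2)[OF H y'(2,1), of 0 0] by simp
  qed
  \<comment> \<open>From \<open>p\<close> to \<open>x\<close> along two axis-parallel segments. In
    each coordinate their points differ from \<open>p\<close> by at most as much as \<open>x\<close>
    does, so they stay in the ball.\<close>
  have const: "conv (H m) 0 0 u0 x = conv (H m) 0 0 u0 p" for m
  proof -
    note D = conv_has_partial[OF H u0, of m 0 0]
    let ?F = "conv (H m) 0 0 u0"
    have mvt: "?F (a + s *\<^sub>R axis i 1) = ?F a"
      if "has_partial i ?F F'" "\<And>t. \<bar>t\<bar> \<le> \<bar>s\<bar> \<Longrightarrow> F' (a + t *\<^sub>R axis i 1) = 0" for a s i F'
    proof -
      have "\<exists>c. \<forall>t\<in>{-\<bar>s\<bar>..\<bar>s\<bar>}. ?F (a + t *\<^sub>R axis i 1) = c"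
      proof (rule has_field_derivative_zero_constant)
        fix t assume "t \<in> {-\<bar>s\<bar>..\<bar>s\<bar>}"
        then have "F' (a + t *\<^sub>R axis i 1) = 0" by (intro that(2)) auto
        then show "((\<lambda>t. ?F (a + t *\<^sub>R axis i 1)) has_real_derivative 0) (at t within {-\<bar>s\<bar>..\<bar>s\<bar>})"
          using has_partial_line[OF that(1), of a t] by (simp add: has_field_derivative_at_within)
      qed simp
      then obtain c where c: "\<And>t. t \<in> {-\<bar>s\<bar>..\<bar>s\<bar>} \<Longrightarrow> ?F (a + t *\<^sub>R axis i 1) = c" by blast
      have "s \<in> {-\<bar>s\<bar>..\<bar>s\<bar>}" by auto
      then show ?thesis using c[of s] c[of 0] by simp
    qed
    define s where "s = x - p"
    have xs: "norm s < \<rho> / 4" using x by (simp add: s_def dist_norm norm_minus_commute)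
    have n2: "norm w = sqrt ((w $ 1)\<^sup>2 + (w $ 2)\<^sup>2)" for w :: "real^2"
      by (simp add: norm_vec_def L2_set_def sum_2)
    have inb: "p + w \<in> ball p (\<rho> / 4)" if "\<bar>w $ 1\<bar> \<le> \<bar>s $ 1\<bar>" "\<bar>w $ 2\<bar> \<le> \<bar>s $ 2\<bar>" for w
    proof -
      have "norm w \<le> norm s" unfolding n2 using that
          by (intro real_sqrt_le_mono add_mono) (auto simp: abs_le_square_iff)
      then show ?thesis using xs by (simp add: dist_norm)
    qed
    have "?F (p + (s $ 1) *\<^sub>R axis 1 1) = ?F p"
    proof (rule mvt[OF D(1)])
      fix t assume "\<bar>t\<bar> \<le> \<bar>s $ 1\<bar>"
      then have "p + t *\<^sub>R axis 1 1 \<in> ball p (\<rho> / 4)" by (intro inb) (auto simp: axis_def)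
      then show "conv (H m) (Suc 0) 0 u0 (p + t *\<^sub>R axis 1 1) = 0" using cz[of _ m] by simp
    qed
    moreover have "?F ((p + (s $ 1) *\<^sub>R axis 1 1) + (s $ 2) *\<^sub>R axis 2 1)
        = ?F (p + (s $ 1) *\<^sub>R axis 1 1)"
    proof (rule mvt[OF D(2)])
      fix t assume "\<bar>t\<bar> \<le> \<bar>s $ 2\<bar>"
      then have "p + ((s $ 1) *\<^sub>R axis 1 1 + t *\<^sub>R axis 2 1) \<in> ball p (\<rho> / 4)"
          by (intro inb) (auto simp: axis_def)
      then show "conv (H m) 0 (Suc 0) u0 (p + (s $ 1) *\<^sub>R axis 1 1 + t *\<^sub>R axis 2 1) = 0"
          using cz[of _ m] by (simp add: add.assoc)
    qed
    moreover have "(p + (s $ 1) *\<^sub>R axis 1 1) + (s $ 2) *\<^sub>R axis 2 1 = x"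
      by (simp add: vec_eq_iff forall_2 axis_def s_def)
    ultimately show ?thesis by simp
  qed
  have lim: "(\<lambda>m. conv (H m) 0 0 u0 y) \<longlonglongrightarrow> u0 y" if y: "y \<in> ball p (\<rho> / 4)" for y
  proof (rule tendstoI)
    fix \<eta> :: real assume \<eta>: "\<eta> > 0"
    have yK: "y \<in> ?K" using y \<rho> by auto
    obtain r where r: "r > 0" "\<And>z. z \<in> ?K \<Longrightarrow> dist z y < r \<Longrightarrow> dist (u0 z) (u0 y) < \<eta> / 2"
      using cont0 yK \<eta> unfolding continuous_on_iff by (metis half_gt_zero)
    have "eventually (\<lambda>m. \<epsilon> m < r / 2) sequentially"
      using \<epsilon>(3) r(1) by (intro order_tendstoD) auto
    then show "\<forall>\<^sub>F m in sequentially. dist (conv (H m) 0 0 u0 y) (u0 y) < \<eta>"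
    proof eventually_elim
      case (elim m)
      have "\<bar>conv (H m) 0 0 u0 y - u0 y\<bar> \<le> \<eta> / 2"
      proof (rule conv_local[OF H u0])
        fix z assume z: "dist y z \<le> 2 * \<epsilon> m"
        have "z \<in> ?K" using z y \<epsilon>(2)[of m] \<rho> dist_triangle[of p z y] by auto
        moreover have "dist z y < r" using z elim by (simp add: dist_commute)
        ultimately show "\<bar>u0 z - u0 y\<bar> \<le> \<eta> / 2" using r(2)[of z] by (simp add: dist_real_def)
      qed
      then show ?case using \<eta> by (simp add: dist_real_def)
    qed
  qed
  have p: "p \<in> ball p (\<rho> / 4)" "p \<in> ?K" "x \<in> ?K" using \<rho> x by auto
  have "u0 x = u0 p"
    using LIMSEQ_unique[OF lim[OF x] lim[OF p(1), folded const]] .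
  moreover have "u0 p = 0"
  proof -
    \<comment> \<open>Order 1 is taken, since order 0 would leave the factor 0 ^ 0 = 1.\<close>
    obtain C where "\<bar>u0 p\<bar> \<le> C * dist p p ^ 1" using van0[of 1] p(2) by blast
    then show ?thesis by simp
  qed
  ultimately show ?thesis using u0K[OF p(3)] by simp
qed

section \<open>Selected representatives of weak derivatives, and propagation over the domain\<close>

lemma has_weak_partial_weak_partial:
  "has_weak_partial \<Omega> i u g \<Longrightarrow> has_weak_partial \<Omega> i u (weak_partial \<Omega> i u)"
  unfolding weak_partial_def by (rule someI[of "\<lambda>g. has_weak_partial \<Omega> i u g"])

lemma has_weak_partial_cong_AE:
  fixes f f' :: "real^'n::finite \<Rightarrow> 'a::euclidean_space"
  assumes h: "has_weak_partial \<Omega> i f h" and f': "L1_loc \<Omega> f'"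
    and eq: "AE x in lebesgue. x \<in> \<Omega> \<longrightarrow> f' x = f x"
  shows "has_weak_partial \<Omega> i f' h"
proof -
  have L1: "L1_loc \<Omega> f" "L1_loc \<Omega> h" and
    heq: "\<And>\<phi>. test_function \<Omega> \<phi> \<Longrightarrow>
        (LINT x:\<Omega>|lebesgue. partial_deriv i \<phi> x *\<^sub>R f x) = - (LINT x:\<Omega>|lebesgue. \<phi> x *\<^sub>R h x)"
    using h by (auto simp: has_weak_partial_def)
  have "(LINT x:\<Omega>|lebesgue. partial_deriv i \<phi> x *\<^sub>R f' x) = - (LINT x:\<Omega>|lebesgue. \<phi> x *\<^sub>R h x)"
    if \<phi>: "test_function \<Omega> \<phi>" for \<phi>
  proof -
    note test_function_integrable(1)[OF L1(1) \<phi>, of i] test_function_integrable(1)[OF f' \<phi>, of i]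
    moreover have "AE x in lebesgue. indicator \<Omega> x *\<^sub>R (partial_deriv i \<phi> x *\<^sub>R f' x)
        = indicator \<Omega> x *\<^sub>R (partial_deriv i \<phi> x *\<^sub>R f x)"
      using eq by eventually_elim (auto simp: indicator_def)
    ultimately have "(LINT x:\<Omega>|lebesgue. partial_deriv i \<phi> x *\<^sub>R f' x)
        = (LINT x:\<Omega>|lebesgue. partial_deriv i \<phi> x *\<^sub>R f x)"
      unfolding set_lebesgue_integral_def set_integrable_def by (intro integral_cong_AE) auto
    then show ?thesis using heq[OF \<phi>] by simp
  qed
  then show ?thesis unfolding has_weak_partial_def by (intro conjI allI impI f' L1)
qed

lemma L2_on_inner_square:
  fixes f :: "real^'n::finite \<Rightarrow> 'a::euclidean_space"
  assumes "L2_on K f" "b \<in> Basis"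
  shows "set_integrable lebesgue K (\<lambda>x. (f x \<bullet> b)\<^sup>2)"
  unfolding set_integrable_def
proof (rule Bochner_Integration.integrable_bound)
  show "integrable lebesgue (\<lambda>x. indicator K x *\<^sub>R (norm (f x))\<^sup>2)"
    using assms by (simp add: L2_on_def set_integrable_def)
  have "(\<lambda>x. ((indicator K x *\<^sub>R f x) \<bullet> b)\<^sup>2) \<in> borel_measurable lebesgue"
    using assms(1) by (intro borel_measurable_power borel_measurable_inner borel_measurable_const)
      (simp add: L2_on_def set_borel_measurable_def)
  moreover have "(\<lambda>x. ((indicator K x *\<^sub>R f x) \<bullet> b)\<^sup>2) = (\<lambda>x. indicator K x *\<^sub>R (f x \<bullet> b)\<^sup>2)"
    by (auto simp: indicator_def fun_eq_iff)
  ultimately show "(\<lambda>x. indicator K x *\<^sub>R (f x \<bullet> b)\<^sup>2) \<in> borel_measurable lebesgue" by simp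
  show "AE x in lebesgue. norm (indicator K x *\<^sub>R (f x \<bullet> b)\<^sup>2)
      \<le> norm (indicator K x *\<^sub>R (norm (f x))\<^sup>2)"
  proof (rule AE_I2)
    fix x
    have "\<bar>f x \<bullet> b\<bar>\<^sup>2 \<le> (norm (f x))\<^sup>2" using Basis_le_norm[OF assms(2)] by (intro power_mono) auto
    then show "norm (indicator K x *\<^sub>R (f x \<bullet> b)\<^sup>2) \<le> norm (indicator K x *\<^sub>R (norm (f x))\<^sup>2)"
      by (simp add: indicator_def)
  qed
qed

(* The sort of 'a is satisfied by real and by complex (and, up to isomorphism, by nothing else),
   so the theorem covers real-valued and complex-valued v alike. *)
theorem corollary3p5:
  fixes \<Omega> :: "(real ^ 2) set"
    and A :: "real ^ 2 \<Rightarrow> real ^ 2"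
    and v :: "real ^ 2 \<Rightarrow> 'a::{real_normed_field, euclidean_space}"
    and z0 :: "real ^ 2"
  assumes "open \<Omega>" and "connected \<Omega>"
    and "L2_on \<Omega> A"
    and "W2_loc 2 \<Omega> v" and "continuous_on \<Omega> v"
    and "AE x in lebesgue. x \<in> \<Omega> \<longrightarrow>
           weak_laplacian \<Omega> v x + (\<Sum>i\<in>UNIV. A x $ i *\<^sub>R weak_partial \<Omega> i v x) = 0"
    and "z0 \<in> \<Omega>"
    and "\<forall>N::nat. \<exists>C>0. \<exists>r>0. \<forall>z\<in>\<Omega>. norm (z - z0) < r \<longrightarrow>
           norm (v z - v z0) \<le> C * norm (z - z0) ^ N"
  shows "\<forall>z\<in>\<Omega>. v z = v z0"
proof -
  have "\<forall>i. \<exists>g. has_weak_partial \<Omega> i v g \<and> L2_loc \<Omega> g \<and> (\<exists>h. has_weak_partial \<Omega> i g h \<and> L2_loc \<Omega> h)"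
    using assms(4) by (fastforce simp: numeral_2_eq_2)
  then obtain g h where g: "\<And>i. has_weak_partial \<Omega> i v (g i)" "\<And>i. L2_loc \<Omega> (g i)"
    and h: "\<And>i. has_weak_partial \<Omega> i (g i) (h i)" "\<And>i. L2_loc \<Omega> (h i)"
    by metis
  let ?G = "\<lambda>i. weak_partial \<Omega> i v"
  have G: "has_weak_partial \<Omega> i v (?G i)" for i using has_weak_partial_weak_partial[OF g(1)] .
  \<comment> \<open>The equation speaks of the representatives selected by
    \<open>weak_partial\<close>, the L^2 bounds of those provided by \<open>W2_loc\<close>. They are
    identified almost everywhere.\<close>
  have Gg: "AE x in lebesgue. x \<in> \<Omega> \<longrightarrow> ?G i x = g i x" for i
    by (rule has_weak_partial_unique[OF assms(1) G g(1)])
  have "L1_loc \<Omega> (?G i)" for i using G by (simp add: has_weak_partial_def)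
  \<comment> \<open>Before the second selection says anything, the selected first derivative must be
    known to have a weak derivative; \<open>h i\<close> is one.\<close>
  then have Gh: "has_weak_partial \<Omega> i (?G i) (h i)" for i
    using Gg by (intro has_weak_partial_cong_AE[OF h(1)])
  have GGh: "AE x in lebesgue. x \<in> \<Omega> \<longrightarrow> weak_partial \<Omega> i (?G i) x = h i x" for i
    by (rule has_weak_partial_unique[OF assms(1) has_weak_partial_weak_partial[OF Gh] Gh])
  have pde: "AE x in lebesgue. x \<in> \<Omega> \<longrightarrow> h 1 x + h 2 x + (A x $ 1 *\<^sub>R g 1 x + A x $ 2 *\<^sub>R g 2 x) = 0"
    using Gg[of 1] Gg[of 2] GGh[of 1] GGh[of 2] assms(6)
    by eventually_elim (auto simp: weak_laplacian_def sum_2)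
  have near: "v x = v z0"
    if \<rho>: "\<rho> > 0" and sub: "cball p (2 * \<rho>) \<subseteq> \<Omega>" and x: "x \<in> ball p (\<rho> / 4)"
      and van: "\<forall>N::nat. \<exists>C>0. \<exists>r>0. \<forall>z\<in>\<Omega>. norm (z - p) < r \<longrightarrow> norm (v z - v z0)
          \<le> C * norm (z - p) ^ N"
    for p x \<rho>
  proof -
    let ?K = "cball p (2 * \<rho>)"
    have L2: "L2_on ?K (g i)" "L2_on ?K (h i)" for i
      by (rule g(2)[unfolded L2_loc_def, rule_format, OF conjI[OF compact_cball sub]]
          h(2)[unfolded L2_loc_def, rule_format, OF conjI[OF compact_cball sub]])+
    have AK: "set_integrable lebesgue ?K (\<lambda>x. (norm (A x))\<^sup>2)"
    proof (rule set_integrable_subset[OF _ _ sub])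
      show "set_integrable lebesgue \<Omega> (\<lambda>x. (norm (A x))\<^sup>2)" using assms(3) by (simp only: L2_on_def)
    qed simp
    have zero: "(v x - v z0) \<bullet> b = 0" if b: "b \<in> Basis" for b
    proof (rule zero_near_point[where u = "\<lambda>x. (v x - v z0) \<bullet> b" and x = x and g =
        "\<lambda>i x. g i x \<bullet> b" and e = "\<lambda>i x. h i x \<bullet> b" and A = A and \<Omega> = \<Omega> and \<rho> = \<rho> and p = p])
      show "has_weak_partial \<Omega> i (\<lambda>x. (v x - v z0) \<bullet> b) (\<lambda>x. g i x \<bullet> b)" for i
        by (rule has_weak_partial_inner[OF g(1)])
      show "has_weak_partial \<Omega> i (\<lambda>x. g i x \<bullet> b) (\<lambda>x. h i x \<bullet> b)" for i
        using has_weak_partial_inner[OF h(1), of i 0 b] by simp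
      show "set_integrable lebesgue ?K (\<lambda>x. (g i x \<bullet> b)\<^sup>2)"
          "set_integrable lebesgue ?K (\<lambda>x. (h i x \<bullet> b)\<^sup>2)" for i
        by (intro L2_on_inner_square L2 b)+
      show "AE x in lebesgue. x \<in> \<Omega> \<longrightarrow>
          h 1 x \<bullet> b + h 2 x \<bullet> b + (A x $ 1 * (g 1 x \<bullet> b) + A x $ 2 * (g 2 x \<bullet> b)) = 0"
        using pde
      proof eventually_elim
        fix x assume "x \<in> \<Omega> \<longrightarrow> h 1 x + h 2 x + (A x $ 1 *\<^sub>R g 1 x + A x $ 2 *\<^sub>R g 2 x) = 0"
        then have "x \<in> \<Omega> \<longrightarrow> (h 1 x + h 2 x + (A x $ 1 *\<^sub>R g 1 x + A x $ 2 *\<^sub>R g 2 x)) \<bullet> b = 0" by simp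
        then show "x \<in> \<Omega> \<longrightarrow> h 1 x \<bullet> b + h 2 x \<bullet> b + (A x $ 1 * (g 1 x \<bullet> b) + A x $ 2 * (g 2 x \<bullet> b))
            = 0"
          by (simp only: inner_add_left inner_scaleR_left)
      qed
      show "continuous_on \<Omega> (\<lambda>x. (v x - v z0) \<bullet> b)" by (intro continuous_intros assms(5))
      fix N :: nat
      from van obtain C r where C: "C > 0" "r > 0"
          "\<And>z. z \<in> \<Omega> \<Longrightarrow> norm (z - p) < r \<Longrightarrow> norm (v z - v z0) \<le> C * norm (z - p) ^ N"
        by metis
      show "\<exists>C>0. \<exists>r>0. \<forall>z\<in>\<Omega>. norm (z - p) < r \<longrightarrow> \<bar>(v z - v z0) \<bullet> b\<bar> \<le> C * norm (z - p) ^ N"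
        by (intro exI[of _ C] exI[of _ r] conjI ballI impI C(1,2)
            order_trans[OF Basis_le_norm[OF b] C(3)])
    qed (fact \<rho> sub AK x)+
    have "v x - v z0 = 0"
      by (rule euclidean_eqI) (simp only: inner_zero_left zero)
    then show ?thesis by simp
  qed
  \<comment> \<open>Openness is immediate for this set. For closedness, every point of
    \<open>S\<close> is a zero of infinite order of \<open>v - v z0\<close>, so \<open>near\<close>
    applies at points of \<open>S\<close> close to a given limit point.\<close>
  define S where "S = {p \<in> \<Omega>. \<exists>r>0. \<forall>y\<in>ball p r. v y = v z0}"
  have "openin (top_of_set \<Omega>) S"
  proof -
    have "open S"
      unfolding open_dist
    proof
      fix p assume "p \<in> S"
      then obtain r where r: "p \<in> \<Omega>" "r > 0" "\<And>y. y \<in> ball p r \<Longrightarrow> v y = v z0" by (auto simp: S_def)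
      obtain r' where r': "r' > 0" "ball p r' \<subseteq> \<Omega>" using assms(1) r(1) open_contains_ball by metis
      have "y \<in> S" if y: "dist y p < min (r / 2) r'" for y
      proof -
        have "y \<in> \<Omega>" using y r' by (auto simp: dist_commute)
        moreover have "v z = v z0" if "z \<in> ball y (r / 2)" for z
          using that y r(3)[of z] dist_triangle[of p z y] by (auto simp: dist_commute)
        ultimately show ?thesis using r(2) unfolding S_def by (auto intro!: exI[of _ "r / 2"])
      qed
      then show "\<exists>e>0. \<forall>y. dist y p < e \<longrightarrow> y \<in> S" using r(2) r'(1)
          by (intro exI[of _ "min (r / 2) r'"]) auto
    qed
    then show ?thesis by (simp add: openin_open_eq assms(1) S_def subset_eq)
  qed
  moreover have "closedin (top_of_set \<Omega>) S"
  proof -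
    have "z \<in> S" if z: "z \<in> \<Omega>" "z \<in> closure S" for z
    proof -
      obtain R where R: "R > 0" "cball z R \<subseteq> \<Omega>" using assms(1) z(1) open_contains_cball by metis
      \<comment> \<open>A point \<open>p\<close> of \<open>S\<close> within \<rho> / 4 of
        \<open>z\<close> has \<open>cball p (2 * \<rho>)\<close> inside
        \<open>cball z (3 * \<rho>)\<close>, which is \<open>cball z R\<close>. The ball of radius
        \<rho> / 4 around \<open>p\<close> on which \<open>v\<close> is constant then contains
        \<open>z\<close>.\<close>
      define \<rho> where "\<rho> = R / 3"
      have \<rho>: "\<rho> > 0" using R by (simp add: \<rho>_def)
      obtain p where p: "p \<in> S" "dist p z < \<rho> / 4" using z(2) \<rho> closure_approachable[of z S]
          by (metis divide_pos_pos zero_less_numeral)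
      obtain r where r: "r > 0" "\<And>y. y \<in> ball p r \<Longrightarrow> v y = v z0" using p(1) by (auto simp: S_def)
      have "\<forall>N::nat. \<exists>C>0. \<exists>r>0. \<forall>z\<in>\<Omega>. norm (z - p) < r \<longrightarrow> norm (v z - v z0) \<le> C * norm (z - p) ^ N"
        using r by (intro allI exI[of _ 1] conjI exI[of _ r])
            (auto simp: dist_norm norm_minus_commute)
      moreover have "cball p (2 * \<rho>) \<subseteq> \<Omega>"
      proof
        fix y assume "y \<in> cball p (2 * \<rho>)"
        then have "y \<in> cball z R" using p(2) dist_triangle[of z y p] R(1)
            by (auto simp: \<rho>_def dist_commute)
        then show "y \<in> \<Omega>" using R by blast
      qed
      ultimately have all: "v y = v z0" if "y \<in> ball p (\<rho> / 4)" for y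
        using near[OF \<rho> _ that] by blast
      have "v y = v z0" if "y \<in> ball z (\<rho> / 4 - dist p z)" for y
        using all[of y] that dist_triangle[of p y z] by auto
      moreover have "\<rho> / 4 - dist p z > 0" using p(2) by simp
      ultimately show ?thesis unfolding S_def using z(1) by blast
    qed
    then have "S = \<Omega> \<inter> closure S" using closure_subset[of S] by (auto simp: S_def)
    then show ?thesis by (metis closed_closure closedin_closed)
  qed
  moreover have "S \<noteq> {}"
  proof -
    obtain R where R: "R > 0" "cball z0 R \<subseteq> \<Omega>" using assms(1,7) open_contains_cball by metis
    have "v y = v z0" if "y \<in> ball z0 (R / 2 / 4)" for y
    proof (rule near[OF _ _ that assms(8)])
      show "R / 2 > 0" "cball z0 (2 * (R / 2)) \<subseteq> \<Omega>" using R by simp_all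
    qed
    moreover have "R / 2 / 4 > 0" using R(1) by simp
    ultimately have "z0 \<in> S" unfolding S_def using assms(7) by blast
    then show ?thesis by blast
  qed
  ultimately have "S = \<Omega>" using assms(2) by (auto simp: connected_clopen)
  then show ?thesis unfolding S_def using centre_in_ball by blast
qed

end
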